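(* Let $d\ge 1$ and $k\ge 2$ be integers. Then $\mathbb{F}(k)$, with the norm $\|\cdot\|_{\mathbb{F}(k)}$ and pointwise multiplication of functions, is a Banach algebra; in particular, if $g^1,g^2\in\mathbb{F}(k)$ then $g^1g^2\in\mathbb{F}(k)$ and $\|g^1g^2\|_{\mathbb{F}(k)}\le\|g^1\|_{\mathbb{F}(k)}\|g^2\|_{\mathbb{F}(k)}$.
   Context: A Banach algebra (not required to be unital) is a Banach space with an associative bilinear product whose norm is submultiplicative. Functions are real-valued. Let $\tilde V_k=\{0,1\}^k\setminus\{\vec 0\}$, $p_k=\frac{2^k}{k+1}$ and $q_k=\frac{2^k-1}{k}$. For $\vec h=(h_1,\dots,h_k)\in(\mathbb{R}^d)^k$ and $\alpha\in\tilde V_k$ put $\alpha\cdot\vec h=\alpha_1h_1+\cdots+\alpha_kh_k\in\mathbb{R}^d$. The cubic convolution product is $$D_k(f_\alpha:\alpha\in\tilde V_k)(x)=\int_{\mathbb{R}^{kd}}\prod_{\alpha\in\tilde V_k}f_\alpha(x+\alpha\cdot\vec h)\,d\vec h .$$ Let $\mathcal{L}(k)$ be the convex hull of $$\Big\{D_k(f_\alpha:\alpha\in\tilde V_k): f_\alpha\in L^{q_k}(\mathbb{R}^d)\cap L^{p_k}(\mathbb{R}^d)\text{ for all }\alpha\in\tilde V_k,\ \prod_{\alpha\in\tilde V_k}\|f_\alpha\|_{q_k}\le 1\Big\}.$$ These are bounded continuous functions on $\mathbb{R}^d$. Let $\mathcal{C}$ be the space of bounded continuous functions on $\mathbb{R}^d$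 with the uniform norm $\|\cdot\|_\infty$, and let $\bar{\mathcal{L}}(k)$ be the closure of $\mathcal{L}(k)$ in $(\mathcal{C},\|\cdot\|_\infty)$. Then $\mathbb{F}(k)$ is the linear subspace of $\mathcal{C}$ spanned by $\bar{\mathcal{L}}(k)$, endowed with the norm $\|\cdot\|_{\mathbb{F}(k)}$ whose closed unit ball is $\bar{\mathcal{L}}(k)$, i.e. $\|g\|_{\mathbb{F}(k)}=\inf\{t>0: g\in t\,\bar{\mathcal{L}}(k)\}$. *)

theory Defs
  imports "HOL-Analysis.Analysis"
begin

text \<open>The Lebesgue spaces on \<open>\<real>\<^sup>d\<close>, for a real exponent \<open>q \<ge> 1\<close>. A member is a Borel representative
  of its class; every Lebesgue measurable function agrees almost everywhere with a Borel one.\<close>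

definition Lspace :: "real \<Rightarrow> (real^'d::finite \<Rightarrow> real) set" where
  "Lspace q = {f. f \<in> borel_measurable lborel \<and> integrable lborel (\<lambda>x. \<bar>f x\<bar> powr q)}"

definition Lnorm :: "real \<Rightarrow> (real^'d::finite \<Rightarrow> real) \<Rightarrow> real" where
  "Lnorm q f = (LINT x|lborel. \<bar>f x\<bar> powr q) powr (1 / q)"

definition p_exp :: "nat \<Rightarrow> real" where
  "p_exp k = 2 ^ k / (real k + 1)"

definition q_exp :: "nat \<Rightarrow> real" where
  "q_exp k = (2 ^ k - 1) / real k"

text \<open>Elements of \<open>{0,1}\<^sup>k\<close> are extensional functions on \<open>{1..k}\<close>, so that the zero vector is
  \<open>\<lambda>i\<in>{1..k}. 0\<close>.\<close>

definition cube_nz :: "nat \<Rightarrow> (nat \<Rightarrow> nat) set" where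
  "cube_nz k = (\<Pi>\<^sub>E i\<in>{1..k}. {0, 1}) - {\<lambda>i\<in>{1..k}. 0}"

definition cube_dot :: "nat \<Rightarrow> (nat \<Rightarrow> nat) \<Rightarrow> (nat \<Rightarrow> real^'d::finite) \<Rightarrow> real^'d" where
  "cube_dot k \<alpha> h = (\<Sum>i\<in>{1..k}. real (\<alpha> i) *\<^sub>R h i)"

definition cubic_conv ::
    "nat \<Rightarrow> ((nat \<Rightarrow> nat) \<Rightarrow> real^'d::finite \<Rightarrow> real) \<Rightarrow> real^'d \<Rightarrow> real" where
  "cubic_conv k f x =
     (LINT h|(\<Pi>\<^sub>M i\<in>{1..k}. lborel). (\<Prod>\<alpha>\<in>cube_nz k. f \<alpha> (x + cube_dot k \<alpha> h)))"

text \<open>The type \<open>(real^'d) \<Rightarrow>\<^sub>C real\<close> carries the uniform norm. For \<open>k \<ge> 2\<close> every cubic convolution product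
  of functions as below is bounded and continuous, so requiring it to be (the underlying function
  of) an element \<open>g\<close> of this type excludes none of them.\<close>

definition cubic_gen :: "nat \<Rightarrow> ((real^'d::finite) \<Rightarrow>\<^sub>C real) set" where
  "cubic_gen k = {g. \<exists>f. (\<forall>\<alpha>\<in>cube_nz k. f \<alpha> \<in> Lspace (q_exp k) \<inter> Lspace (p_exp k)) \<and>
      (\<Prod>\<alpha>\<in>cube_nz k. Lnorm (q_exp k) (f \<alpha>)) \<le> 1 \<and>
      apply_bcontfun g = cubic_conv k f}"

definition L_hull :: "nat \<Rightarrow> ((real^'d::finite) \<Rightarrow>\<^sub>C real) set" where
  "L_hull k = convex hull (cubic_gen k)"

definition L_bar :: "nat \<Rightarrow> ((real^'d::finite) \<Rightarrow>\<^sub>C real) set" where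
  "L_bar k = closure (L_hull k)"

definition F_space :: "nat \<Rightarrow> ((real^'d::finite) \<Rightarrow>\<^sub>C real) set" where
  "F_space k = span (L_bar k)"

definition F_norm :: "nat \<Rightarrow> ((real^'d::finite) \<Rightarrow>\<^sub>C real) \<Rightarrow> real" where
  "F_norm k g = Inf {t. t > 0 \<and> g \<in> (\<lambda>u. t *\<^sub>R u) ` L_bar k}"

definition bcontfun_mult ::
    "('a::topological_space \<Rightarrow>\<^sub>C real) \<Rightarrow> ('a \<Rightarrow>\<^sub>C real) \<Rightarrow> ('a \<Rightarrow>\<^sub>C real)" where
  "bcontfun_mult f g = Bcontfun (\<lambda>x. apply_bcontfun f x * apply_bcontfun g x)"

lemma apply_bcontfun_mult:
  "apply_bcontfun (bcontfun_mult f g) x = apply_bcontfun f x * apply_bcontfun g x"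
proof -
  obtain a b where a: "\<And>x. norm (apply_bcontfun f x) \<le> a"
    and b: "\<And>x. norm (apply_bcontfun g x) \<le> b"
    using bounded_apply_bcontfun[of f] bounded_apply_bcontfun[of g]
    unfolding bounded_iff by blast
  have "norm (apply_bcontfun f x * apply_bcontfun g x) \<le> a * b" for x
    unfolding norm_mult by (intro mult_mono a b order_trans[OF norm_ge_zero a] norm_ge_zero)
  then have "bounded (range (\<lambda>x. apply_bcontfun f x * apply_bcontfun g x))"
    unfolding bounded_iff by blast
  then have "(\<lambda>x. apply_bcontfun f x * apply_bcontfun g x) \<in> bcontfun"
    by (simp add: bcontfun_def continuous_on_mult)
  then show ?thesis
    by (simp add: bcontfun_mult_def Bcontfun_inverse)
qed

text \<open>A not necessarily unital Banach algebra whose underlying vector space is a subspace \<open>A\<close> of an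
  ambient real vector space, with norm \<open>N\<close> and product \<open>m\<close>.\<close>

definition banach_algebra_on ::
    "'v::real_vector set \<Rightarrow> ('v \<Rightarrow> real) \<Rightarrow> ('v \<Rightarrow> 'v \<Rightarrow> 'v) \<Rightarrow> bool" where
  "banach_algebra_on A N m \<longleftrightarrow>
     subspace A \<and>
     \<comment> \<open>\<open>N\<close> is a norm on \<open>A\<close>\<close>
     (\<forall>u\<in>A. 0 \<le> N u \<and> (N u = 0 \<longleftrightarrow> u = 0)) \<and>
     (\<forall>c. \<forall>u\<in>A. N (c *\<^sub>R u) = \<bar>c\<bar> * N u) \<and>
     (\<forall>u\<in>A. \<forall>v\<in>A. N (u + v) \<le> N u + N v) \<and>
     \<comment> \<open>\<open>A\<close> is complete for \<open>N\<close>\<close>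
     (\<forall>X :: nat \<Rightarrow> 'v. (\<forall>n. X n \<in> A) \<longrightarrow>
        (\<forall>e>0. \<exists>M. \<forall>i\<ge>M. \<forall>j\<ge>M. N (X i - X j) < e) \<longrightarrow>
        (\<exists>l\<in>A. (\<lambda>n. N (X n - l)) \<longlonglongrightarrow> 0)) \<and>
     \<comment> \<open>\<open>m\<close> is an associative bilinear product on \<open>A\<close>\<close>
     (\<forall>u\<in>A. \<forall>v\<in>A. m u v \<in> A) \<and>
     (\<forall>u\<in>A. \<forall>v\<in>A. \<forall>w\<in>A. m (m u v) w = m u (m v w)) \<and>
     (\<forall>u\<in>A. \<forall>v\<in>A. \<forall>w\<in>A. m (u + v) w = m u w + m v w \<and> m u (v + w) = m u v + m u w) \<and>
     (\<forall>c. \<forall>u\<in>A. \<forall>v\<in>A. m (c *\<^sub>R u) v = c *\<^sub>R m u v \<and> m u (c *\<^sub>R v) = c *\<^sub>R m u v) \<and>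
     \<comment> \<open>\<open>N\<close> is submultiplicative\<close>
     (\<forall>u\<in>A. \<forall>v\<in>A. N (m u v) \<le> N u * N v)"

end

theory Submission
  imports Defs
begin

text \<open>
  Write \<open>D f\<close> for the cubic convolution product of a family \<open>f\<close>, and \<open>q = q_exp k\<close>. The substitution
  \<open>h \<mapsto> h + u\<close> in the second factor of \<open>D f x * D g x\<close> turns the product into an average of cubic
  convolution products,
  \<open>D f x * D g x = \<integral> D (\<lambda>\<alpha> y. f \<alpha> y * g \<alpha> (y + \<alpha> \<cdot> u)) x du\<close>
  (\<open>cubic_conv_mult_eq_integral\<close>). The member with parameter \<open>u\<close> lies in \<open>w u\<close> times the unit ball, where
  \<open>w u\<close> is the product over \<open>\<alpha>\<close> of the \<open>L\<^sup>q\<close> norms of its factors. So the product lies in the unit ball as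
  soon as \<open>w\<close> has integral at most \<open>1\<close>.

  The bound on the integral of \<open>w\<close>, and also the bound of the uniform norm of \<open>D f\<close> by the product of the
  \<open>L\<^sup>q\<close> norms, are instances of one Brascamp-Lieb inequality (\<open>nn_integral_cube_prod_le\<close>):
  \<open>\<integral> \<Prod>\<alpha>. F\<^sub>\<alpha>(\<alpha> \<cdot> u) powr (1/q) du \<le> \<Prod>\<alpha>. (\<integral> F\<^sub>\<alpha>) powr (1/q)\<close> for nonnegative \<open>F\<^sub>\<alpha>\<close>. It has the following
  reason. If \<open>\<alpha>\<^sub>1, \<dots>, \<alpha>\<^sub>k\<close> are 0-1 vectors that form a basis over the field with two elements, then the
  integer matrix with these rows has odd determinant, hence determinant of absolute value at least \<open>1\<close>, and
  a linear change of variables gives \<open>\<integral> \<Prod>j. F\<^sub>\<alpha>\<^sub>j(\<alpha>\<^sub>j \<cdot> u) du \<le> \<Prod>j. \<integral> F\<^sub>\<alpha>\<^sub>j\<close>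
  (\<open>nn_integral_integer_forms_le\<close>). The linear group over that field acts transitively on the nonzero
  vectors, so each of the \<open>2^k - 1\<close> vectors occurs in the same proportion of all bases (\<open>sum_over_f2_bases\<close>);
  as a basis has \<open>k\<close> members, that proportion is \<open>k / (2^k - 1) = 1/q\<close>. Therefore
  \<open>\<Prod>\<alpha>. F\<^sub>\<alpha>(\<alpha> \<cdot> u) powr (1/q)\<close> is the geometric mean, over all bases, of the products over one basis, and
  the inequality between the geometric and the arithmetic mean finishes the proof.

  It remains to see that an average of members of the ball is in the ball, although the space of bounded
  continuous functions is not separable. For continuous families with compact support the parametrised
  family depends uniformly continuously on \<open>u\<close>, so a finite Riemann sum is uniformly close to the integral;
  if on each cell the sample point is chosen where \<open>w\<close> does not exceed its mean, the total weight of the sum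
  is at most the integral of \<open>w\<close> (\<open>cubic_conv_Cc_mult_in_L_bar\<close>). The general case follows because such
  families are dense in \<open>L\<^sup>q\<close> (\<open>cubic_approximation\<close>) and \<open>D\<close> is continuous from \<open>L\<^sup>q\<close> families to the uniform
  norm (\<open>cubic_conv_diff_le\<close>).

  Completeness and the norm axioms use only that the unit ball is a closed, convex, symmetric and bounded
  subset of a Banach space (locale \<open>banach_disc\<close>).
\<close>

section \<open>The Banach space spanned by a bounded closed disc\<close>

definition minkowski_functional :: "'v::real_vector set \<Rightarrow> 'v \<Rightarrow> real" where
  "minkowski_functional K u = Inf {t. t > 0 \<and> u \<in> (\<lambda>x. t *\<^sub>R x) ` K}"

text \<open>The bound \<open>1\<close> is a normalisation that makes the ambient norm at most the Minkowski functional of \<open>K\<close>.\<close>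

locale banach_disc =
  fixes K :: "'v::{real_normed_vector, complete_space} set"
  assumes disc_convex: "convex K"
    and disc_closed: "closed K"
    and disc_zero: "0 \<in> K"
    and disc_uminus: "x \<in> K \<Longrightarrow> - x \<in> K"
    and disc_norm_le_1: "x \<in> K \<Longrightarrow> norm x \<le> 1"
begin

abbreviation N :: "'v \<Rightarrow> real" where "N \<equiv> minkowski_functional K"

abbreviation scales :: "'v \<Rightarrow> real set" where
  "scales u \<equiv> {t. t > 0 \<and> u \<in> (\<lambda>x. t *\<^sub>R x) ` K}"

lemma scaled_iff: "t > 0 \<Longrightarrow> u \<in> (\<lambda>x. t *\<^sub>R x) ` K \<longleftrightarrow> (1 / t) *\<^sub>R u \<in> K"
  by (force simp: image_iff)

text \<open>The multiples \<open>t K\<close> increase with \<open>t\<close> because \<open>K\<close> is convex and contains \<open>0\<close>.\<close>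

lemma scale_mono:
  assumes "0 < s" "s \<le> t" "(1 / s) *\<^sub>R u \<in> K" shows "(1 / t) *\<^sub>R u \<in> K"
proof -
  have "(s / t) *\<^sub>R ((1 / s) *\<^sub>R u) + (1 - s / t) *\<^sub>R 0 \<in> K"
    using assms disc_zero by (intro convexD[OF disc_convex]) auto
  then show ?thesis using assms by simp
qed

lemma scale_sum:
  assumes "0 < s" "0 < t" "(1 / s) *\<^sub>R u \<in> K" "(1 / t) *\<^sub>R v \<in> K"
  shows "(1 / (s + t)) *\<^sub>R (u + v) \<in> K"
proof -
  have "(s / (s + t)) *\<^sub>R ((1 / s) *\<^sub>R u) + (t / (s + t)) *\<^sub>R ((1 / t) *\<^sub>R v) \<in> K"
    using assms by (intro convexD[OF disc_convex]) (auto simp: add_divide_distrib[symmetric])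
  then show ?thesis using assms by (simp add: scaleR_add_right)
qed

lemma span_imp_scale: "u \<in> span K \<Longrightarrow> \<exists>t>0. (1 / t) *\<^sub>R u \<in> K"
proof (induction rule: span_induct_alt)
  case base
  then show ?case using disc_zero by (intro exI[of _ 1]) auto
next
  case (step c x y)
  then obtain t where t: "t > 0" "(1 / t) *\<^sub>R y \<in> K" by blast
  have "\<exists>s>0. (1 / s) *\<^sub>R (c *\<^sub>R x) \<in> K"
  proof (cases "c = 0")
    case True
    then show ?thesis using disc_zero by (intro exI[of _ 1]) auto
  next
    case False
    then show ?thesis using step(1) disc_uminus[OF step(1)]
      by (intro exI[of _ "\<bar>c\<bar>"]) (auto simp: abs_if)
  qed
  then show ?case using t scale_sum by (metis add_pos_pos)
qed

lemma scale_in_span: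
  assumes "t > 0" "(1 / t) *\<^sub>R u \<in> K" shows "u \<in> span K"
proof -
  have "t *\<^sub>R ((1 / t) *\<^sub>R u) \<in> span K"
    using assms by (intro span_scale span_base)
  then show ?thesis using assms(1) by simp
qed

lemma scales_bdd_below: "bdd_below (scales u)"
  by (rule bdd_belowI[of _ 0]) auto

lemma N_le: "t > 0 \<Longrightarrow> (1 / t) *\<^sub>R u \<in> K \<Longrightarrow> N u \<le> t"
  unfolding minkowski_functional_def
  by (rule cInf_lower[OF _ scales_bdd_below]) (simp add: scaled_iff)

text \<open>The infimum defining \<open>N u\<close> is not attained for \<open>u = 0\<close>, but every larger \<open>t\<close> is admissible; all
  properties of \<open>N\<close> below are proved by taking such a \<open>t\<close> close to \<open>N u\<close>.\<close>

lemma N_less_scale: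
  assumes "u \<in> span K" "N u < t" shows "t > 0" "(1 / t) *\<^sub>R u \<in> K"
proof -
  have ne: "scales u \<noteq> {}" using span_imp_scale[OF assms(1)] by (auto simp: scaled_iff)
  then obtain s where "s > 0" "u \<in> (\<lambda>x. s *\<^sub>R x) ` K" "s < t"
    using assms(2) cInf_less_iff[OF ne scales_bdd_below, of t]
    by (auto simp: minkowski_functional_def)
  then have s: "s > 0" "(1 / s) *\<^sub>R u \<in> K" "s \<le> t" by (auto simp: scaled_iff)
  show "t > 0" using s by simp
  show "(1 / t) *\<^sub>R u \<in> K" using scale_mono s by blast
qed

lemma N_nonneg: "u \<in> span K \<Longrightarrow> 0 \<le> N u"
  using N_less_scale(1) by (meson dense_ge not_le less_imp_le)

lemma norm_le_N: "u \<in> span K \<Longrightarrow> norm u \<le> N u"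
proof (rule dense_ge)
  fix t assume "u \<in> span K" "N u < t"
  note * = N_less_scale[OF this]
  show "norm u \<le> t" using disc_norm_le_1[OF *(2)] *(1) by (simp add: divide_simps)
qed

lemma N_zero: "N 0 = 0"
proof (rule antisym)
  show "N 0 \<le> 0"
    by (rule dense_ge) (use N_le[of _ 0] disc_zero in auto)
qed (simp add: N_nonneg span_zero)

lemma N_scaleR:
  assumes "u \<in> span K" shows "N (c *\<^sub>R u) = \<bar>c\<bar> * N u"
proof -
  have le: "N (c *\<^sub>R u) \<le> \<bar>c\<bar> * N u" if u: "u \<in> span K" and "c \<noteq> 0" for c u
  proof -
    have "N (c *\<^sub>R u) / \<bar>c\<bar> \<le> N u"
    proof (rule dense_ge)
      fix t assume "N u < t"
      note * = N_less_scale[OF u this]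
      have "(1 / (\<bar>c\<bar> * t)) *\<^sub>R (c *\<^sub>R u) = sgn c *\<^sub>R ((1 / t) *\<^sub>R u)"
        using that by (auto simp: sgn_if abs_if)
      also have "\<dots> \<in> K" using * disc_uminus that by (auto simp: sgn_if)
      finally have "N (c *\<^sub>R u) \<le> \<bar>c\<bar> * t" using * that by (intro N_le) auto
      then show "N (c *\<^sub>R u) / \<bar>c\<bar> \<le> t" using that by (simp add: divide_simps mult.commute)
    qed
    then show ?thesis using that by (simp add: divide_simps mult.commute)
  qed
  show ?thesis
  proof (cases "c = 0")
    case False
    have "N u \<le> \<bar>1 / c\<bar> * N (c *\<^sub>R u)"
      using le[of "c *\<^sub>R u" "1 / c"] False assms by (auto simp: span_scale span_mul)
    then have "\<bar>c\<bar> * N u \<le> N (c *\<^sub>R u)"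
      using False by (simp add: divide_simps mult.commute)
    then show ?thesis using le[OF assms False] by simp
  qed (simp add: N_zero)
qed

lemma N_triangle:
  assumes "u \<in> span K" "v \<in> span K" shows "N (u + v) \<le> N u + N v"
proof (rule field_le_epsilon)
  fix e :: real assume "e > 0"
  then have "N u < N u + e / 2" "N v < N v + e / 2" by auto
  note u = N_less_scale[OF assms(1) this(1)] and v = N_less_scale[OF assms(2) this(2)]
  have "N (u + v) \<le> (N u + e / 2) + (N v + e / 2)"
    by (intro N_le scale_sum add_pos_pos u v)
  then show "N (u + v) \<le> N u + N v + e" by simp
qed

text \<open>A sequence that is Cauchy for \<open>N\<close> is Cauchy for the ambient norm, which is smaller, and so has an ambient
  limit; that it also converges for \<open>N\<close> is due to the closedness of \<open>K\<close>.\<close>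

lemma N_complete:
  fixes X :: "nat \<Rightarrow> 'v"
  assumes X: "\<And>n. X n \<in> span K"
    and cauchy: "\<And>e. e > 0 \<Longrightarrow> \<exists>M. \<forall>i\<ge>M. \<forall>j\<ge>M. N (X i - X j) < e"
  shows "\<exists>l\<in>span K. (\<lambda>n. N (X n - l)) \<longlonglongrightarrow> 0"
proof -
  have "Cauchy X"
  proof (rule CauchyI)
    fix e :: real assume "e > 0"
    then obtain M where M: "\<And>i j. i \<ge> M \<Longrightarrow> j \<ge> M \<Longrightarrow> N (X i - X j) < e" using cauchy by meson
    have "norm (X i - X j) < e" if "i \<ge> M" "j \<ge> M" for i j
      using norm_le_N[OF span_diff[OF X X], of i j] M[OF that] by linarith
    then show "\<exists>M. \<forall>m\<ge>M. \<forall>n\<ge>M. norm (X m - X n) < e" by blast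
  qed
  then obtain l where l: "X \<longlonglongrightarrow> l" by (auto simp: Cauchy_convergent_iff convergent_def)
  \<comment> \<open>Differences with the limit inherit the bound, because multiples of \<open>K\<close> are closed.\<close>
  have tail: "\<exists>M. \<forall>n\<ge>M. (1 / e) *\<^sub>R (X n - l) \<in> K" if "e > 0" for e
  proof -
    obtain M where M: "\<And>i j. i \<ge> M \<Longrightarrow> j \<ge> M \<Longrightarrow> N (X i - X j) < e"
      using cauchy \<open>e > 0\<close> by meson
    have "(1 / e) *\<^sub>R (X n - l) \<in> K" if "n \<ge> M" for n
    proof (rule Lim_in_closed_set[OF disc_closed _ sequentially_bot])
      show "(\<lambda>j. (1 / e) *\<^sub>R (X n - X j)) \<longlonglongrightarrow> (1 / e) *\<^sub>R (X n - l)"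
        by (intro tendsto_intros l)
      show "\<forall>\<^sub>F j in sequentially. (1 / e) *\<^sub>R (X n - X j) \<in> K"
        using N_less_scale(2)[OF span_diff[OF X X] M[OF that]]
        by (auto simp: eventually_sequentially)
    qed
    then show ?thesis by blast
  qed
  obtain M where "\<forall>n\<ge>M. (1 / 1) *\<^sub>R (X n - l) \<in> K" using tail[of 1] by auto
  then have "X M - l \<in> span K" by (simp add: span_base)
  then have lK: "l \<in> span K" using span_diff[OF X[of M]] by fastforce
  moreover have "(\<lambda>n. N (X n - l)) \<longlonglongrightarrow> 0"
  proof (rule LIMSEQ_I)
    fix e :: real assume "e > 0"
    then obtain M where "\<forall>n\<ge>M. (1 / (e / 2)) *\<^sub>R (X n - l) \<in> K" using tail[of "e / 2"] by auto
    then have "N (X n - l) \<le> e / 2" if "n \<ge> M" for n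
      using that \<open>e > 0\<close> by (intro N_le) auto
    moreover have "0 \<le> N (X n - l)" for n by (intro N_nonneg span_diff X lK)
    ultimately have "norm (N (X n - l) - 0) < e" if "n \<ge> M" for n
      using that \<open>e > 0\<close> by (smt (verit) field_sum_of_halves real_norm_def)
    then show "\<exists>M. \<forall>n\<ge>M. norm (N (X n - l) - 0) < e" by blast
  qed
  ultimately show ?thesis by blast
qed

lemma banach_algebra_on_span:
  assumes bil: "bounded_bilinear m"
    and assoc: "\<And>u v w. m (m u v) w = m u (m v w)"
    and closed_mult: "\<And>u v. u \<in> K \<Longrightarrow> v \<in> K \<Longrightarrow> m u v \<in> K"
  shows "banach_algebra_on (span K) N m"
proof -
  interpret bounded_bilinear m by (rule bil)
  have mult: "(1 / (s * t)) *\<^sub>R m u v \<in> K"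
    if "(1 / s) *\<^sub>R u \<in> K" "(1 / t) *\<^sub>R v \<in> K" for s t u v
  proof -
    have "(1 / (s * t)) *\<^sub>R m u v = m ((1 / s) *\<^sub>R u) ((1 / t) *\<^sub>R v)"
      unfolding scaleR_left scaleR_right by simp
    then show ?thesis using closed_mult[OF that] by simp
  qed
  have mem: "m u v \<in> span K" if uv: "u \<in> span K" "v \<in> span K" for u v
  proof -
    obtain s t where "s > 0" "t > 0" "(1 / s) *\<^sub>R u \<in> K" "(1 / t) *\<^sub>R v \<in> K"
      using span_imp_scale uv by meson
    then show ?thesis by (intro scale_in_span[of "s * t"] mult) auto
  qed
  have sub: "N (m u v) \<le> N u * N v" if uv: "u \<in> span K" "v \<in> span K" for u v
  proof (rule tendsto_lowerbound)
    show "((\<lambda>e. (N u + e) * (N v + e)) \<longlongrightarrow> N u * N v) (at_right 0)"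
      by (auto intro!: tendsto_eq_intros)
    show "\<forall>\<^sub>F e in at_right 0. N (m u v) \<le> (N u + e) * (N v + e)"
    proof (rule eventually_mono[OF eventually_at_right_less])
      fix e :: real assume "0 < e"
      then have "N u < N u + e" "N v < N v + e" by auto
      note u = N_less_scale[OF uv(1) this(1)] and v = N_less_scale[OF uv(2) this(2)]
      show "N (m u v) \<le> (N u + e) * (N v + e)"
        by (intro N_le mult_pos_pos mult u v)
    qed
  qed simp
  have zero: "N u = 0 \<longleftrightarrow> u = 0" if "u \<in> span K" for u
    using norm_le_N[OF that] N_zero by auto
  show ?thesis
    unfolding banach_algebra_on_def
    by (intro conjI ballI allI impI N_complete)
      (auto simp: N_nonneg zero N_scaleR N_triangle mem sub assoc add_left add_right
        scaleR_left scaleR_right)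
qed

end

section \<open>Integer linear forms that are independent modulo 2\<close>

interpretation lborel_prod: product_sigma_finite "\<lambda>_. lborel :: 'a::euclidean_space measure"
  by standard

lemma nn_integral_lborel_plus:
  fixes f :: "'a::euclidean_space \<Rightarrow> ennreal"
  assumes [measurable]: "f \<in> borel_measurable borel"
  shows "(\<integral>\<^sup>+x. f (a + x) \<partial>lborel) = (\<integral>\<^sup>+x. f x \<partial>lborel)"
proof -
  have "(\<integral>\<^sup>+x. f x \<partial>lborel) = (\<integral>\<^sup>+x. f x \<partial>distr lborel borel ((+) a))"
    by (simp add: lborel_distr_plus)
  also have "\<dots> = (\<integral>\<^sup>+x. f (a + x) \<partial>lborel)"
    by (rule nn_integral_distr) auto
  finally show ?thesis ..
qed

lemma nn_integral_lborel_dilation_le: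
  fixes f :: "'a::euclidean_space \<Rightarrow> ennreal"
  assumes [measurable]: "f \<in> borel_measurable borel" and a: "\<bar>a\<bar> \<ge> 1"
  shows "(\<integral>\<^sup>+x. f (a *\<^sub>R x) \<partial>lborel) \<le> (\<integral>\<^sup>+x. f x \<partial>lborel)"
proof -
  have "(\<integral>\<^sup>+x. f x \<partial>lborel) =
      (\<integral>\<^sup>+x. f x \<partial>density (distr lborel borel (\<lambda>x. 0 + a *\<^sub>R x)) (\<lambda>_. \<bar>a\<bar> ^ DIM('a)))"
    using a by (subst lborel_affine[of a 0, symmetric]) auto
  also have "\<dots> = (\<integral>\<^sup>+x. ennreal (\<bar>a\<bar> ^ DIM('a)) * f (a *\<^sub>R x) \<partial>lborel)"
    by (simp add: nn_integral_density nn_integral_distr)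
  also have "\<dots> \<ge> (\<integral>\<^sup>+x. 1 * f (a *\<^sub>R x) \<partial>lborel)"
    using a by (intro nn_integral_mono mult_right_mono) auto
  finally show ?thesis by simp
qed

text \<open>Shears generate enough of the linear group for the elimination below, and they preserve the measure by
  translation invariance in the single coordinate that changes.\<close>

lemma nn_integral_shear:
  fixes f :: "('i \<Rightarrow> 'a::euclidean_space) \<Rightarrow> ennreal"
  assumes I: "finite I" "i \<in> I" "i' \<noteq> i" "i' \<in> I"
    and f[measurable]: "f \<in> borel_measurable (PiM I (\<lambda>_. lborel))"
  shows "(\<integral>\<^sup>+u. f (u(i := u i + c *\<^sub>R u i')) \<partial>PiM I (\<lambda>_. lborel)) = (\<integral>\<^sup>+u. f u \<partial>PiM I (\<lambda>_. lborel))"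
proof -
  define I' where "I' = I - {i}"
  have I': "I = insert i I'" "finite I'" "i \<notin> I'" "i' \<in> I'" using I by (auto simp: I'_def)
  have sh: "(\<lambda>u. u(i := u i + c *\<^sub>R u i')) \<in> PiM I (\<lambda>_. lborel) \<rightarrow>\<^sub>M PiM I (\<lambda>_. lborel)"
    using I by (intro measurable_fun_upd[where J = I]) auto
  have "i' \<noteq> i" using I by simp
  have f': "f \<in> borel_measurable (PiM (insert i I') (\<lambda>_. lborel))" using f I'(1) by simp
  have "(\<integral>\<^sup>+u. f (u(i := u i + c *\<^sub>R u i')) \<partial>PiM I (\<lambda>_. lborel)) =
     (\<integral>\<^sup>+x. \<integral>\<^sup>+y. f (x(i := y + c *\<^sub>R x i')) \<partial>lborel \<partial>PiM I' (\<lambda>_. lborel))"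
    using measurable_compose[OF sh f] I' \<open>i' \<noteq> i\<close>
    by (simp add: lborel_prod.product_nn_integral_insert)
  also have "\<dots> = (\<integral>\<^sup>+x. \<integral>\<^sup>+y. f (x(i := y)) \<partial>lborel \<partial>PiM I' (\<lambda>_. lborel))"
  proof (rule nn_integral_cong)
    fix x assume x: "x \<in> space (PiM I' (\<lambda>_. lborel :: 'a measure))"
    have "(\<lambda>y. x(i := y)) \<in> borel \<rightarrow>\<^sub>M PiM (insert i I') (\<lambda>_. lborel)"
      using x by measurable
    then have "(\<lambda>y. f (x(i := y))) \<in> borel_measurable borel"
      using f' by (rule measurable_compose)
    from nn_integral_lborel_plus[OF this, of "c *\<^sub>R x i'"]
    show "(\<integral>\<^sup>+y. f (x(i := y + c *\<^sub>R x i')) \<partial>lborel) = (\<integral>\<^sup>+y. f (x(i := y)) \<partial>lborel)"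
      by (simp add: add.commute)
  qed
  also have "\<dots> = (\<integral>\<^sup>+u. f u \<partial>PiM I (\<lambda>_. lborel))"
    using f' I' by (simp add: lborel_prod.product_nn_integral_insert)
  finally show ?thesis .
qed

text \<open>This says that the matrix \<open>A\<close>, with rows \<open>J\<close> and columns \<open>I\<close>, has trivial kernel over the field with two
  elements. Vectors over that field are represented by integer vectors up to parity, so that one
  condition serves for integer matrices without reduction of the entries.\<close>

definition nonsingular_mod2 :: "'i set \<Rightarrow> 'j set \<Rightarrow> ('j \<Rightarrow> 'i \<Rightarrow> int) \<Rightarrow> bool" where
  "nonsingular_mod2 I J A \<longleftrightarrow>
     (\<forall>v. (\<forall>j\<in>J. even (\<Sum>i\<in>I. A j i * v i)) \<longrightarrow> (\<forall>i\<in>I. even (v i)))"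

text \<open>If row \<open>j0\<close> vanished, then the parities of the remaining rows, which are one fewer than the columns, would
  agree on two different subsets of \<open>I\<close> by the pigeonhole principle; the difference of the two indicator
  vectors would be a nontrivial element of the kernel.\<close>

lemma nonsingular_mod2_row_nonzero:
  assumes fin: "finite I" "finite J" and card: "card J = card I" and j0: "j0 \<in> J"
    and ns: "nonsingular_mod2 I J A"
  shows "\<exists>i\<in>I. A j0 i \<noteq> 0"
proof (rule ccontr)
  assume "\<not> ?thesis"
  then have zero: "A j0 i = 0" if "i \<in> I" for i using that by blast
  define p where "p S = {j \<in> J - {j0}. odd (\<Sum>i\<in>S. A j i)}" for S
  have "card (Pow (J - {j0})) < card (Pow I)"
    using fin card j0 card_gt_0_iff[of J] by (auto simp: card_Pow)
  moreover have "p ` Pow I \<subseteq> Pow (J - {j0})" by (auto simp: p_def)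
  ultimately have "\<not> inj_on p (Pow I)"
    using card_inj_on_le[of p "Pow I" "Pow (J - {j0})"] fin by auto
  then obtain S S' where S: "S \<subseteq> I" "S' \<subseteq> I" "S \<noteq> S'" "p S = p S'"
    by (auto simp: inj_on_def)
  define v :: "'a \<Rightarrow> int" where "v i = of_bool (i \<in> S) - of_bool (i \<in> S')" for i
  have sum_v: "(\<Sum>i\<in>I. A j i * v i) = (\<Sum>i\<in>S. A j i) - (\<Sum>i\<in>S'. A j i)" for j
  proof -
    have "(\<Sum>i\<in>I. A j i * of_bool (i \<in> T)) = (\<Sum>i\<in>T. A j i)" if "T \<subseteq> I" for T
    proof -
      have "(\<Sum>i\<in>I. A j i * of_bool (i \<in> T)) = (\<Sum>i\<in>I. if i \<in> T then A j i else 0)"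
        by (intro sum.cong) auto
      also have "\<dots> = (\<Sum>i\<in>I \<inter> T. A j i)" using fin(1) by (simp add: sum.inter_restrict)
      finally show ?thesis using that by (simp add: Int_absorb1)
    qed
    then show ?thesis using S by (simp add: v_def right_diff_distrib sum_subtractf)
  qed
  have "even (\<Sum>i\<in>I. A j i * v i)" if "j \<in> J" for j
  proof (cases "j = j0")
    case False
    then have "j \<in> p S \<longleftrightarrow> j \<in> p S'" using S by simp
    then show ?thesis using False that unfolding sum_v p_def by auto
  qed (simp add: zero)
  then have ev: "even (v i)" if "i \<in> I" for i using ns that unfolding nonsingular_mod2_def by blast
  have "S = S'"
  proof (rule set_eqI)
    fix i show "i \<in> S \<longleftrightarrow> i \<in> S'"
      using ev[of i] S(1,2) by (cases "i \<in> S"; cases "i \<in> S'") (auto simp: v_def)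
  qed
  then show False using S(3) by simp
qed

lemma nonsingular_mod2_minor:
  assumes ns: "nonsingular_mod2 I J A" and fin: "finite I" and i0: "i0 \<in> I" and j0: "j0 \<in> J"
    and row: "\<And>i. i \<in> I \<Longrightarrow> i \<noteq> i0 \<Longrightarrow> A j0 i = 0"
  shows "nonsingular_mod2 (I - {i0}) (J - {j0}) A"
  unfolding nonsingular_mod2_def
proof (intro allI impI)
  fix v assume v: "\<forall>j\<in>J - {j0}. even (\<Sum>i\<in>I - {i0}. A j i * v i)"
  define w where "w = v(i0 := 0)"
  have w: "(\<Sum>i\<in>I. A j i * w i) = (\<Sum>i\<in>I - {i0}. A j i * v i)" for j
    using fin i0 by (subst sum.remove[of _ i0]) (auto simp: w_def intro!: sum.cong)
  have "even (\<Sum>i\<in>I. A j i * w i)" if "j \<in> J" for j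
    using v that row unfolding w by (cases "j = j0") auto
  then have "\<forall>i\<in>I. even (w i)" using ns unfolding nonsingular_mod2_def by blast
  then show "\<forall>i\<in>I - {i0}. even (v i)" by (metis DiffE fun_upd_other insertI1 w_def)
qed

lemma sum_shear:
  fixes g :: "'i \<Rightarrow> 'r \<Rightarrow> 'b::ab_group_add"
  assumes "finite I" "i \<in> I"
  shows "(\<Sum>l\<in>I. g l ((u(i := w)) l)) = (\<Sum>l\<in>I. g l (u l)) + (g i w - g i (u i))"
proof -
  have "(\<Sum>l\<in>I - {i}. g l ((u(i := w)) l)) = (\<Sum>l\<in>I - {i}. g l (u l))"
    by (intro sum.cong) auto
  then show ?thesis using assms by (simp add: sum.remove[of I i] algebra_simps)
qed

text \<open>The integral equals \<open>\<bar>det A\<bar> powr (- DIM('a))\<close> times the right-hand side, and \<open>det A\<close> is odd. The proof avoids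
  determinants: column operations, which are shears of the variables, run the Euclidean algorithm on one row
  until it has a single nonzero entry \<open>a\<close>. The factor of this row then depends on one variable only, in
  which the dilation by the integer \<open>a\<close> can only decrease the integral, and on which the other factors depend
  by a translation, so that they are handled by induction.\<close>

lemma nn_integral_integer_forms_le:
  fixes A :: "'j \<Rightarrow> 'i \<Rightarrow> int" and F :: "'j \<Rightarrow> 'a::euclidean_space \<Rightarrow> ennreal"
  assumes "finite I" "finite J" "card J = card I"
    and "\<And>j. j \<in> J \<Longrightarrow> F j \<in> borel_measurable borel"
    and "nonsingular_mod2 I J A"
  shows "(\<integral>\<^sup>+u. (\<Prod>j\<in>J. F j (\<Sum>i\<in>I. of_int (A j i) *\<^sub>R u i)) \<partial>PiM I (\<lambda>_. lborel))
    \<le> (\<Prod>j\<in>J. \<integral>\<^sup>+x. F j x \<partial>lborel)"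
  using assms
proof (induction "card I" arbitrary: I J A F)
  case 0
  then have "I = {}" "J = {}" by auto
  then show ?case by (simp add: lborel_prod.nn_integral_empty space_PiM)
next
  case (Suc n)
  note [measurable] = Suc.prems(4)
  have "card J \<noteq> 0" using Suc.hyps(2) Suc.prems(3) by linarith
  then obtain j0 where j0: "j0 \<in> J" by (metis card.empty ex_in_conv)
  define J' where "J' = J - {j0}"
  have J': "J = insert j0 J'" "finite J'" "j0 \<notin> J'" "card J' = n"
    using j0 Suc by (auto simp: J'_def)
  show ?case using Suc.prems(5)
  proof (induction "\<Sum>i\<in>I. nat \<bar>A j0 i\<bar>" arbitrary: A rule: less_induct)
    case (less A)
    show ?case
    proof (cases "\<exists>i\<in>I. \<exists>i'\<in>I. i \<noteq> i' \<and> A j0 i \<noteq> 0 \<and> A j0 i' \<noteq> 0")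
      case True
      then obtain i i' where i: "i \<in> I" "i' \<in> I" "i \<noteq> i'" "A j0 i \<noteq> 0" "A j0 i' \<noteq> 0"
        "\<bar>A j0 i'\<bar> \<le> \<bar>A j0 i\<bar>"
        by (metis linorder_le_cases)
      \<comment> \<open>Adding the multiple \<open>c\<close> of column \<open>i'\<close> to column \<open>i\<close> shortens the larger of the two entries.\<close>
      define c where "c = - (sgn (A j0 i) * sgn (A j0 i'))"
      define B where "B j = (A j)(i := A j i + c * A j i')" for j
      have less_i: "\<bar>A j0 i + c * A j0 i'\<bar> < \<bar>A j0 i\<bar>"
        using i by (auto simp: c_def sgn_if)
      have "(\<Sum>l\<in>I. nat \<bar>B j0 l\<bar>) < (\<Sum>l\<in>I. nat \<bar>A j0 l\<bar>)"
        using i less_i Suc.prems(1)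
        by (intro sum_strict_mono_ex1) (auto simp: B_def intro!: bexI[of _ i])
      moreover have "nonsingular_mod2 I J B"
        unfolding nonsingular_mod2_def
      proof (intro allI impI)
        fix v assume v: "\<forall>j\<in>J. even (\<Sum>l\<in>I. B j l * v l)"
        define w where "w = v(i' := v i' + c * v i)"
        have "(\<Sum>l\<in>I. A j l * w l) = (\<Sum>l\<in>I. B j l * v l)" for j
          unfolding w_def B_def
          using sum_shear[of I i "\<lambda>l r. r * v l" "A j" "A j i + c * A j i'"]
            sum_shear[of I i' "\<lambda>l r. A j l * r" v "v i' + c * v i"] Suc.prems(1) i
          by (simp add: algebra_simps)
        then have ev: "\<forall>l\<in>I. even (w l)"
          using less.prems v unfolding nonsingular_mod2_def by simp
        then have "even (v i)" "even (v i' + c * v i)" using i by (auto simp: w_def)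
        then have "even (v i')" by simp
        then show "\<forall>l\<in>I. even (v l)" using ev by (metis fun_upd_other w_def)
      qed
      ultimately have le: "(\<integral>\<^sup>+u. (\<Prod>j\<in>J. F j (\<Sum>l\<in>I. of_int (B j l) *\<^sub>R u l)) \<partial>PiM I (\<lambda>_. lborel))
          \<le> (\<Prod>j\<in>J. \<integral>\<^sup>+x. F j x \<partial>lborel)"
        by (rule less.hyps)
      have eq: "(\<Sum>l\<in>I. of_int (B j l) *\<^sub>R u l) =
          (\<Sum>l\<in>I. of_int (A j l) *\<^sub>R (u(i' := u i' + of_int c *\<^sub>R u i)) l)" for j and u :: "'i \<Rightarrow> 'a"
        unfolding B_def
        using sum_shear[of I i "\<lambda>l r. of_int r *\<^sub>R u l" "A j" "A j i + c * A j i'"]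
          sum_shear[of I i' "\<lambda>l r. of_int (A j l) *\<^sub>R r" u "u i' + of_int c *\<^sub>R u i"] Suc.prems(1) i
        by (simp add: algebra_simps)
      have "(\<integral>\<^sup>+u. (\<Prod>j\<in>J. F j (\<Sum>l\<in>I. of_int (A j l) *\<^sub>R u l)) \<partial>PiM I (\<lambda>_. lborel)) =
         (\<integral>\<^sup>+u. (\<Prod>j\<in>J. F j (\<Sum>l\<in>I. of_int (B j l) *\<^sub>R u l)) \<partial>PiM I (\<lambda>_. lborel))"
        unfolding eq using Suc.prems(1,2) i
        by (subst nn_integral_shear[of I i' i "\<lambda>u. \<Prod>j\<in>J. F j (\<Sum>l\<in>I. of_int (A j l) *\<^sub>R u l)"])
          (auto intro!: borel_measurable_prod measurable_compose[OF _ Suc.prems(4)])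
      with le show ?thesis by simp
    next
      case False
      obtain i0 where i0: "i0 \<in> I" "A j0 i0 \<noteq> 0"
        using nonsingular_mod2_row_nonzero[OF Suc.prems(1-3) j0 less.prems] by blast
      with False have row: "A j0 i = 0" if "i \<in> I" "i \<noteq> i0" for i using that by metis
      define I' where "I' = I - {i0}"
      have I': "I = insert i0 I'" "finite I'" "i0 \<notin> I'" "card I' = n"
        using i0 Suc by (auto simp: I'_def)
      have ns': "nonsingular_mod2 I' J' A"
        unfolding I'_def J'_def using less.prems Suc.prems(1) i0(1) j0 row
        by (rule nonsingular_mod2_minor)
      have split: "(\<Sum>i\<in>I. of_int (A j i) *\<^sub>R (u(i0 := y)) i) =
          of_int (A j i0) *\<^sub>R y + (\<Sum>i\<in>I'. of_int (A j i) *\<^sub>R u i)" for j and u :: "'i \<Rightarrow> 'a" and y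
        unfolding I'(1) using I' by (auto intro!: sum.cong)
      have row': "(\<Sum>i\<in>I'. of_int (A j0 i) *\<^sub>R u i) = 0" for u :: "'i \<Rightarrow> 'a"
        using row by (intro sum.neutral) (auto simp: I'_def)
      have prod_split: "(\<Prod>j\<in>J. F j (\<Sum>i\<in>I. of_int (A j i) *\<^sub>R (u(i0 := y)) i)) =
          F j0 (of_int (A j0 i0) *\<^sub>R y) *
          (\<Prod>j\<in>J'. F j (of_int (A j i0) *\<^sub>R y + (\<Sum>i\<in>I'. of_int (A j i) *\<^sub>R u i)))"
        for u :: "'i \<Rightarrow> 'a" and y
        unfolding split unfolding J'(1) prod.insert[OF J'(2,3)] row' add_0_right ..
      have meas: "(\<lambda>u. \<Prod>j\<in>J. F j (\<Sum>i\<in>I. of_int (A j i) *\<^sub>R u i))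
          \<in> borel_measurable (PiM (insert i0 I') (\<lambda>_. lborel))"
        using I'(1) by (auto intro!: borel_measurable_prod measurable_compose[OF _ Suc.prems(4)])
      have "(\<integral>\<^sup>+u. (\<Prod>j\<in>J. F j (\<Sum>l\<in>I. of_int (A j l) *\<^sub>R u l)) \<partial>PiM I (\<lambda>_. lborel)) =
        (\<integral>\<^sup>+y. \<integral>\<^sup>+u. (\<Prod>j\<in>J. F j (\<Sum>i\<in>I. of_int (A j i) *\<^sub>R (u(i0 := y)) i))
           \<partial>PiM I' (\<lambda>_. lborel) \<partial>lborel)"
        using lborel_prod.product_nn_integral_insert_rev[OF I'(2,3) meas] I'(1) by simp
      also have "\<dots> = (\<integral>\<^sup>+y. F j0 (of_int (A j0 i0) *\<^sub>R y) * (\<integral>\<^sup>+u. (\<Prod>j\<in>J'. F j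
          (of_int (A j i0) *\<^sub>R y + (\<Sum>i\<in>I'. of_int (A j i) *\<^sub>R u i))) \<partial>PiM I' (\<lambda>_. lborel)) \<partial>lborel)"
        unfolding prod_split using J'(1)
        by (intro nn_integral_cong nn_integral_cmult borel_measurable_prod
          measurable_compose[OF _ Suc.prems(4)]) auto
      also have "\<dots> \<le> (\<integral>\<^sup>+y. F j0 (of_int (A j0 i0) *\<^sub>R y) * (\<Prod>j\<in>J'. \<integral>\<^sup>+x. F j x \<partial>lborel) \<partial>lborel)"
      proof (intro nn_integral_mono mult_left_mono)
        fix y
        have "(\<integral>\<^sup>+u. (\<Prod>j\<in>J'. F j
          (of_int (A j i0) *\<^sub>R y + (\<Sum>i\<in>I'. of_int (A j i) *\<^sub>R u i))) \<partial>PiM I' (\<lambda>_. lborel))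
          \<le> (\<Prod>j\<in>J'. \<integral>\<^sup>+x. F j (of_int (A j i0) *\<^sub>R y + x) \<partial>lborel)"
          using I' J' by (intro Suc.hyps(1)[OF _ _ _ _ _ ns'])
            (auto intro!: measurable_compose[OF _ Suc.prems(4)])
        also have "\<dots> = (\<Prod>j\<in>J'. \<integral>\<^sup>+x. F j x \<partial>lborel)"
          using J' Suc.prems(4) by (intro prod.cong nn_integral_lborel_plus) auto
        finally show "(\<integral>\<^sup>+u. (\<Prod>j\<in>J'. F j
          (of_int (A j i0) *\<^sub>R y + (\<Sum>i\<in>I'. of_int (A j i) *\<^sub>R u i))) \<partial>PiM I' (\<lambda>_. lborel))
          \<le> (\<Prod>j\<in>J'. \<integral>\<^sup>+x. F j x \<partial>lborel)" .
      qed auto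
      also have "\<dots> = (\<integral>\<^sup>+y. F j0 (of_int (A j0 i0) *\<^sub>R y) \<partial>lborel) * (\<Prod>j\<in>J'. \<integral>\<^sup>+x. F j x \<partial>lborel)"
        by (intro nn_integral_multc measurable_compose[OF _ Suc.prems(4)[OF j0]]) auto
      also have "\<dots> \<le> (\<integral>\<^sup>+y. F j0 y \<partial>lborel) * (\<Prod>j\<in>J'. \<integral>\<^sup>+x. F j x \<partial>lborel)"
        using i0 Suc.prems(4)[OF j0]
        by (intro mult_right_mono nn_integral_lborel_dilation_le) auto
      also have "\<dots> = (\<Prod>j\<in>J. \<integral>\<^sup>+x. F j x \<partial>lborel)" using J' by simp
      finally show ?thesis .
    qed
  qed
qed

section \<open>Bases over the field with two elements\<close>

definition f2_bases :: "nat \<Rightarrow> (nat \<Rightarrow> nat \<Rightarrow> nat) set" where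
  "f2_bases k = {b \<in> {1..k} \<rightarrow>\<^sub>E cube_nz k. nonsingular_mod2 {1..k} {1..k} (\<lambda>j i. int (b j i))}"

lemma cube_nz_iff:
  "\<alpha> \<in> cube_nz k \<longleftrightarrow> \<alpha> \<in> extensional {1..k} \<and> (\<forall>i\<in>{1..k}. \<alpha> i = 0 \<or> \<alpha> i = 1) \<and> (\<exists>i\<in>{1..k}. \<alpha> i = 1)"
proof -
  have "\<alpha> \<noteq> (\<lambda>i\<in>{1..k}. 0) \<longleftrightarrow> (\<exists>i\<in>{1..k}. \<alpha> i = 1)"
    if "\<alpha> \<in> extensional {1..k}" "\<forall>i\<in>{1..k}. \<alpha> i = 0 \<or> \<alpha> i = 1"
  proof
    assume "\<alpha> \<noteq> (\<lambda>i\<in>{1..k}. 0)"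
    then show "\<exists>i\<in>{1..k}. \<alpha> i = 1" using that by (metis extensionalityI restrict_apply' restrict_extensional)
  qed auto
  then show ?thesis by (auto simp: cube_nz_def PiE_iff)
qed

lemma finite_cube_nz: "finite (cube_nz k)"
  by (auto simp: cube_nz_def intro!: finite_PiE)

lemma card_cube_nz: "real (card (cube_nz k)) = 2 ^ k - 1"
proof -
  have "(\<lambda>i\<in>{1..k}. 0) \<in> {1..k} \<rightarrow>\<^sub>E {0, 1::nat}" by auto
  then have "card (cube_nz k) = 2 ^ k - 1"
    by (simp add: cube_nz_def card_Diff_singleton card_PiE numeral_2_eq_2)
  then show ?thesis by (simp add: of_nat_diff)
qed

lemma finite_f2_bases: "finite (f2_bases k)"
  by (auto simp: f2_bases_def intro!: finite_subset[OF _ finite_PiE[of "{1..k}" "\<lambda>_. cube_nz k"]] finite_cube_nz)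

lemma f2_bases_nonempty: "f2_bases k \<noteq> {}"
proof -
  define e :: "nat \<Rightarrow> nat \<Rightarrow> nat" where "e = (\<lambda>j\<in>{1..k}. \<lambda>i\<in>{1..k}. if i = j then 1 else 0)"
  have "e j \<in> cube_nz k" if "j \<in> {1..k}" for j
    using that unfolding cube_nz_iff by (auto simp: e_def)
  moreover have "nonsingular_mod2 {1..k} {1..k} (\<lambda>j i. int (e j i))"
    unfolding nonsingular_mod2_def
  proof (intro allI impI ballI)
    fix v i assume v: "\<forall>j\<in>{1..k}. even (\<Sum>i = 1..k. int (e j i) * v i)" and i: "i \<in> {1..k}"
    have "(\<Sum>l = 1..k. int (e i l) * v l) = (\<Sum>l = 1..k. if l = i then v l else 0)"
      using i by (intro sum.cong) (auto simp: e_def)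
    also have "\<dots> = v i" using i by simp
    finally show "even (v i)" using v i by metis
  qed
  moreover have "e \<in> extensional {1..k}" by (simp add: e_def)
  ultimately have "e \<in> f2_bases k" unfolding f2_bases_def PiE_iff by blast
  then show ?thesis by blast
qed

text \<open>The linear map \<open>x \<mapsto> x + \<phi>(x) \<delta>\<close> over the field with two elements, where the functional \<open>\<phi>\<close> sums the
  coordinates in \<open>P\<close>. If \<open>\<phi>(\<delta>) = 0\<close> it is an involution.\<close>

definition transvection ::
    "nat \<Rightarrow> nat set \<Rightarrow> (nat \<Rightarrow> nat) \<Rightarrow> (nat \<Rightarrow> nat) \<Rightarrow> (nat \<Rightarrow> nat)" where
  "transvection k P \<delta> x = (\<lambda>i\<in>{1..k}. (x i + (\<Sum>p\<in>P. x p) * \<delta> i) mod 2)"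

lemma even_sum_cong:
  fixes f g :: "'i \<Rightarrow> 'b::semiring_parity"
  assumes "\<And>i. i \<in> I \<Longrightarrow> even (f i) = even (g i)"
  shows "even (sum f I) = even (sum g I)"
  using assms by (induction I rule: infinite_finite_induct) auto

lemma even_transvection:
  "i \<in> {1..k} \<Longrightarrow> even (transvection k P \<delta> x i) \<longleftrightarrow> even (x i + (\<Sum>p\<in>P. x p) * \<delta> i)"
  by (simp add: transvection_def)

lemma even_sum_transvection:
  assumes "P \<subseteq> {1..k}" "even (\<Sum>p\<in>P. \<delta> p)"
  shows "even (\<Sum>p\<in>P. transvection k P \<delta> x p) \<longleftrightarrow> even (\<Sum>p\<in>P. x p)"
proof -
  have "even (\<Sum>p\<in>P. transvection k P \<delta> x p) \<longleftrightarrow> even (\<Sum>p\<in>P. x p + (\<Sum>p\<in>P. x p) * \<delta> p)"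
    using assms(1) by (intro even_sum_cong even_transvection) auto
  also have "(\<Sum>p\<in>P. x p + (\<Sum>p\<in>P. x p) * \<delta> p) = (\<Sum>p\<in>P. x p) + (\<Sum>p\<in>P. x p) * (\<Sum>p\<in>P. \<delta> p)"
    by (simp add: sum.distrib sum_distrib_left)
  finally show ?thesis using assms(2) by simp
qed

lemma transvection_involution:
  assumes "P \<subseteq> {1..k}" "even (\<Sum>p\<in>P. \<delta> p)"
    and x: "x \<in> extensional {1..k}" "\<And>i. i \<in> {1..k} \<Longrightarrow> x i = 0 \<or> x i = 1"
  shows "transvection k P \<delta> (transvection k P \<delta> x) = x"
proof (rule extensionalityI[of _ "{1..k}"])
  fix i assume i: "i \<in> {1..k}"
  let ?y = "transvection k P \<delta> x"
  have "even (transvection k P \<delta> ?y i) \<longleftrightarrow> even (x i)"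
    using i even_sum_transvection[OF assms(1,2), of x] by (auto simp: even_transvection)
  moreover have "transvection k P \<delta> ?y i < 2" using i by (simp add: transvection_def)
  ultimately show "transvection k P \<delta> ?y i = x i"
    using x(2)[OF i] by (auto simp: less_2_cases_iff)
qed (use x in \<open>auto simp: transvection_def\<close>)

lemma transvection_cube_nz:
  assumes "P \<subseteq> {1..k}" "even (\<Sum>p\<in>P. \<delta> p)" and x: "x \<in> cube_nz k"
  shows "transvection k P \<delta> x \<in> cube_nz k"
proof -
  have 01: "transvection k P \<delta> x i = 0 \<or> transvection k P \<delta> x i = 1" if "i \<in> {1..k}" for i
    using that by (auto simp: transvection_def)
  have "\<exists>i\<in>{1..k}. transvection k P \<delta> x i = 1"
  proof (rule ccontr)
    assume "\<not> ?thesis"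
    then have zero: "transvection k P \<delta> x i = 0" if "i \<in> {1..k}" for i using 01 that by blast
    have "transvection k P \<delta> (transvection k P \<delta> x) i = 0" if "i \<in> {1..k}" for i
      using that zero assms(1) unfolding transvection_def[of k P \<delta> "transvection k P \<delta> x"]
      by (simp add: sum.neutral subset_iff)
    moreover have "transvection k P \<delta> (transvection k P \<delta> x) = x"
      using x assms(1,2) by (intro transvection_involution) (auto simp: cube_nz_iff)
    ultimately show False using x by (auto simp: cube_nz_iff)
  qed
  then show ?thesis using 01 by (auto simp: cube_nz_iff transvection_def)
qed

text \<open>Invertible linear maps send bases to bases. In terms of kernels: a vector \<open>v\<close> that is orthogonal to the
  images has an image \<open>w\<close> under the adjoint map that is orthogonal to the original basis. So \<open>w\<close> vanishes
  modulo 2, and then so does \<open>v\<close>, as the adjoint is injective.\<close>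

lemma transvection_f2_bases:
  assumes P: "P \<subseteq> {1..k}" "even (\<Sum>p\<in>P. \<delta> p)" and b: "b \<in> f2_bases k"
  shows "(\<lambda>j\<in>{1..k}. transvection k P \<delta> (b j)) \<in> f2_bases k"
proof -
  have bj: "b j \<in> cube_nz k" if "j \<in> {1..k}" for j using b that by (auto simp: f2_bases_def)
  have "nonsingular_mod2 {1..k} {1..k}
      (\<lambda>j i. int ((\<lambda>j\<in>{1..k}. transvection k P \<delta> (b j)) j i))"
    unfolding nonsingular_mod2_def
  proof (intro allI impI)
    fix v :: "nat \<Rightarrow> int"
    assume v: "\<forall>j\<in>{1..k}. even (\<Sum>i = 1..k. int ((\<lambda>j\<in>{1..k}. transvection k P \<delta> (b j)) j i) * v i)"
    define d where "d = (\<Sum>i = 1..k. int (\<delta> i) * v i)"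
    \<comment> \<open>The image of \<open>v\<close> under the adjoint of the transvection.\<close>
    define w where "w i = v i + d * of_bool (i \<in> P)" for i
    have restrict_P: "(\<Sum>i = 1..k. g i * of_bool (i \<in> P)) = (\<Sum>p\<in>P. g p)" for g :: "nat \<Rightarrow> int"
    proof -
      have "(\<Sum>i = 1..k. g i * of_bool (i \<in> P)) = (\<Sum>i = 1..k. if i \<in> P then g i else 0)"
        by (intro sum.cong) auto
      also have "\<dots> = (\<Sum>i\<in>{1..k} \<inter> P. g i)" by (simp add: sum.inter_restrict)
      finally show ?thesis using P(1) by (simp add: Int_absorb1)
    qed
    have sum_w: "(\<Sum>i = 1..k. g i * w i) = (\<Sum>i = 1..k. g i * v i) + (\<Sum>p\<in>P. g p) * d"
      for g :: "nat \<Rightarrow> int"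
    proof -
      have "(\<Sum>i = 1..k. g i * w i) = (\<Sum>i = 1..k. g i * v i + g i * of_bool (i \<in> P) * d)"
        by (intro sum.cong) (auto simp: w_def algebra_simps)
      then show ?thesis unfolding sum.distrib sum_distrib_right[symmetric] restrict_P .
    qed
    have "even (\<Sum>i = 1..k. int (b j i) * w i)" if j: "j \<in> {1..k}" for j
    proof -
      have "even (\<Sum>i = 1..k. int (transvection k P \<delta> (b j) i) * v i)" using v j by auto
      also have "even (\<Sum>i = 1..k. int (transvection k P \<delta> (b j) i) * v i) \<longleftrightarrow>
          even (\<Sum>i = 1..k. int (b j i + (\<Sum>p\<in>P. b j p) * \<delta> i) * v i)"
        using even_transvection[of _ k P \<delta> "b j"] by (intro even_sum_cong) (auto simp del: of_nat_add)
      also have "(\<Sum>i = 1..k. int (b j i + (\<Sum>p\<in>P. b j p) * \<delta> i) * v i) =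
          (\<Sum>i = 1..k. int (b j i) * v i) + (\<Sum>p\<in>P. int (b j p)) * d"
        by (simp add: d_def algebra_simps sum.distrib sum_distrib_left)
      also have "\<dots> = (\<Sum>i = 1..k. int (b j i) * w i)"
        by (rule sum_w[symmetric])
      finally show ?thesis .
    qed
    then have ev: "even (w i)" if "i \<in> {1..k}" for i
      using b that unfolding f2_bases_def nonsingular_mod2_def by blast
    \<comment> \<open>The pairing of \<open>\<delta>\<close> with \<open>w\<close> has the parity of \<open>d\<close>, because \<open>\<phi>(\<delta>) = 0\<close>.\<close>
    have "(\<Sum>i = 1..k. int (\<delta> i) * w i) = d + (\<Sum>p\<in>P. int (\<delta> p)) * d"
      unfolding sum_w by (simp add: d_def)
    moreover have "even (\<Sum>i = 1..k. int (\<delta> i) * w i)" using ev by (auto intro!: dvd_sum)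
    moreover have "even (\<Sum>p\<in>P. int (\<delta> p))" using P(2) by (metis even_of_nat of_nat_sum)
    ultimately have "even d" by simp
    then show "\<forall>i\<in>{1..k}. even (v i)" using ev by (auto simp: w_def)
  qed
  then show ?thesis
    using bj transvection_cube_nz[OF P] unfolding f2_bases_def by (auto simp: PiE_iff)
qed

text \<open>Take \<open>\<delta> = \<alpha> + \<beta>\<close> and a functional with \<open>\<phi>(\<alpha>) = \<phi>(\<beta>) = 1\<close>: a coordinate in which both are \<open>1\<close>, or else the sum
  of a coordinate in the support of \<open>\<alpha>\<close> only and one in the support of \<open>\<beta>\<close> only.\<close>

lemma exists_transvection:
  assumes "\<alpha> \<in> cube_nz k" "\<beta> \<in> cube_nz k"
  obtains P \<delta> where "P \<subseteq> {1..k}" "even (\<Sum>p\<in>P. \<delta> p)" "transvection k P \<delta> \<alpha> = \<beta>"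
proof -
  obtain i j where ij: "i \<in> {1..k}" "j \<in> {1..k}" "\<alpha> i = 1" "\<beta> j = 1"
    using assms by (auto simp: cube_nz_iff)
  have \<alpha>: "\<alpha> l = 0 \<or> \<alpha> l = 1" and \<beta>: "\<beta> l = 0 \<or> \<beta> l = 1" if "l \<in> {1..k}" for l
    using assms that by (auto simp: cube_nz_iff)
  define \<delta> where "\<delta> l = \<alpha> l + \<beta> l" for l
  have "\<exists>P. P \<subseteq> {1..k} \<and> (\<Sum>p\<in>P. \<alpha> p) = 1 \<and> (\<Sum>p\<in>P. \<beta> p) = 1"
  proof (cases "\<alpha> j = 1 \<or> \<beta> i = 1")
    case True
    then show ?thesis
    proof
      assume "\<alpha> j = 1" then show ?thesis using ij by (intro exI[of _ "{j}"]) auto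
    next
      assume "\<beta> i = 1" then show ?thesis using ij by (intro exI[of _ "{i}"]) auto
    qed
  next
    case False
    then have "\<alpha> j = 0" "\<beta> i = 0" "i \<noteq> j" using \<alpha>[OF ij(2)] \<beta>[OF ij(1)] ij by auto
    then show ?thesis using ij by (intro exI[of _ "{i, j}"]) auto
  qed
  then obtain P where P: "P \<subseteq> {1..k}" "(\<Sum>p\<in>P. \<alpha> p) = 1" "(\<Sum>p\<in>P. \<beta> p) = 1" by blast
  have "transvection k P \<delta> \<alpha> = \<beta>"
  proof (rule extensionalityI[of _ "{1..k}"])
    fix l assume l: "l \<in> {1..k}"
    have "transvection k P \<delta> \<alpha> l = (\<alpha> l + 1 * (\<alpha> l + \<beta> l)) mod 2"
      unfolding transvection_def P(2) \<delta>_def using l by simp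
    then show "transvection k P \<delta> \<alpha> l = \<beta> l" using \<alpha>[OF l] \<beta>[OF l] by auto
  qed (use assms in \<open>auto simp: transvection_def cube_nz_iff\<close>)
  moreover have "even (\<Sum>p\<in>P. \<delta> p)" using P by (simp add: \<delta>_def sum.distrib)
  ultimately show thesis using P(1) that by blast
qed

definition occurrences :: "nat \<Rightarrow> (nat \<Rightarrow> nat) \<Rightarrow> ((nat \<Rightarrow> nat \<Rightarrow> nat) \<times> nat) set" where
  "occurrences k \<alpha> = {(b, j). b \<in> f2_bases k \<and> j \<in> {1..k} \<and> b j = \<alpha>}"

lemma card_occurrences_eq:
  assumes "\<alpha> \<in> cube_nz k" "\<beta> \<in> cube_nz k"
  shows "card (occurrences k \<alpha>) = card (occurrences k \<beta>)"
proof -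
  obtain P \<delta> where P: "P \<subseteq> {1..k}" "even (\<Sum>p\<in>P. \<delta> p)" and T: "transvection k P \<delta> \<alpha> = \<beta>"
    using exists_transvection assms by blast
  have inv: "transvection k P \<delta> (transvection k P \<delta> x) = x" if "x \<in> cube_nz k" for x
    using that by (intro transvection_involution[OF P]) (auto simp: cube_nz_iff)
  define \<Phi> where "\<Phi> = (\<lambda>(b, j::nat). (\<lambda>i\<in>{1..k}. transvection k P \<delta> (b i), j))"
  have \<Phi>\<Phi>: "\<Phi> (\<Phi> (b, j)) = (b, j)" if "b \<in> f2_bases k" for b j
  proof -
    have "b \<in> {1..k} \<rightarrow>\<^sub>E cube_nz k" using that by (simp add: f2_bases_def)
    then have "(\<lambda>i\<in>{1..k}. transvection k P \<delta> (transvection k P \<delta> (b i))) = b"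
      by - (rule extensionalityI[of _ "{1..k}"], auto simp: inv PiE_iff)
    then show ?thesis by (simp add: \<Phi>_def restrict_def cong: if_cong)
  qed
  have T': "transvection k P \<delta> \<beta> = \<alpha>" using inv assms(1) T by auto
  have "bij_betw \<Phi> (occurrences k \<alpha>) (occurrences k \<beta>)"
  proof (rule bij_betw_byWitness[where f' = \<Phi>])
    show "\<forall>a\<in>occurrences k \<alpha>. \<Phi> (\<Phi> a) = a" "\<forall>a\<in>occurrences k \<beta>. \<Phi> (\<Phi> a) = a"
      by (auto simp: occurrences_def \<Phi>\<Phi>)
    show "\<Phi> ` occurrences k \<alpha> \<subseteq> occurrences k \<beta>" "\<Phi> ` occurrences k \<beta> \<subseteq> occurrences k \<alpha>"
      using T T' transvection_f2_bases[OF P] by (auto simp: occurrences_def \<Phi>_def)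
  qed
  then show ?thesis by (rule bij_betw_same_card)
qed

text \<open>The constant \<open>c\<close> is the common number of occurrences of a vector; its value follows by taking \<open>L = 1\<close>.\<close>

lemma sum_over_f2_bases:
  assumes "k \<ge> 1"
  obtains c :: real where "c > 0" "c * (2 ^ k - 1) = real k * real (card (f2_bases k))"
    "\<And>L :: (nat \<Rightarrow> nat) \<Rightarrow> real.
       (\<Sum>b\<in>f2_bases k. \<Sum>j = 1..k. L (b j)) = c * (\<Sum>\<alpha>\<in>cube_nz k. L \<alpha>)"
proof -
  define \<alpha>0 :: "nat \<Rightarrow> nat" where "\<alpha>0 = (\<lambda>i\<in>{1..k}. 1)"
  have \<alpha>0: "\<alpha>0 \<in> cube_nz k" using assms by (auto simp: cube_nz_iff \<alpha>0_def)
  define c where "c = real (card (occurrences k \<alpha>0))"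
  have sum_eq: "(\<Sum>b\<in>f2_bases k. \<Sum>j = 1..k. L (b j)) = c * (\<Sum>\<alpha>\<in>cube_nz k. L \<alpha>)" for L
  proof -
    have "(\<Sum>b\<in>f2_bases k. \<Sum>j = 1..k. L (b j)) =
        (\<Sum>p\<in>f2_bases k \<times> {1..k}. L (fst p (snd p)))"
      by (simp add: sum.cartesian_product case_prod_beta)
    also have "\<dots> = (\<Sum>\<alpha>\<in>cube_nz k.
        \<Sum>p\<in>{p \<in> f2_bases k \<times> {1..k}. fst p (snd p) = \<alpha>}. L (fst p (snd p)))"
      by (intro sum.group[symmetric] finite_cartesian_product finite_f2_bases finite_cube_nz)
        (auto simp: f2_bases_def)
    also have "\<dots> = (\<Sum>\<alpha>\<in>cube_nz k. c * L \<alpha>)"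
    proof (rule sum.cong)
      fix \<alpha> assume "\<alpha> \<in> cube_nz k"
      moreover have "{p \<in> f2_bases k \<times> {1..k}. fst p (snd p) = \<alpha>} = occurrences k \<alpha>"
        by (auto simp: occurrences_def)
      moreover have "(\<Sum>p\<in>occurrences k \<alpha>. L (fst p (snd p))) = (\<Sum>p\<in>occurrences k \<alpha>. L \<alpha>)"
        by (intro sum.cong) (auto simp: occurrences_def)
      ultimately show "(\<Sum>p\<in>{p \<in> f2_bases k \<times> {1..k}. fst p (snd p) = \<alpha>}. L (fst p (snd p))) = c * L \<alpha>"
        using card_occurrences_eq[OF _ \<alpha>0, of \<alpha>] by (simp add: c_def)
    qed simp
    finally show ?thesis by (simp add: sum_distrib_left)
  qed
  have card: "c * (2 ^ k - 1) = real k * real (card (f2_bases k))"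
    using sum_eq[of "\<lambda>_. 1"] by (simp add: card_cube_nz mult.commute)
  moreover have "c > 0"
  proof -
    have "real k * real (card (f2_bases k)) > 0"
      using assms f2_bases_nonempty finite_f2_bases by (simp add: card_gt_0_iff)
    then show ?thesis using card by (metis c_def mult_zero_left of_nat_0_less_iff of_nat_eq_0_iff neq0_conv less_irrefl)
  qed
  ultimately show thesis using sum_eq that by blast
qed

section \<open>The Brascamp-Lieb inequality for the cube\<close>

text \<open>Rewriting the index set \<open>{1..k}\<close> to \<open>{Suc 0..k}\<close> would keep the measurability rules for the product measure
  from matching.\<close>

declare One_nat_def [simp del]

lemma q_exp_pos: "k \<ge> 1 \<Longrightarrow> q_exp k > 0"
  using power_increasing[of 1 k "2::real"] by (auto simp: q_exp_def)

lemma measurable_cube_dot [measurable]: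
  "(\<lambda>h. cube_dot k \<alpha> h) \<in> PiM {1..k} (\<lambda>_. lborel) \<rightarrow>\<^sub>M (borel :: (real^'d::finite) measure)"
  unfolding cube_dot_def by (intro borel_measurable_sum borel_measurable_scaleR) auto

text \<open>With \<open>c\<close> occurrences of each vector among \<open>n\<close> bases, \<open>1 / q_exp k = c / n\<close>, so the left-hand side is the
  geometric mean of the products over one basis.\<close>

lemma cube_prod_le_basis_average:
  fixes t :: "(nat \<Rightarrow> nat) \<Rightarrow> real"
  assumes k: "k \<ge> 1" and t: "\<And>\<alpha>. \<alpha> \<in> cube_nz k \<Longrightarrow> t \<alpha> \<ge> 0"
  shows "(\<Prod>\<alpha>\<in>cube_nz k. t \<alpha> powr (1 / q_exp k))
    \<le> (\<Sum>b\<in>f2_bases k. (\<Prod>j = 1..k. t (b j)) / card (f2_bases k))"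
proof (cases "\<exists>\<alpha>\<in>cube_nz k. t \<alpha> = 0")
  case True
  then have "(\<Prod>\<alpha>\<in>cube_nz k. t \<alpha> powr (1 / q_exp k)) = 0"
    using finite_cube_nz by auto
  moreover have "(\<Sum>b\<in>f2_bases k. (\<Prod>j = 1..k. t (b j)) / card (f2_bases k)) \<ge> 0"
    by (intro sum_nonneg divide_nonneg_nonneg prod_nonneg) (auto simp: f2_bases_def intro!: t)
  ultimately show ?thesis by simp
next
  case False
  then have pos: "t \<alpha> > 0" if "\<alpha> \<in> cube_nz k" for \<alpha> using t that by force
  define n where "n = real (card (f2_bases k))"
  have n: "n > 0" using f2_bases_nonempty finite_f2_bases by (auto simp: n_def card_gt_0_iff)
  obtain c where c: "c * (2 ^ k - 1) = real k * n"
    "\<And>L :: (nat \<Rightarrow> nat) \<Rightarrow> real.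
       (\<Sum>b\<in>f2_bases k. \<Sum>j = 1..k. L (b j)) = c * (\<Sum>\<alpha>\<in>cube_nz k. L \<alpha>)"
    using sum_over_f2_bases[OF k] unfolding n_def by metis
  have "(2::real) ^ k - 1 > 0" using power_increasing[of 1 k "2::real"] k by simp
  then have q: "1 / q_exp k = c / n"
    using c(1) n by (simp add: q_exp_def divide_simps mult.commute)
  have b: "b j \<in> cube_nz k" if "b \<in> f2_bases k" "j \<in> {1..k}" for b j
    using that by (auto simp: f2_bases_def)
  have pos_b: "0 < (\<Prod>j = 1..k. t (b j))" if "b \<in> f2_bases k" for b
    by (intro prod_pos pos b that)
  have "(\<Prod>\<alpha>\<in>cube_nz k. t \<alpha> powr (1 / q_exp k)) = exp (c / n * (\<Sum>\<alpha>\<in>cube_nz k. ln (t \<alpha>)))"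
    using pos finite_cube_nz unfolding q sum_distrib_left
    by (subst exp_sum) (auto simp: powr_def intro!: prod.cong dest: pos)
  also have "c / n * (\<Sum>\<alpha>\<in>cube_nz k. ln (t \<alpha>)) = 1 / n * (\<Sum>b\<in>f2_bases k. \<Sum>j = 1..k. ln (t (b j)))"
    using c(2)[of "\<lambda>\<alpha>. ln (t \<alpha>)"] by simp
  also have "(\<Sum>b\<in>f2_bases k. \<Sum>j = 1..k. ln (t (b j))) = (\<Sum>b\<in>f2_bases k. ln (\<Prod>j = 1..k. t (b j)))"
    using b pos by (intro sum.cong refl ln_prod[symmetric]) force+
  also have "\<dots> = ln (\<Prod>b\<in>f2_bases k. \<Prod>j = 1..k. t (b j))"
    by (intro ln_prod[symmetric] pos_b[THEN less_imp_neq, THEN not_sym] finite_f2_bases) auto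
  also have "exp (1 / n * \<dots>) = (\<Prod>b\<in>f2_bases k. \<Prod>j = 1..k. t (b j)) powr (1 / n)"
    using prod_pos[of "f2_bases k" "\<lambda>b. \<Prod>j = 1..k. t (b j)"] pos_b by (auto simp: powr_def)
  also have "\<dots> \<le> (\<Sum>b\<in>f2_bases k. (\<Prod>j = 1..k. t (b j)) / n)"
    unfolding n_def using pos_b finite_f2_bases f2_bases_nonempty
    by (intro arith_geom_mean) (auto intro: less_imp_le)
  finally show ?thesis by (simp add: n_def)
qed

lemma nn_integral_cube_prod_le_1:
  fixes F :: "(nat \<Rightarrow> nat) \<Rightarrow> real^'d::finite \<Rightarrow> real"
  assumes k: "k \<ge> 1"
    and F: "\<And>\<alpha>. \<alpha> \<in> cube_nz k \<Longrightarrow> F \<alpha> \<in> borel_measurable borel"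
      "\<And>\<alpha> x. \<alpha> \<in> cube_nz k \<Longrightarrow> F \<alpha> x \<ge> 0"
      "\<And>\<alpha>. \<alpha> \<in> cube_nz k \<Longrightarrow> (\<integral>\<^sup>+x. ennreal (F \<alpha> x) \<partial>lborel) \<le> 1"
  shows "(\<integral>\<^sup>+h. ennreal (\<Prod>\<alpha>\<in>cube_nz k. F \<alpha> (cube_dot k \<alpha> h) powr (1 / q_exp k))
    \<partial>PiM {1..k} (\<lambda>_. lborel)) \<le> 1"
proof -
  define n where "n = real (card (f2_bases k))"
  have n: "n > 0" using f2_bases_nonempty finite_f2_bases by (auto simp: n_def card_gt_0_iff)
  have b: "b j \<in> cube_nz k" if "b \<in> f2_bases k" "j \<in> {1..k}" for b j
    using that by (auto simp: f2_bases_def)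
  have "(\<integral>\<^sup>+h. ennreal (\<Prod>\<alpha>\<in>cube_nz k. F \<alpha> (cube_dot k \<alpha> h) powr (1 / q_exp k)) \<partial>PiM {1..k} (\<lambda>_. lborel))
    \<le> (\<integral>\<^sup>+h. (\<Sum>b\<in>f2_bases k. ennreal (1 / n) * (\<Prod>j = 1..k. ennreal (F (b j) (cube_dot k (b j) h))))
        \<partial>PiM {1..k} (\<lambda>_. lborel))"
  proof (rule nn_integral_mono)
    fix h :: "nat \<Rightarrow> real^'d"
    have "ennreal (\<Prod>\<alpha>\<in>cube_nz k. F \<alpha> (cube_dot k \<alpha> h) powr (1 / q_exp k))
      \<le> ennreal (\<Sum>b\<in>f2_bases k. 1 / n * (\<Prod>j = 1..k. F (b j) (cube_dot k (b j) h)))"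
      using cube_prod_le_basis_average[OF k, of "\<lambda>\<alpha>. F \<alpha> (cube_dot k \<alpha> h)"] F(2)
      by (intro ennreal_leI) (auto simp: n_def)
    also have "\<dots> = (\<Sum>b\<in>f2_bases k. ennreal (1 / n) * (\<Prod>j = 1..k. ennreal (F (b j) (cube_dot k (b j) h))))"
    proof -
      have nn: "0 \<le> (\<Prod>j = 1..k. F (b j) (cube_dot k (b j) h))" if "b \<in> f2_bases k" for b
        by (intro prod_nonneg F(2) ballI b[OF that])
      have "ennreal (1 / n) * (\<Prod>j = 1..k. ennreal (F (b j) (cube_dot k (b j) h))) =
          ennreal (1 / n * (\<Prod>j = 1..k. F (b j) (cube_dot k (b j) h)))" if "b \<in> f2_bases k" for b
        using n nn[OF that] F(2) b[OF that] by (subst prod_ennreal) (auto simp: ennreal_mult[symmetric])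
      then show ?thesis
        using n nn by (simp add: sum_ennreal)
    qed
    finally show "ennreal (\<Prod>\<alpha>\<in>cube_nz k. F \<alpha> (cube_dot k \<alpha> h) powr (1 / q_exp k)) \<le> \<dots>" .
  qed
  also have "\<dots> = (\<Sum>b\<in>f2_bases k. ennreal (1 / n) *
      (\<integral>\<^sup>+h. (\<Prod>j = 1..k. ennreal (F (b j) (cube_dot k (b j) h))) \<partial>PiM {1..k} (\<lambda>_. lborel)))"
    using b F(1) measurable_compose[OF measurable_cube_dot]
    by (subst nn_integral_sum)
      (auto intro!: sum.cong nn_integral_cmult borel_measurable_prod measurable_compose[OF _ measurable_ennreal]
        borel_measurable_times)
  also have "\<dots> \<le> (\<Sum>b\<in>f2_bases k. ennreal (1 / n) * 1)"
  proof (intro sum_mono mult_left_mono)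
    fix b assume bb: "b \<in> f2_bases k"
    have ns: "nonsingular_mod2 {1..k} {1..k} (\<lambda>j i. int (b j i))" using bb by (simp add: f2_bases_def)
    have "(\<integral>\<^sup>+h. (\<Prod>j = 1..k. ennreal (F (b j) (cube_dot k (b j) h))) \<partial>PiM {1..k} (\<lambda>_. lborel))
      \<le> (\<Prod>j = 1..k. \<integral>\<^sup>+x. ennreal (F (b j) x) \<partial>lborel)"
      using nn_integral_integer_forms_le[OF _ _ _ _ ns, of "\<lambda>j x. ennreal (F (b j) x)"] F(1) b bb
      by (auto simp: cube_dot_def)
    also have "\<dots> \<le> 1" using F(3) b bb by (intro prod_le_1) auto
    finally show "(\<integral>\<^sup>+h. (\<Prod>j = 1..k. ennreal (F (b j) (cube_dot k (b j) h))) \<partial>PiM {1..k} (\<lambda>_. lborel)) \<le> 1" .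
  qed auto
  also have "\<dots> = 1"
    using n by (simp add: n_def ennreal_of_nat_eq_real_of_nat ennreal_mult[symmetric])
  finally show ?thesis .
qed

text \<open>Normalising by \<open>(\<integral> F\<^sub>\<alpha>) + e\<close> instead of \<open>\<integral> F\<^sub>\<alpha>\<close> covers functions with integral zero without a separate
  argument; then \<open>e\<close> tends to \<open>0\<close>.\<close>

lemma nn_integral_cube_prod_le:
  fixes F :: "(nat \<Rightarrow> nat) \<Rightarrow> real^'d::finite \<Rightarrow> real"
  assumes k: "k \<ge> 1"
    and F: "\<And>\<alpha>. \<alpha> \<in> cube_nz k \<Longrightarrow> integrable lborel (F \<alpha>)"
      "\<And>\<alpha> x. \<alpha> \<in> cube_nz k \<Longrightarrow> F \<alpha> x \<ge> 0"
  shows "(\<integral>\<^sup>+h. ennreal (\<Prod>\<alpha>\<in>cube_nz k. F \<alpha> (cube_dot k \<alpha> h) powr (1 / q_exp k))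
      \<partial>PiM {1..k} (\<lambda>_. lborel))
    \<le> ennreal (\<Prod>\<alpha>\<in>cube_nz k. (LINT x|lborel. F \<alpha> x) powr (1 / q_exp k))" (is "?L \<le> _")
proof (rule tendsto_lowerbound)
  let ?A = "\<lambda>\<alpha>. LINT x|lborel. F \<alpha> x"
  let ?r = "1 / q_exp k"
  have r: "?r > 0" using q_exp_pos[OF k] by simp
  have A: "?A \<alpha> \<ge> 0" if "\<alpha> \<in> cube_nz k" for \<alpha> using F(2)[OF that] by (intro Bochner_Integration.integral_nonneg)
  show "((\<lambda>e. ennreal (\<Prod>\<alpha>\<in>cube_nz k. (?A \<alpha> + e) powr ?r)) \<longlongrightarrow>
      ennreal (\<Prod>\<alpha>\<in>cube_nz k. ?A \<alpha> powr ?r)) (at_right 0)"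
  proof (intro tendsto_ennrealI tendsto_prod tendsto_powr')
    fix \<alpha> assume \<alpha>: "\<alpha> \<in> cube_nz k"
    show "((\<lambda>e. ?A \<alpha> + e) \<longlongrightarrow> ?A \<alpha>) (at_right 0)" by (auto intro!: tendsto_eq_intros)
    have "\<forall>\<^sub>F e in at_right 0. 0 \<le> ?A \<alpha> + e"
      using eventually_at_right_less by (rule eventually_mono) (use A[OF \<alpha>] in auto)
    then show "?A \<alpha> \<noteq> 0 \<or> ?r > 0 \<and> (\<forall>\<^sub>F e in at_right 0. 0 \<le> ?A \<alpha> + e)" using r by blast
  qed auto
  show "\<forall>\<^sub>F e in at_right 0. ?L \<le> ennreal (\<Prod>\<alpha>\<in>cube_nz k. (?A \<alpha> + e) powr ?r)"
  proof (rule eventually_mono[OF eventually_at_right_less])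
    fix e :: real assume e: "0 < e"
    define C where "C = (\<Prod>\<alpha>\<in>cube_nz k. (?A \<alpha> + e) powr ?r)"
    have Ae: "?A \<alpha> + e > 0" if "\<alpha> \<in> cube_nz k" for \<alpha> using A[OF that] e by simp
    have C: "C > 0" unfolding C_def using Ae by (intro prod_pos) force
    have eq: "(\<Prod>\<alpha>\<in>cube_nz k. F \<alpha> (cube_dot k \<alpha> h) powr ?r) =
        C * (\<Prod>\<alpha>\<in>cube_nz k. (F \<alpha> (cube_dot k \<alpha> h) / (?A \<alpha> + e)) powr ?r)" for h
      unfolding C_def prod.distrib[symmetric] using Ae F(2)
      by (intro prod.cong refl) (simp add: powr_divide less_imp_le less_imp_neq[symmetric])
    have "?L = (\<integral>\<^sup>+h. ennreal C * ennreal (\<Prod>\<alpha>\<in>cube_nz k. (F \<alpha> (cube_dot k \<alpha> h) / (?A \<alpha> + e)) powr ?r)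
        \<partial>PiM {1..k} (\<lambda>_. lborel))"
      unfolding eq using C by (intro nn_integral_cong) (auto simp: ennreal_mult prod_nonneg)
    also have "\<dots> = ennreal C * (\<integral>\<^sup>+h. ennreal (\<Prod>\<alpha>\<in>cube_nz k. (F \<alpha> (cube_dot k \<alpha> h) / (?A \<alpha> + e)) powr ?r)
        \<partial>PiM {1..k} (\<lambda>_. lborel))"
      using borel_measurable_integrable[OF F(1)]
      by (intro nn_integral_cmult measurable_compose[OF _ measurable_ennreal] borel_measurable_prod
        powr_real_measurable borel_measurable_divide measurable_compose[OF measurable_cube_dot]) auto
    also have "\<dots> \<le> ennreal C * 1"
    proof (intro mult_left_mono nn_integral_cube_prod_le_1 k)
      fix \<alpha> assume \<alpha>: "\<alpha> \<in> cube_nz k"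
      show "(\<lambda>x. F \<alpha> x / (?A \<alpha> + e)) \<in> borel_measurable borel"
        using borel_measurable_integrable[OF F(1)[OF \<alpha>]] by auto
      show "F \<alpha> x / (?A \<alpha> + e) \<ge> 0" for x using F(2)[OF \<alpha>] Ae[OF \<alpha>] by auto
      have "(\<integral>\<^sup>+x. ennreal (F \<alpha> x / (?A \<alpha> + e)) \<partial>lborel) = ennreal (LINT x|lborel. F \<alpha> x / (?A \<alpha> + e))"
        using F \<alpha> Ae[OF \<alpha>] by (intro nn_integral_eq_integral) auto
      also have "\<dots> \<le> 1" using Ae[OF \<alpha>] e by simp
      finally show "(\<integral>\<^sup>+x. ennreal (F \<alpha> x / (?A \<alpha> + e)) \<partial>lborel) \<le> 1" .
    qed auto
    finally show "?L \<le> ennreal (\<Prod>\<alpha>\<in>cube_nz k. (?A \<alpha> + e) powr ?r)" by (simp add: C_def)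
  qed
qed simp

section \<open>Bounds for cubic convolution products\<close>

lemma
  fixes f :: "'a::euclidean_space \<Rightarrow> real"
  assumes "f \<in> borel_measurable borel"
  shows integrable_lborel_plus: "integrable lborel (\<lambda>y. f (x + y)) \<longleftrightarrow> integrable lborel f"
    and integral_lborel_plus: "(LINT y|lborel. f (x + y)) = (LINT y|lborel. f y)"
  using assms integrable_distr_eq[of "(+) x" lborel borel f] integral_distr[of "(+) x" lborel borel f]
  by (simp_all add: lborel_distr_plus)

lemma Lspace_plus_arg: "f \<in> Lspace q \<Longrightarrow> (\<lambda>y. f (x + y)) \<in> Lspace q"
  using integrable_lborel_plus[of "\<lambda>y. \<bar>f y\<bar> powr q" x] by (auto simp: Lspace_def)

lemma Lnorm_plus_arg: "f \<in> Lspace q \<Longrightarrow> Lnorm q (\<lambda>y. f (x + y)) = Lnorm q f"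
  using integral_lborel_plus[of "\<lambda>y. \<bar>f y\<bar> powr q" x] by (auto simp: Lspace_def Lnorm_def)

lemma abs_add_powr_le:
  fixes a b q :: real
  assumes "q \<ge> 0" shows "(\<bar>a\<bar> + \<bar>b\<bar>) powr q \<le> 2 powr q * (\<bar>a\<bar> powr q + \<bar>b\<bar> powr q)"
proof -
  have "(\<bar>a\<bar> + \<bar>b\<bar>) powr q \<le> (2 * max \<bar>a\<bar> \<bar>b\<bar>) powr q" using assms by (intro powr_mono2) auto
  also have "\<dots> = 2 powr q * max \<bar>a\<bar> \<bar>b\<bar> powr q" by (simp add: powr_mult)
  also have "\<dots> \<le> 2 powr q * (\<bar>a\<bar> powr q + \<bar>b\<bar> powr q)"
    by (intro mult_left_mono) (auto simp: max_def)
  finally show ?thesis .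
qed

lemma Lspace_add_abs:
  assumes "q \<ge> 0" "f \<in> Lspace q" "g \<in> Lspace q" shows "(\<lambda>x. \<bar>f x\<bar> + \<bar>g x\<bar>) \<in> Lspace q"
proof -
  have [measurable]: "f \<in> borel_measurable borel" "g \<in> borel_measurable borel"
    using assms by (auto simp: Lspace_def)
  have "integrable lborel (\<lambda>x. 2 powr q * (\<bar>f x\<bar> powr q + \<bar>g x\<bar> powr q))"
    using assms by (auto simp: Lspace_def)
  then have "integrable lborel (\<lambda>x. \<bar>\<bar>f x\<bar> + \<bar>g x\<bar>\<bar> powr q)"
    by (rule Bochner_Integration.integrable_bound)
      (auto intro!: AE_I2 order_trans[OF abs_add_powr_le[OF assms(1)]])
  then show ?thesis by (auto simp: Lspace_def)
qed

lemma Lspace_dominated: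
  assumes "q \<ge> 0" "g \<in> Lspace q" "f \<in> borel_measurable borel" "\<And>x. \<bar>f x\<bar> \<le> \<bar>g x\<bar>"
  shows "f \<in> Lspace q"
proof -
  have "integrable lborel (\<lambda>x. \<bar>f x\<bar> powr q)"
    by (rule Bochner_Integration.integrable_bound[of _ "\<lambda>x. \<bar>g x\<bar> powr q"])
      (use assms in \<open>auto simp: Lspace_def intro!: AE_I2 powr_mono2\<close>)
  then show ?thesis using assms(3) by (simp add: Lspace_def)
qed

lemma Lspace_diff:
  assumes "q \<ge> 0" "f \<in> Lspace q" "g \<in> Lspace q" shows "(\<lambda>x. f x - g x) \<in> Lspace q"
  using assms(2,3)
  by (intro Lspace_dominated[OF assms(1) Lspace_add_abs[OF assms]]) (auto simp: Lspace_def)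

lemma nn_integral_cube_prod_le_Lnorm:
  fixes f :: "(nat \<Rightarrow> nat) \<Rightarrow> real^'d::finite \<Rightarrow> real"
  assumes k: "k \<ge> 1" and f: "\<And>\<alpha>. \<alpha> \<in> cube_nz k \<Longrightarrow> f \<alpha> \<in> Lspace (q_exp k)"
  shows "(\<integral>\<^sup>+h. ennreal (\<Prod>\<alpha>\<in>cube_nz k. \<bar>f \<alpha> (x + cube_dot k \<alpha> h)\<bar>) \<partial>PiM {1..k} (\<lambda>_. lborel))
    \<le> ennreal (\<Prod>\<alpha>\<in>cube_nz k. Lnorm (q_exp k) (f \<alpha>))"
proof -
  have q: "q_exp k > 0" by (rule q_exp_pos[OF k])
  have "(\<integral>\<^sup>+h. ennreal (\<Prod>\<alpha>\<in>cube_nz k. (\<bar>f \<alpha> (x + cube_dot k \<alpha> h)\<bar> powr q_exp k) powr (1 / q_exp k))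
      \<partial>PiM {1..k} (\<lambda>_. lborel))
    \<le> ennreal (\<Prod>\<alpha>\<in>cube_nz k. (LINT y|lborel. \<bar>f \<alpha> (x + y)\<bar> powr q_exp k) powr (1 / q_exp k))"
    using Lspace_plus_arg[OF f, of _ x]
    by (intro nn_integral_cube_prod_le[OF k, of "\<lambda>\<alpha> y. \<bar>f \<alpha> (x + y)\<bar> powr q_exp k"]) (auto simp: Lspace_def)
  also have "\<dots> = ennreal (\<Prod>\<alpha>\<in>cube_nz k. Lnorm (q_exp k) (f \<alpha>))"
    using Lnorm_plus_arg[OF f, of _ x] by (auto simp: Lnorm_def intro!: arg_cong[of _ _ ennreal] prod.cong)
  finally show ?thesis using q by (simp add: powr_powr)
qed

lemma measurable_cube_prod:
  fixes f :: "(nat \<Rightarrow> nat) \<Rightarrow> real^'d::finite \<Rightarrow> real"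
  assumes "\<And>\<alpha>. \<alpha> \<in> cube_nz k \<Longrightarrow> f \<alpha> \<in> borel_measurable borel"
  shows "(\<lambda>h. \<Prod>\<alpha>\<in>cube_nz k. f \<alpha> (x + cube_dot k \<alpha> h)) \<in> borel_measurable (PiM {1..k} (\<lambda>_. lborel))"
  by (intro borel_measurable_prod measurable_compose[OF _ assms] borel_measurable_add measurable_cube_dot) auto

lemma integrable_cube_prod:
  fixes f :: "(nat \<Rightarrow> nat) \<Rightarrow> real^'d::finite \<Rightarrow> real"
  assumes k: "k \<ge> 1" and f: "\<And>\<alpha>. \<alpha> \<in> cube_nz k \<Longrightarrow> f \<alpha> \<in> Lspace (q_exp k)"
  shows "integrable (PiM {1..k} (\<lambda>_. lborel)) (\<lambda>h. \<Prod>\<alpha>\<in>cube_nz k. f \<alpha> (x + cube_dot k \<alpha> h))"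
proof (rule integrableI_bounded)
  show "(\<lambda>h. \<Prod>\<alpha>\<in>cube_nz k. f \<alpha> (x + cube_dot k \<alpha> h)) \<in> borel_measurable (PiM {1..k} (\<lambda>_. lborel))"
    using f by (intro measurable_cube_prod) (auto simp: Lspace_def)
  show "(\<integral>\<^sup>+h. ennreal (norm (\<Prod>\<alpha>\<in>cube_nz k. f \<alpha> (x + cube_dot k \<alpha> h))) \<partial>PiM {1..k} (\<lambda>_. lborel)) < \<infinity>"
    using nn_integral_cube_prod_le_Lnorm[of k f x, OF assms] by (simp add: abs_prod order.strict_trans1)
qed

text \<open>The case \<open>F\<^sub>\<alpha>(y) = \<bar>f\<^sub>\<alpha>(x + y)\<bar> powr q\<close> of the Brascamp-Lieb inequality.\<close>

lemma cubic_conv_bound: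
  fixes f :: "(nat \<Rightarrow> nat) \<Rightarrow> real^'d::finite \<Rightarrow> real"
  assumes k: "k \<ge> 1" and f: "\<And>\<alpha>. \<alpha> \<in> cube_nz k \<Longrightarrow> f \<alpha> \<in> Lspace (q_exp k)"
  shows "\<bar>cubic_conv k f x\<bar> \<le> (\<Prod>\<alpha>\<in>cube_nz k. Lnorm (q_exp k) (f \<alpha>))"
proof -
  have "ennreal (norm (cubic_conv k f x)) \<le>
      (\<integral>\<^sup>+h. ennreal (norm (\<Prod>\<alpha>\<in>cube_nz k. f \<alpha> (x + cube_dot k \<alpha> h))) \<partial>PiM {1..k} (\<lambda>_. lborel))"
    unfolding cubic_conv_def by (intro integral_norm_bound_ennreal integrable_cube_prod assms)
  also have "\<dots> \<le> ennreal (\<Prod>\<alpha>\<in>cube_nz k. Lnorm (q_exp k) (f \<alpha>))"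
    using nn_integral_cube_prod_le_Lnorm[of k f x, OF assms] by (simp add: abs_prod)
  finally show ?thesis
    by (subst (asm) ennreal_le_iff) (auto intro!: prod_nonneg simp: Lnorm_def)
qed

lemma abs_prod_diff_le:
  fixes a b :: "'i \<Rightarrow> real"
  assumes "finite S"
  shows "\<bar>prod a S - prod b S\<bar> \<le> (\<Sum>i\<in>S. \<Prod>j\<in>S. if j = i then \<bar>a j - b j\<bar> else \<bar>a j\<bar> + \<bar>b j\<bar>)"
  using assms
proof (induction S rule: finite_induct)
  case (insert s S)
  let ?c = "\<lambda>i j. if j = i then \<bar>a j - b j\<bar> else \<bar>a j\<bar> + \<bar>b j\<bar>"
  have "prod a (insert s S) - prod b (insert s S) =
      (a s - b s) * prod a S + b s * (prod a S - prod b S)"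
    using insert by (simp add: algebra_simps)
  also have "\<bar>\<dots>\<bar> \<le> \<bar>a s - b s\<bar> * \<bar>prod a S\<bar> + \<bar>b s\<bar> * \<bar>prod a S - prod b S\<bar>"
    by (simp add: abs_mult[symmetric])
  also have "\<dots> \<le> \<bar>a s - b s\<bar> * (\<Prod>j\<in>S. \<bar>a j\<bar> + \<bar>b j\<bar>) +
      (\<bar>a s\<bar> + \<bar>b s\<bar>) * (\<Sum>i\<in>S. \<Prod>j\<in>S. ?c i j)"
    unfolding abs_prod
    by (intro add_mono mult_mono insert.IH prod_mono prod_nonneg sum_nonneg) auto
  also have "\<dots> = (\<Sum>i\<in>insert s S. \<Prod>j\<in>insert s S. ?c i j)"
  proof -
    have "(\<Prod>j\<in>S. ?c s j) = (\<Prod>j\<in>S. \<bar>a j\<bar> + \<bar>b j\<bar>)"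
      using insert by (intro prod.cong) auto
    moreover have "(\<Sum>i\<in>S. \<Prod>j\<in>insert s S. ?c i j) = (\<Sum>i\<in>S. (\<bar>a s\<bar> + \<bar>b s\<bar>) * (\<Prod>j\<in>S. ?c i j))"
      using insert by (intro sum.cong) auto
    ultimately show ?thesis using insert by (simp add: sum_distrib_left)
  qed
  finally show ?case .
qed simp

text \<open>This bounds the difference of the cubic convolution products of \<open>f\<close> and \<open>g\<close>: the terms come from
  replacing the factors one at a time, with both functions in each of the other places so that the
  expression is symmetric and independent of the order of replacement.\<close>

definition telescoping_bound ::
    "nat \<Rightarrow> ((nat \<Rightarrow> nat) \<Rightarrow> real^'d::finite \<Rightarrow> real) \<Rightarrow> ((nat \<Rightarrow> nat) \<Rightarrow> real^'d \<Rightarrow> real) \<Rightarrow> real" where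
  "telescoping_bound k f g = (\<Sum>\<alpha>\<in>cube_nz k. \<Prod>\<beta>\<in>cube_nz k. Lnorm (q_exp k)
     (\<lambda>x. if \<beta> = \<alpha> then \<bar>f \<beta> x - g \<beta> x\<bar> else \<bar>f \<beta> x\<bar> + \<bar>g \<beta> x\<bar>))"

lemma cubic_conv_diff_le:
  fixes f g :: "(nat \<Rightarrow> nat) \<Rightarrow> real^'d::finite \<Rightarrow> real"
  assumes k: "k \<ge> 1" and f: "\<And>\<alpha>. \<alpha> \<in> cube_nz k \<Longrightarrow> f \<alpha> \<in> Lspace (q_exp k)"
    and g: "\<And>\<alpha>. \<alpha> \<in> cube_nz k \<Longrightarrow> g \<alpha> \<in> Lspace (q_exp k)"
  shows "\<bar>cubic_conv k f x - cubic_conv k g x\<bar> \<le> telescoping_bound k f g"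
proof -
  let ?M = "PiM {1..k} (\<lambda>_. lborel) :: (nat \<Rightarrow> real^'d) measure"
  let ?c = "\<lambda>\<alpha> \<beta> y. if \<beta> = \<alpha> then \<bar>f \<beta> y - g \<beta> y\<bar> else \<bar>f \<beta> y\<bar> + \<bar>g \<beta> y\<bar>"
  let ?P = "\<lambda>f h. \<Prod>\<alpha>\<in>cube_nz k. f \<alpha> (x + cube_dot k \<alpha> h)"
  have q: "q_exp k \<ge> 0" using q_exp_pos[OF k] by simp
  have c: "?c \<alpha> \<beta> \<in> Lspace (q_exp k)" if "\<beta> \<in> cube_nz k" for \<alpha> \<beta>
  proof (cases "\<beta> = \<alpha>")
    case True
    then show ?thesis using f[OF that] g[OF that]
      by (intro Lspace_dominated[OF q Lspace_diff[OF q f[OF that] g[OF that]]]) (auto simp: Lspace_def)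
  next
    case False
    then show ?thesis using Lspace_add_abs[OF q f g] that by simp
  qed
  have c_abs: "\<bar>?c \<alpha> \<beta> y\<bar> = ?c \<alpha> \<beta> y" for \<alpha> \<beta> y by auto
  have "ennreal (norm (cubic_conv k f x - cubic_conv k g x)) = ennreal (norm (LINT h|?M. ?P f h - ?P g h))"
    unfolding cubic_conv_def
    by (subst Bochner_Integration.integral_diff) (auto intro!: integrable_cube_prod assms)
  also have "\<dots> \<le> (\<integral>\<^sup>+h. ennreal (norm (?P f h - ?P g h)) \<partial>?M)"
    by (intro integral_norm_bound_ennreal Bochner_Integration.integrable_diff integrable_cube_prod assms)
  also have "\<dots> \<le> (\<integral>\<^sup>+h. (\<Sum>\<alpha>\<in>cube_nz k. ennreal (\<Prod>\<beta>\<in>cube_nz k. \<bar>?c \<alpha> \<beta> (x + cube_dot k \<beta> h)\<bar>)) \<partial>?M)"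
    unfolding c_abs using abs_prod_diff_le[OF finite_cube_nz]
    by (intro nn_integral_mono, subst sum_ennreal) (auto intro!: ennreal_leI prod_nonneg)
  also have "\<dots> = (\<Sum>\<alpha>\<in>cube_nz k. \<integral>\<^sup>+h. ennreal (\<Prod>\<beta>\<in>cube_nz k. \<bar>?c \<alpha> \<beta> (x + cube_dot k \<beta> h)\<bar>) \<partial>?M)"
    using measurable_cube_prod[of k "\<lambda>\<beta> y. \<bar>?c _ \<beta> y\<bar>" x] c
    by (intro nn_integral_sum measurable_compose[OF _ measurable_ennreal] measurable_cube_prod[of k "\<lambda>\<beta> y. \<bar>?c _ \<beta> y\<bar>" x])
      (auto simp: Lspace_def)
  also have "\<dots> \<le> (\<Sum>\<alpha>\<in>cube_nz k. ennreal (\<Prod>\<beta>\<in>cube_nz k. Lnorm (q_exp k) (?c \<alpha> \<beta>)))"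
    using c by (intro sum_mono nn_integral_cube_prod_le_Lnorm[OF k]) auto
  also have "\<dots> = ennreal (telescoping_bound k f g)"
    unfolding telescoping_bound_def by (intro sum_ennreal prod_nonneg) (auto simp: Lnorm_def)
  finally show ?thesis
    by (subst (asm) ennreal_le_iff)
      (auto simp: telescoping_bound_def Lnorm_def intro!: sum_nonneg prod_nonneg)
qed

section \<open>Density of continuous functions with compact support\<close>

definition Cc :: "(real^'d::finite \<Rightarrow> real) set" where
  "Cc = {f. continuous_on UNIV f \<and> (\<exists>R. \<forall>x. norm x > R \<longrightarrow> f x = 0)}"

lemma Cc_bound:
  assumes "f \<in> Cc"
  obtains M R where "M \<ge> 0" "R \<ge> 0" "\<And>x. \<bar>f x\<bar> \<le> M * indicator (cball 0 R) x"
proof -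
  from assms obtain R where R: "continuous_on UNIV f" "\<And>x. norm x > R \<Longrightarrow> f x = 0"
    by (auto simp: Cc_def)
  have "bounded (f ` cball 0 (max R 0))"
    by (intro compact_imp_bounded compact_continuous_image continuous_on_subset[OF R(1)]) auto
  then obtain M where M: "M > 0" "\<And>x. norm x \<le> max R 0 \<Longrightarrow> \<bar>f x\<bar> \<le> M"
    by (auto simp: bounded_pos)
  have "\<bar>f x\<bar> \<le> M * indicator (cball 0 (max R 0)) x" for x
    using M R(2)[of x] by (auto simp: indicator_def)
  then show thesis using that[of M "max R 0"] M by simp
qed

lemma Cc_uniformly_continuous:
  assumes "f \<in> Cc" "e > 0"
  obtains \<delta> where "\<delta> > 0" "\<And>x y. dist x y < \<delta> \<Longrightarrow> \<bar>f x - f y\<bar> < e"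
proof -
  from assms(1) obtain R where R: "continuous_on UNIV f" "\<And>x. norm x > R \<Longrightarrow> f x = 0"
    by (auto simp: Cc_def)
  have "uniformly_continuous_on (cball 0 (R + 1)) f"
    by (intro compact_uniformly_continuous continuous_on_subset[OF R(1)]) auto
  then obtain \<delta> where \<delta>: "\<delta> > 0"
    "\<And>x y. norm x \<le> R + 1 \<Longrightarrow> norm y \<le> R + 1 \<Longrightarrow> dist x y < \<delta> \<Longrightarrow> dist (f x) (f y) < e"
    using assms(2) unfolding uniformly_continuous_on_def by (metis dist_commute mem_cball_0)
  have "\<bar>f x - f y\<bar> < e" if "dist x y < min \<delta> 1" for x y
  proof (cases "norm x \<le> R \<or> norm y \<le> R")
    case True
    have "norm x \<le> norm y + dist x y" "norm y \<le> norm x + dist x y"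
      unfolding dist_norm by norm+
    then have "norm x \<le> R + 1" "norm y \<le> R + 1" using True that by auto
    then show ?thesis using \<delta>(2)[of x y] that by (simp add: dist_real_def)
  next
    case False
    then show ?thesis using R(2) assms(2) by simp
  qed
  then show thesis using that[of "min \<delta> 1"] \<delta>(1) by simp
qed

lemma Cc_borel: "f \<in> Cc \<Longrightarrow> f \<in> borel_measurable borel"
  by (auto simp: Cc_def intro: borel_measurable_continuous_onI)

lemma integrable_indicator_cball:
  "integrable lborel (\<lambda>x::'a::euclidean_space. c * indicator (cball 0 R) x :: real)"
  by (intro integrable_mult_right integrable_real_indicator emeasure_bounded_finite) auto

lemma Lspace_bounded_support:
  fixes f :: "real^'d::finite \<Rightarrow> real"
  assumes "q > 0" "f \<in> borel_measurable borel" "\<And>x. \<bar>f x\<bar> \<le> M * indicator (cball 0 R) x"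
  shows "f \<in> Lspace q"
proof -
  have "integrable lborel (\<lambda>x. \<bar>f x\<bar> powr q)"
  proof (rule Bochner_Integration.integrable_bound)
    show "integrable lborel (\<lambda>x::real^'d. M powr q * indicator (cball 0 R) x :: real)"
      by (rule integrable_indicator_cball)
    have "\<bar>f x\<bar> powr q \<le> M powr q * indicator (cball 0 R) x" for x
      using powr_mono2[of q "\<bar>f x\<bar>" M] assms(1) assms(3)[of x] by (cases "x \<in> cball 0 R") auto
    then show "AE x in lborel. norm (\<bar>f x\<bar> powr q) \<le> norm (M powr q * indicator (cball 0 R) x)"
      by (intro AE_I2) (simp add: abs_mult)
  qed (use assms(2) in auto)
  then show ?thesis using assms(2) by (simp add: Lspace_def)
qed

lemma Cc_Lspace: "q > 0 \<Longrightarrow> f \<in> Cc \<Longrightarrow> f \<in> Lspace q"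
  by (metis Cc_bound Cc_borel Lspace_bounded_support)

lemma tendsto_integral_abs_powr:
  fixes s :: "nat \<Rightarrow> 'a \<Rightarrow> real"
  assumes "q > 0" and [measurable]: "f \<in> borel_measurable M" "\<And>n. s n \<in> borel_measurable M"
    and w: "integrable M (\<lambda>x. \<bar>w x\<bar> powr q)"
    and lim: "AE x in M. (\<lambda>n. s n x) \<longlonglongrightarrow> f x"
    and bound: "\<And>n x. \<bar>s n x\<bar> \<le> \<bar>w x\<bar>"
  shows "(\<lambda>n. LINT x|M. \<bar>s n x\<bar> powr q) \<longlonglongrightarrow> (LINT x|M. \<bar>f x\<bar> powr q)"
proof (rule integral_dominated_convergence[OF _ _ w])
  show "AE x in M. (\<lambda>n. \<bar>s n x\<bar> powr q) \<longlonglongrightarrow> \<bar>f x\<bar> powr q"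
    using lim by eventually_elim (use assms(1) in \<open>auto intro!: tendsto_powr' tendsto_intros\<close>)
  show "AE x in M. norm (\<bar>s n x\<bar> powr q) \<le> \<bar>w x\<bar> powr q" for n
    using bound assms(1) by (intro AE_I2) (auto intro!: powr_mono2)
qed auto

text \<open>Closeness of the \<open>q\<close>-th moments is recorded separately, so that convergence of the norms is available
  without the triangle inequality in \<open>L\<^sup>q\<close>.\<close>

definition Lq_close :: "real \<Rightarrow> real \<Rightarrow> (real^'d::finite \<Rightarrow> real) \<Rightarrow> (real^'d \<Rightarrow> real) \<Rightarrow> bool" where
  "Lq_close q e f g \<longleftrightarrow> (LINT x|lborel. \<bar>f x - g x\<bar> powr q) < e \<and>
     \<bar>(LINT x|lborel. \<bar>f x\<bar> powr q) - (LINT x|lborel. \<bar>g x\<bar> powr q)\<bar> < e"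

lemma Lq_close_of_dominated_limit:
  fixes s :: "nat \<Rightarrow> real^'d::finite \<Rightarrow> real"
  assumes "q > 0" "e > 0" and [measurable]: "f \<in> borel_measurable borel" "\<And>n. s n \<in> borel_measurable borel"
    and w: "w \<in> Lspace q"
    and lim: "AE x in lborel. (\<lambda>n. s n x) \<longlonglongrightarrow> f x"
    and bound: "\<And>n x. \<bar>s n x\<bar> \<le> \<bar>w x\<bar>" "\<And>x. \<bar>f x\<bar> \<le> \<bar>w x\<bar>"
  shows "\<exists>n. Lq_close q e f (s n)"
proof -
  have "(\<lambda>n. LINT x|lborel. \<bar>f x - s n x\<bar> powr q) \<longlonglongrightarrow> (LINT x|(lborel::(real^'d) measure). \<bar>0::real\<bar> powr q)"
  proof (rule tendsto_integral_abs_powr[where w = "\<lambda>x. \<bar>w x\<bar> + \<bar>w x\<bar>"])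
    show "integrable lborel (\<lambda>x. \<bar>\<bar>w x\<bar> + \<bar>w x\<bar>\<bar> powr q)"
      using Lspace_add_abs[OF _ w w] assms(1) by (simp add: Lspace_def)
    show "AE x in lborel. (\<lambda>n. f x - s n x) \<longlonglongrightarrow> 0"
      using lim by eventually_elim (auto intro!: tendsto_eq_intros)
    show "\<bar>f x - s n x\<bar> \<le> \<bar>\<bar>w x\<bar> + \<bar>w x\<bar>\<bar>" for n x using bound(1)[of n x] bound(2)[of x] by linarith
  qed (use assms(1) in auto)
  moreover have "(\<lambda>n. LINT x|lborel. \<bar>s n x\<bar> powr q) \<longlonglongrightarrow> (LINT x|lborel. \<bar>f x\<bar> powr q)"
    using w by (intro tendsto_integral_abs_powr[where w = w] assms) (auto simp: Lspace_def)
  ultimately have "\<forall>\<^sub>F n in sequentially. (LINT x|lborel. \<bar>f x - s n x\<bar> powr q) < e"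
    "\<forall>\<^sub>F n in sequentially. dist (LINT x|lborel. \<bar>s n x\<bar> powr q) (LINT x|lborel. \<bar>f x\<bar> powr q) < e"
    using assms(2) by (auto intro: order_tendstoD(2) tendstoD)
  then have "\<forall>\<^sub>F n in sequentially. Lq_close q e f (s n)"
    by eventually_elim (auto simp: Lq_close_def dist_real_def abs_minus_commute)
  then show ?thesis by (auto simp: eventually_sequentially)
qed

lemma Lq_close_trans:
  fixes f g h :: "real^'d::finite \<Rightarrow> real"
  assumes q: "q > 0" and "f \<in> Lspace q" "g \<in> Lspace q" "h \<in> Lspace q"
    and "Lq_close q e f g" "Lq_close q e g h"
  shows "Lq_close q (2 * (2 powr q * e) + 2 * e) f h"
proof -
  have fg: "(\<lambda>x. f x - g x) \<in> Lspace q" and gh: "(\<lambda>x. g x - h x) \<in> Lspace q"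
    and fh: "(\<lambda>x. f x - h x) \<in> Lspace q"
    using assms by (auto intro!: Lspace_diff)
  have e: "e > 0"
    using assms(5) order.strict_trans1[OF Bochner_Integration.integral_nonneg]
    unfolding Lq_close_def by fastforce
  have "(LINT x|lborel. \<bar>f x - h x\<bar> powr q) \<le>
      (LINT x|lborel. 2 powr q * (\<bar>f x - g x\<bar> powr q + \<bar>g x - h x\<bar> powr q))"
  proof (rule integral_mono)
    fix x
    have "\<bar>f x - h x\<bar> powr q \<le> (\<bar>f x - g x\<bar> + \<bar>g x - h x\<bar>) powr q" using q by (intro powr_mono2) auto
    also have "\<dots> \<le> 2 powr q * (\<bar>f x - g x\<bar> powr q + \<bar>g x - h x\<bar> powr q)" using q by (intro abs_add_powr_le) auto
    finally show "\<bar>f x - h x\<bar> powr q \<le> \<dots>" .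
  qed (use fg gh fh in \<open>auto simp: Lspace_def\<close>)
  also have "\<dots> = 2 powr q * ((LINT x|lborel. \<bar>f x - g x\<bar> powr q) + (LINT x|lborel. \<bar>g x - h x\<bar> powr q))"
    using fg gh by (simp add: Lspace_def)
  also have "\<dots> \<le> 2 powr q * (e + e)"
    using assms(5,6) by (intro mult_left_mono) (auto simp: Lq_close_def)
  finally have "(LINT x|lborel. \<bar>f x - h x\<bar> powr q) \<le> 2 * (2 powr q * e)" by (simp add: algebra_simps)
  moreover have "2 powr q * e \<ge> 0" using e by simp
  moreover have "\<bar>(LINT x|lborel. \<bar>f x\<bar> powr q) - (LINT x|lborel. \<bar>h x\<bar> powr q)\<bar> < 2 * e"
    using assms(5,6) unfolding Lq_close_def by linarith
  ultimately show ?thesis using e unfolding Lq_close_def by linarith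
qed

text \<open>A measurable function is an almost everywhere limit of continuous functions. Clamping them to the range
  of \<open>g\<close> and multiplying by a continuous cutoff makes them dominated and compactly supported.\<close>

lemma Cc_dense_in_bounded_support:
  fixes g :: "real^'d::finite \<Rightarrow> real"
  assumes q: "q > 0" "e > 0" and g: "g \<in> borel_measurable borel"
    and bound: "\<And>x. \<bar>g x\<bar> \<le> real n * indicator (cball 0 (real n)) x"
  shows "\<exists>\<phi>\<in>Cc. Lq_close q e g \<phi>"
proof -
  have "g \<in> borel_measurable lebesgue" using g by (simp add: measurable_completion)
  from lebesgue_measurable_imp_measurable_on[OF this, of UNIV] obtain Z c where c: "negligible Z" "\<And>j. continuous_on UNIV (c j)"
    "\<And>x. x \<notin> Z \<Longrightarrow> (\<lambda>j. c j x) \<longlonglongrightarrow> g x"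
    unfolding measurable_on_def by auto
  \<comment> \<open>\<open>cut\<close> is \<open>1\<close> on the ball that carries \<open>g\<close> and \<open>0\<close> outside the ball of radius \<open>n + 1\<close>.\<close>
  define cut where "cut x = max 0 (min 1 (real n + 1 - norm x))" for x :: "real^'d"
  define s where "s j x = cut x * max (- real n) (min (real n) (c j x))" for j x
  have s_cont: "continuous_on UNIV (s j)" for j
    unfolding s_def cut_def by (intro continuous_intros c(2))
  have s_bound: "\<bar>s j x\<bar> \<le> \<bar>real n * indicator (cball 0 (real n + 1)) x\<bar>" for j x
  proof (cases "norm x \<le> real n + 1")
    case True
    have "\<bar>cut x\<bar> * \<bar>max (- real n) (min (real n) (c j x))\<bar> \<le> 1 * real n"
      by (intro mult_mono) (auto simp: cut_def)
    then show ?thesis using True by (simp add: s_def abs_mult)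
  qed (auto simp: s_def cut_def)
  have s_Cc: "s j \<in> Cc" for j
    using s_cont by (auto simp: Cc_def s_def cut_def intro!: exI[of _ "real n + 1"])
  have "\<exists>j. Lq_close q e g (s j)"
  proof (rule Lq_close_of_dominated_limit[OF q g])
    show "(\<lambda>x. real n * indicator (cball 0 (real n + 1)) x) \<in> Lspace q"
      using q by (intro Lspace_bounded_support[where M = "real n" and R = "real n + 1"]
          borel_measurable_times borel_measurable_indicator) auto
    show "\<bar>g x\<bar> \<le> \<bar>real n * indicator (cball 0 (real n + 1)) x\<bar>" for x
      using bound[of x] by (cases "norm x \<le> real n") (auto simp: indicator_def)
    have "AE x in lebesgue. x \<notin> Z"
      using c(1) by (intro AE_not_in) (simp add: negligible_iff_null_sets)
    then have "AE x in lborel. x \<notin> Z" by (simp add: AE_completion_iff)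
    then show "AE x in lborel. (\<lambda>j. s j x) \<longlonglongrightarrow> g x"
    proof eventually_elim
      fix x assume "x \<notin> Z"
      have "(\<lambda>j. s j x) \<longlonglongrightarrow> cut x * max (- real n) (min (real n) (g x))"
        unfolding s_def by (intro tendsto_intros tendsto_max tendsto_min c(3) \<open>x \<notin> Z\<close>)
      also have "cut x * max (- real n) (min (real n) (g x)) = g x"
        using bound[of x] by (cases "norm x \<le> real n") (auto simp: cut_def)
      finally show "(\<lambda>j. s j x) \<longlonglongrightarrow> g x" .
    qed
  qed (use s_bound Cc_borel[OF s_Cc] in auto)
  then show ?thesis using s_Cc by blast
qed

lemma Cc_dense_in_Lspace:
  fixes f :: "real^'d::finite \<Rightarrow> real"
  assumes q: "q > 0" "e > 0" and f: "f \<in> Lspace q"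
  shows "\<exists>\<phi>\<in>Cc. Lq_close q e f \<phi>"
proof -
  \<comment> \<open>Chosen so that two approximations with error \<open>e'\<close> compose to one with error \<open>e\<close>.\<close>
  define e' where "e' = e / (2 * 2 powr q + 2)"
  have e': "e' > 0" "2 * (2 powr q * e') + 2 * e' = e"
  proof -
    have pos: "2 * 2 powr q + 2 > 0" by (intro add_pos_pos) auto
    then show "e' > 0" using q by (simp add: e'_def)
    have "2 * (2 powr q * e') + 2 * e' = (2 * 2 powr q + 2) * e'" by (simp add: algebra_simps)
    also have "\<dots> = e" using pos by (simp add: e'_def)
    finally show "2 * (2 powr q * e') + 2 * e' = e" .
  qed
  have fm [measurable]: "f \<in> borel_measurable borel" using f by (simp add: Lspace_def)
  define s where "s n x = (if \<bar>f x\<bar> \<le> real n \<and> norm x \<le> real n then f x else 0)" for n :: nat and x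
  have sm: "s n \<in> borel_measurable borel" for n unfolding s_def by measurable
  have "\<exists>n. Lq_close q e' f (s n)"
  proof (rule Lq_close_of_dominated_limit[OF q(1) e'(1) fm sm f])
    have "(\<lambda>n. s n x) \<longlonglongrightarrow> f x" for x
    proof (rule tendsto_eventually)
      obtain m :: nat where "max \<bar>f x\<bar> (norm x) \<le> real m" using real_arch_simple by blast
      then show "\<forall>\<^sub>F n in sequentially. s n x = f x"
        by (auto simp: s_def eventually_sequentially intro!: exI[of _ m])
    qed
    then show "AE x in lborel. (\<lambda>n. s n x) \<longlonglongrightarrow> f x" by simp
  qed (auto simp: s_def)
  then obtain n where n: "Lq_close q e' f (s n)" by blast
  have bound: "\<bar>s n x\<bar> \<le> real n * indicator (cball 0 (real n)) x" for x by (auto simp: s_def)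
  obtain \<phi> where \<phi>: "\<phi> \<in> Cc" "Lq_close q e' (s n) \<phi>"
    using Cc_dense_in_bounded_support[OF q(1) e'(1) sm bound] by blast
  have "s n \<in> Lspace q" by (rule Lspace_bounded_support[OF q(1) sm bound])
  from Lq_close_trans[OF q(1) f this Cc_Lspace[OF q(1) \<phi>(1)] n \<phi>(2)] \<phi>(1)
  show ?thesis by (auto simp: e'(2))
qed

lemma Lspace_approximation:
  fixes f :: "real^'d::finite \<Rightarrow> real"
  assumes q: "q > 0" and f: "f \<in> Lspace q"
  obtains \<phi> where "\<And>n. \<phi> n \<in> Cc"
    "(\<lambda>n. LINT x|lborel. \<bar>f x - \<phi> n x\<bar> powr q) \<longlonglongrightarrow> 0"
    "(\<lambda>n. LINT x|lborel. \<bar>\<phi> n x\<bar> powr q) \<longlonglongrightarrow> (LINT x|lborel. \<bar>f x\<bar> powr q)"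
proof -
  have "\<exists>\<phi>\<in>Cc. Lq_close q (inverse (real (Suc n))) f \<phi>" for n
    by (rule Cc_dense_in_Lspace[OF q _ f]) simp
  then obtain \<phi> where \<phi>: "\<And>n. \<phi> n \<in> Cc" "\<And>n. Lq_close q (inverse (real (Suc n))) f (\<phi> n)" by metis
  show thesis
  proof (rule that[OF \<phi>(1)])
    show "(\<lambda>n. LINT x|lborel. \<bar>f x - \<phi> n x\<bar> powr q) \<longlonglongrightarrow> 0"
      using \<phi>(2) unfolding Lq_close_def
      by (intro real_tendsto_sandwich[OF _ _ tendsto_const LIMSEQ_inverse_real_of_nat])
        (auto intro!: always_eventually Bochner_Integration.integral_nonneg less_imp_le)
    show "(\<lambda>n. LINT x|lborel. \<bar>\<phi> n x\<bar> powr q) \<longlonglongrightarrow> (LINT x|lborel. \<bar>f x\<bar> powr q)"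
      using \<phi>(2) unfolding Lq_close_def
      by (intro metric_tendsto_imp_tendsto[OF LIMSEQ_inverse_real_of_nat])
        (auto intro!: always_eventually less_imp_le simp: dist_real_def abs_minus_commute)
  qed
qed

text \<open>Each term of the telescoping bound has one factor that tends to \<open>0\<close> and other factors that stay bounded.\<close>

lemma cubic_approximation:
  fixes f :: "(nat \<Rightarrow> nat) \<Rightarrow> real^'d::finite \<Rightarrow> real"
  assumes k: "k \<ge> 1" and f: "\<And>\<alpha>. \<alpha> \<in> cube_nz k \<Longrightarrow> f \<alpha> \<in> Lspace (q_exp k)"
  obtains \<phi> where "\<And>n \<alpha>. \<alpha> \<in> cube_nz k \<Longrightarrow> \<phi> n \<alpha> \<in> Cc"
    "(\<lambda>n. telescoping_bound k f (\<phi> n)) \<longlonglongrightarrow> 0"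
    "(\<lambda>n. \<Prod>\<alpha>\<in>cube_nz k. Lnorm (q_exp k) (\<phi> n \<alpha>)) \<longlonglongrightarrow> (\<Prod>\<alpha>\<in>cube_nz k. Lnorm (q_exp k) (f \<alpha>))"
proof -
  let ?q = "q_exp k"
  have q: "?q > 0" by (rule q_exp_pos[OF k])
  define P where "P \<alpha> \<phi> \<longleftrightarrow> (\<forall>n. \<phi> n \<in> Cc) \<and>
      (\<lambda>n. LINT x|lborel. \<bar>f \<alpha> x - \<phi> n x\<bar> powr ?q) \<longlonglongrightarrow> 0 \<and>
      (\<lambda>n. LINT x|lborel. \<bar>\<phi> n x\<bar> powr ?q) \<longlonglongrightarrow> (LINT x|lborel. \<bar>f \<alpha> x\<bar> powr ?q)" for \<alpha> \<phi>
  have "\<exists>\<phi>. P \<alpha> \<phi>" if "\<alpha> \<in> cube_nz k" for \<alpha>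
    by (rule Lspace_approximation[OF q f[OF that]]) (auto simp: P_def)
  then obtain \<phi> where "\<And>\<alpha>. \<alpha> \<in> cube_nz k \<Longrightarrow> P \<alpha> (\<phi> \<alpha>)" by metis
  then have \<phi>: "\<And>\<alpha> n. \<alpha> \<in> cube_nz k \<Longrightarrow> \<phi> \<alpha> n \<in> Cc"
    "\<And>\<alpha>. \<alpha> \<in> cube_nz k \<Longrightarrow> (\<lambda>n. LINT x|lborel. \<bar>f \<alpha> x - \<phi> \<alpha> n x\<bar> powr ?q) \<longlonglongrightarrow> 0"
    "\<And>\<alpha>. \<alpha> \<in> cube_nz k \<Longrightarrow>
      (\<lambda>n. LINT x|lborel. \<bar>\<phi> \<alpha> n x\<bar> powr ?q) \<longlonglongrightarrow> (LINT x|lborel. \<bar>f \<alpha> x\<bar> powr ?q)"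
    unfolding P_def by blast+
  have int_nonneg: "(LINT x|lborel. \<bar>g x\<bar> powr ?q) \<ge> 0" for g :: "real^'d \<Rightarrow> real"
    by (intro Bochner_Integration.integral_nonneg) auto
  have root: "(\<lambda>n. a n powr (1 / ?q)) \<longlonglongrightarrow> l powr (1 / ?q)"
    if "a \<longlonglongrightarrow> l" "\<And>n. a n \<ge> 0" for a :: "nat \<Rightarrow> real" and l
    using that q by (intro tendsto_powr') auto
  define D where "D \<alpha> \<beta> n = (if \<beta> = \<alpha> then (LINT x|lborel. \<bar>f \<beta> x - \<phi> \<beta> n x\<bar> powr ?q) else
      2 powr ?q * ((LINT x|lborel. \<bar>f \<beta> x\<bar> powr ?q) + (LINT x|lborel. \<bar>\<phi> \<beta> n x\<bar> powr ?q)))" for \<alpha> \<beta> n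
  have D_nonneg: "D \<alpha> \<beta> n \<ge> 0" for \<alpha> \<beta> n by (auto simp: D_def intro!: mult_nonneg_nonneg add_nonneg_nonneg int_nonneg)
  have le_D: "Lnorm ?q (\<lambda>x. if \<beta> = \<alpha> then \<bar>f \<beta> x - \<phi> \<beta> n x\<bar> else \<bar>f \<beta> x\<bar> + \<bar>\<phi> \<beta> n x\<bar>) \<le> D \<alpha> \<beta> n powr (1 / ?q)"
    if \<beta>: "\<beta> \<in> cube_nz k" for \<alpha> \<beta> n
  proof (cases "\<beta> = \<alpha>")
    case False
    have \<phi>L: "\<phi> \<beta> n \<in> Lspace ?q" using Cc_Lspace[OF q \<phi>(1)[OF \<beta>]] .
    have "(LINT x|lborel. \<bar>\<bar>f \<beta> x\<bar> + \<bar>\<phi> \<beta> n x\<bar>\<bar> powr ?q) \<le>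
        (LINT x|lborel. 2 powr ?q * (\<bar>f \<beta> x\<bar> powr ?q + \<bar>\<phi> \<beta> n x\<bar> powr ?q))"
      using abs_add_powr_le[of ?q] q Lspace_add_abs[OF _ f[OF \<beta>] \<phi>L] f[OF \<beta>] \<phi>L
      by (intro integral_mono) (auto simp: Lspace_def)
    also have "\<dots> = D \<alpha> \<beta> n" using False f[OF \<beta>] \<phi>L by (simp add: D_def Lspace_def)
    finally show ?thesis using False q by (auto simp: Lnorm_def intro!: powr_mono2 int_nonneg)
  qed (simp add: D_def Lnorm_def)
  have D_lim: "(\<lambda>n. \<Prod>\<beta>\<in>cube_nz k. D \<alpha> \<beta> n powr (1 / ?q)) \<longlonglongrightarrow> 0" if \<alpha>: "\<alpha> \<in> cube_nz k" for \<alpha>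
  proof -
    define l where "l \<beta> = (if \<beta> = \<alpha> then 0 else 2 powr ?q * ((LINT x|lborel. \<bar>f \<beta> x\<bar> powr ?q) + (LINT x|lborel. \<bar>f \<beta> x\<bar> powr ?q)))" for \<beta>
    have "(\<lambda>n. D \<alpha> \<beta> n) \<longlonglongrightarrow> l \<beta>" if "\<beta> \<in> cube_nz k" for \<beta>
    proof (cases "\<beta> = \<alpha>")
      case False
      then show ?thesis
        unfolding D_def l_def if_not_P[OF False] by (intro tendsto_intros \<phi>(3) that)
    qed (use \<phi>(2)[OF that] in \<open>simp add: D_def l_def\<close>)
    then have "(\<lambda>n. \<Prod>\<beta>\<in>cube_nz k. D \<alpha> \<beta> n powr (1 / ?q)) \<longlonglongrightarrow> (\<Prod>\<beta>\<in>cube_nz k. l \<beta> powr (1 / ?q))"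
      by (intro tendsto_prod root D_nonneg)
    also have "(\<Prod>\<beta>\<in>cube_nz k. l \<beta> powr (1 / ?q)) = 0"
      using \<alpha> finite_cube_nz by (auto intro!: bexI[of _ \<alpha>] simp: l_def)
    finally show ?thesis .
  qed
  show thesis
  proof (rule that[of "\<lambda>n \<alpha>. \<phi> \<alpha> n"])
    show "(\<lambda>n. telescoping_bound k f (\<lambda>\<alpha>. \<phi> \<alpha> n)) \<longlonglongrightarrow> 0"
    proof (rule tendsto_sandwich[OF _ _ tendsto_const])
      show "(\<lambda>n. \<Sum>\<alpha>\<in>cube_nz k. \<Prod>\<beta>\<in>cube_nz k. D \<alpha> \<beta> n powr (1 / ?q)) \<longlonglongrightarrow> 0"
        using D_lim by (rule tendsto_null_sum)
      show "\<forall>\<^sub>F n in sequentially. 0 \<le> telescoping_bound k f (\<lambda>\<alpha>. \<phi> \<alpha> n)"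
        unfolding telescoping_bound_def Lnorm_def
        by (intro always_eventually allI sum_nonneg prod_nonneg) auto
      show "\<forall>\<^sub>F n in sequentially. telescoping_bound k f (\<lambda>\<alpha>. \<phi> \<alpha> n) \<le>
          (\<Sum>\<alpha>\<in>cube_nz k. \<Prod>\<beta>\<in>cube_nz k. D \<alpha> \<beta> n powr (1 / ?q))"
        unfolding telescoping_bound_def
        by (intro always_eventually allI sum_mono prod_mono conjI le_D) (auto simp: Lnorm_def)
    qed
    show "(\<lambda>n. \<Prod>\<alpha>\<in>cube_nz k. Lnorm ?q (\<phi> \<alpha> n)) \<longlonglongrightarrow> (\<Prod>\<alpha>\<in>cube_nz k. Lnorm ?q (f \<alpha>))"
      unfolding Lnorm_def by (intro tendsto_prod root \<phi>(3) int_nonneg)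
  qed (use \<phi>(1) in auto)
qed

section \<open>Continuity of cubic convolution products\<close>

lemma Lnorm_le_bounded_support:
  fixes f :: "real^'d::finite \<Rightarrow> real"
  assumes q: "q > 0" and M: "M \<ge> 0" and f: "f \<in> borel_measurable borel"
    and bound: "\<And>x. \<bar>f x\<bar> \<le> M * indicator (cball 0 R) x"
  shows "Lnorm q f \<le> M * measure lborel (cball (0::real^'d) R) powr (1 / q)"
proof -
  have "(LINT x|lborel. \<bar>f x\<bar> powr q) \<le> (LINT x|lborel. M powr q * indicator (cball (0::real^'d) R) x)"
  proof (rule integral_mono)
    show "integrable lborel (\<lambda>x. \<bar>f x\<bar> powr q)"
      using Lspace_bounded_support[OF q f bound] by (simp add: Lspace_def)
    show "\<bar>f x\<bar> powr q \<le> M powr q * indicator (cball 0 R) x" for x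
      using powr_mono2[of q "\<bar>f x\<bar>" M] q bound[of x] by (cases "x \<in> cball 0 R") auto
  qed (rule integrable_indicator_cball)
  then have "Lnorm q f \<le> (M powr q * measure lborel (cball (0::real^'d) R)) powr (1 / q)"
    using q unfolding Lnorm_def by (intro powr_mono2) (auto intro!: Bochner_Integration.integral_nonneg)
  also have "\<dots> = M * measure lborel (cball (0::real^'d) R) powr (1 / q)"
    using q M by (simp add: powr_mult powr_powr)
  finally show ?thesis .
qed

text \<open>For families with a common bound and a common bounded support, uniform closeness controls the telescoping
  bound. This yields both the continuity of \<open>D f\<close> in \<open>x\<close> and the uniform continuity in the parameter \<open>u\<close> of
  the averages below.\<close>

lemma telescoping_bound_uniform:
  fixes M R :: real
  assumes k: "k \<ge> 1" and M: "M \<ge> 0"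
  obtains K where "K \<ge> 0"
    "\<And>(f :: (nat \<Rightarrow> nat) \<Rightarrow> real^'d::finite \<Rightarrow> real) g \<delta>. \<lbrakk>\<delta> \<ge> 0;
       \<And>\<alpha>. \<alpha> \<in> cube_nz k \<Longrightarrow> f \<alpha> \<in> borel_measurable borel;
       \<And>\<alpha>. \<alpha> \<in> cube_nz k \<Longrightarrow> g \<alpha> \<in> borel_measurable borel;
       \<And>\<alpha> x. \<alpha> \<in> cube_nz k \<Longrightarrow> \<bar>f \<alpha> x\<bar> \<le> M * indicator (cball 0 R) x;
       \<And>\<alpha> x. \<alpha> \<in> cube_nz k \<Longrightarrow> \<bar>g \<alpha> x\<bar> \<le> M * indicator (cball 0 R) x;
       \<And>\<alpha> x. \<alpha> \<in> cube_nz k \<Longrightarrow> \<bar>f \<alpha> x - g \<alpha> x\<bar> \<le> \<delta>\<rbrakk>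
       \<Longrightarrow> telescoping_bound k f g \<le> K * \<delta>"
proof -
  \<comment> \<open>The \<open>L\<^sup>q\<close> norm of the indicator function of the ball.\<close>
  define V where "V = measure lborel (cball (0::real^'d) R) powr (1 / q_exp k)"
  define n where "n = card (cube_nz k)"
  define K where "K = real n * (V * (2 * M * V) ^ (n - 1))"
  have q: "q_exp k > 0" by (rule q_exp_pos[OF k])
  have V: "V \<ge> 0" by (simp add: V_def)
  show thesis
  proof (rule that)
    show "K \<ge> 0" using M V by (simp add: K_def)
    fix f g :: "(nat \<Rightarrow> nat) \<Rightarrow> real^'d \<Rightarrow> real" and \<delta> :: real
    assume \<delta>: "\<delta> \<ge> 0"
      and meas: "\<And>\<alpha>. \<alpha> \<in> cube_nz k \<Longrightarrow> f \<alpha> \<in> borel_measurable borel"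
        "\<And>\<alpha>. \<alpha> \<in> cube_nz k \<Longrightarrow> g \<alpha> \<in> borel_measurable borel"
      and f: "\<And>\<alpha> x. \<alpha> \<in> cube_nz k \<Longrightarrow> \<bar>f \<alpha> x\<bar> \<le> M * indicator (cball 0 R) x"
      and g: "\<And>\<alpha> x. \<alpha> \<in> cube_nz k \<Longrightarrow> \<bar>g \<alpha> x\<bar> \<le> M * indicator (cball 0 R) x"
      and fg: "\<And>\<alpha> x. \<alpha> \<in> cube_nz k \<Longrightarrow> \<bar>f \<alpha> x - g \<alpha> x\<bar> \<le> \<delta>"
    have "telescoping_bound k f g \<le>
        (\<Sum>\<alpha>\<in>cube_nz k. \<Prod>\<beta>\<in>cube_nz k. if \<beta> = \<alpha> then \<delta> * V else 2 * M * V)"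
      unfolding telescoping_bound_def
    proof (intro sum_mono prod_mono conjI)
      fix \<alpha> \<beta> assume \<beta>: "\<beta> \<in> cube_nz k"
      show "Lnorm (q_exp k) (\<lambda>x. if \<beta> = \<alpha> then \<bar>f \<beta> x - g \<beta> x\<bar> else \<bar>f \<beta> x\<bar> + \<bar>g \<beta> x\<bar>)
          \<le> (if \<beta> = \<alpha> then \<delta> * V else 2 * M * V)"
      proof (cases "\<beta> = \<alpha>")
        case True
        have "\<bar>\<bar>f \<beta> x - g \<beta> x\<bar>\<bar> \<le> \<delta> * indicator (cball 0 R) x" for x
          using f[OF \<beta>, of x] g[OF \<beta>, of x] fg[OF \<beta>, of x] by (cases "x \<in> cball 0 R") auto
        then have "Lnorm (q_exp k) (\<lambda>x. \<bar>f \<beta> x - g \<beta> x\<bar>) \<le> \<delta> * V"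
          unfolding V_def using meas[OF \<beta>] q \<delta> by (intro Lnorm_le_bounded_support) auto
        then show ?thesis using True by simp
      next
        case False
        have "\<bar>\<bar>f \<beta> x\<bar> + \<bar>g \<beta> x\<bar>\<bar> \<le> 2 * M * indicator (cball 0 R) x" for x
          using f[OF \<beta>, of x] g[OF \<beta>, of x] by (cases "x \<in> cball 0 R") auto
        then have "Lnorm (q_exp k) (\<lambda>x. \<bar>f \<beta> x\<bar> + \<bar>g \<beta> x\<bar>) \<le> 2 * M * V"
          unfolding V_def using meas[OF \<beta>] q M by (intro Lnorm_le_bounded_support) auto
        then show ?thesis using False by simp
      qed
    qed (simp add: Lnorm_def)
    also have "\<dots> = (\<Sum>\<alpha>\<in>cube_nz k. \<delta> * V * (2 * M * V) ^ (n - 1))"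
    proof (rule sum.cong)
      fix \<alpha> assume \<alpha>: "\<alpha> \<in> cube_nz k"
      have "(\<Prod>\<beta>\<in>cube_nz k - {\<alpha>}. if \<beta> = \<alpha> then \<delta> * V else 2 * M * V) = (\<Prod>\<beta>\<in>cube_nz k - {\<alpha>}. 2 * M * V)"
        by (intro prod.cong) auto
      then show "(\<Prod>\<beta>\<in>cube_nz k. if \<beta> = \<alpha> then \<delta> * V else 2 * M * V) = \<delta> * V * (2 * M * V) ^ (n - 1)"
        using \<alpha> finite_cube_nz by (simp add: prod.remove[of _ \<alpha>] n_def)
    qed simp
    also have "\<dots> = K * \<delta>" by (simp add: K_def n_def)
    finally show "telescoping_bound k f g \<le> K * \<delta>" .
  qed
qed

lemma cubic_conv_shift: "cubic_conv k f x = cubic_conv k (\<lambda>\<alpha> y. f \<alpha> (x + y)) 0"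
  by (simp add: cubic_conv_def)

lemma Cc_family_bound:
  fixes f :: "(nat \<Rightarrow> nat) \<Rightarrow> real^'d::finite \<Rightarrow> real"
  assumes "\<And>\<alpha>. \<alpha> \<in> cube_nz k \<Longrightarrow> f \<alpha> \<in> Cc"
  obtains M R where "M \<ge> 0" "R \<ge> 0" "\<And>\<alpha> x. \<alpha> \<in> cube_nz k \<Longrightarrow> \<bar>f \<alpha> x\<bar> \<le> M * indicator (cball 0 R) x"
proof -
  have "\<exists>M R. M \<ge> 0 \<and> R \<ge> 0 \<and> (\<forall>x. \<bar>f \<alpha> x\<bar> \<le> M * indicator (cball 0 R) x)" if "\<alpha> \<in> cube_nz k" for \<alpha>
    using Cc_bound[OF assms[OF that]] by metis
  then obtain M R where MR: "\<And>\<alpha>. \<alpha> \<in> cube_nz k \<Longrightarrow> M \<alpha> \<ge> 0" "\<And>\<alpha>. \<alpha> \<in> cube_nz k \<Longrightarrow> R \<alpha> \<ge> 0"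
    "\<And>\<alpha> x. \<alpha> \<in> cube_nz k \<Longrightarrow> \<bar>f \<alpha> x\<bar> \<le> M \<alpha> * indicator (cball 0 (R \<alpha>)) x"
    by metis
  show thesis
  proof (rule that)
    show "sum M (cube_nz k) \<ge> 0" "sum R (cube_nz k) \<ge> 0" using MR by (auto intro: sum_nonneg)
    fix \<alpha> x assume \<alpha>: "\<alpha> \<in> cube_nz k"
    have "M \<alpha> \<le> sum M (cube_nz k)" "R \<alpha> \<le> sum R (cube_nz k)"
      using MR \<alpha> finite_cube_nz by (auto intro: member_le_sum)
    moreover have "sum M (cube_nz k) \<ge> 0" using MR by (auto intro: sum_nonneg)
    ultimately show "\<bar>f \<alpha> x\<bar> \<le> sum M (cube_nz k) * indicator (cball 0 (sum R (cube_nz k))) x"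
      using MR(3)[OF \<alpha>, of x] by (cases "norm x \<le> R \<alpha>"; cases "norm x \<le> sum R (cube_nz k)") auto
  qed
qed

lemma Cc_family_uniformly_continuous:
  fixes f :: "(nat \<Rightarrow> nat) \<Rightarrow> real^'d::finite \<Rightarrow> real"
  assumes "\<And>\<alpha>. \<alpha> \<in> cube_nz k \<Longrightarrow> f \<alpha> \<in> Cc" "e > 0"
  obtains \<delta> where "\<delta> > 0" "\<And>\<alpha> (x :: real^'d) y. \<alpha> \<in> cube_nz k \<Longrightarrow> dist x y < \<delta> \<Longrightarrow> \<bar>f \<alpha> x - f \<alpha> y\<bar> < e"
proof -
  have "\<exists>\<delta>>0. \<forall>(x :: real^'d) y. dist x y < \<delta> \<longrightarrow> \<bar>f \<alpha> x - f \<alpha> y\<bar> < e" if "\<alpha> \<in> cube_nz k" for \<alpha>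
    using Cc_uniformly_continuous[OF assms(1)[OF that] assms(2)] by metis
  then obtain \<delta> where \<delta>: "\<And>\<alpha>. \<alpha> \<in> cube_nz k \<Longrightarrow> \<delta> \<alpha> > 0"
    "\<And>\<alpha> (x :: real^'d) y. \<alpha> \<in> cube_nz k \<Longrightarrow> dist x y < \<delta> \<alpha> \<Longrightarrow> \<bar>f \<alpha> x - f \<alpha> y\<bar> < e"
    by metis
  show thesis
  proof (rule that)
    show "Min (insert 1 (\<delta> ` cube_nz k)) > 0" using \<delta>(1) finite_cube_nz by auto
    fix \<alpha> and x y :: "real^'d" assume "\<alpha> \<in> cube_nz k" "dist x y < Min (insert 1 (\<delta> ` cube_nz k))"
    then show "\<bar>f \<alpha> x - f \<alpha> y\<bar> < e" using \<delta>(2) finite_cube_nz by auto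
  qed
qed

lemma cubic_conv_Cc_bcontfun:
  fixes f :: "(nat \<Rightarrow> nat) \<Rightarrow> real^'d::finite \<Rightarrow> real"
  assumes k: "k \<ge> 1" and f: "\<And>\<alpha>. \<alpha> \<in> cube_nz k \<Longrightarrow> f \<alpha> \<in> Cc"
  shows "cubic_conv k f \<in> bcontfun"
proof (rule bcontfun_normI)
  have q: "q_exp k > 0" by (rule q_exp_pos[OF k])
  show "norm (cubic_conv k f x) \<le> (\<Prod>\<alpha>\<in>cube_nz k. Lnorm (q_exp k) (f \<alpha>))" for x
    using cubic_conv_bound[OF k, of f x] Cc_Lspace[OF q f] by simp
  obtain M R where MR: "M \<ge> 0" "R \<ge> 0" "\<And>\<alpha> x. \<alpha> \<in> cube_nz k \<Longrightarrow> \<bar>f \<alpha> x\<bar> \<le> M * indicator (cball 0 R) x"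
    using Cc_family_bound[of k f] f by metis
  show "continuous_on UNIV (cubic_conv k f)"
    unfolding continuous_on_iff
  proof (intro ballI allI impI)
    fix x :: "real^'d" and e :: real assume e: "e > 0"
    obtain K where K: "K \<ge> 0" and tele: "\<And>(f :: (nat \<Rightarrow> nat) \<Rightarrow> real^'d \<Rightarrow> real) g \<delta>. \<lbrakk>\<delta> \<ge> 0;
       \<And>\<alpha>. \<alpha> \<in> cube_nz k \<Longrightarrow> f \<alpha> \<in> borel_measurable borel;
       \<And>\<alpha>. \<alpha> \<in> cube_nz k \<Longrightarrow> g \<alpha> \<in> borel_measurable borel;
       \<And>\<alpha> y. \<alpha> \<in> cube_nz k \<Longrightarrow> \<bar>f \<alpha> y\<bar> \<le> M * indicator (cball 0 (R + norm x + 1)) y;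
       \<And>\<alpha> y. \<alpha> \<in> cube_nz k \<Longrightarrow> \<bar>g \<alpha> y\<bar> \<le> M * indicator (cball 0 (R + norm x + 1)) y;
       \<And>\<alpha> y. \<alpha> \<in> cube_nz k \<Longrightarrow> \<bar>f \<alpha> y - g \<alpha> y\<bar> \<le> \<delta>\<rbrakk>
       \<Longrightarrow> telescoping_bound k f g \<le> K * \<delta>"
      using telescoping_bound_uniform[OF k MR(1), of "R + norm x + 1"] by metis
    define e' where "e' = e / (K + 1)"
    have e': "e' > 0" "K * e' < e" using e K by (auto simp: e'_def field_simps)
    obtain \<delta> where \<delta>: "\<delta> > 0" "\<And>\<alpha> (x :: real^'d) y. \<alpha> \<in> cube_nz k \<Longrightarrow> dist x y < \<delta> \<Longrightarrow> \<bar>f \<alpha> x - f \<alpha> y\<bar> < e'"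
      using Cc_family_uniformly_continuous[of k f e'] f e'(1) by metis
    have supp: "\<bar>f \<alpha> (z + y)\<bar> \<le> M * indicator (cball 0 (R + norm x + 1)) y"
      if "dist z x < 1" "\<alpha> \<in> cube_nz k" for z y \<alpha>
    proof -
      have "norm y \<le> norm (z + y) + norm x + dist z x" unfolding dist_norm by norm
      then show ?thesis using MR(3)[OF that(2), of "z + y"] that(1) MR(1)
        by (cases "norm (z + y) \<le> R") auto
    qed
    have "dist (cubic_conv k f x') (cubic_conv k f x) < e" if d: "dist x' x < min \<delta> 1" for x'
    proof -
      have "\<bar>cubic_conv k f x' - cubic_conv k f x\<bar> \<le>
          telescoping_bound k (\<lambda>\<alpha> y. f \<alpha> (x' + y)) (\<lambda>\<alpha> y. f \<alpha> (x + y))"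
        unfolding cubic_conv_shift[of k f x'] cubic_conv_shift[of k f x]
        by (intro cubic_conv_diff_le k Lspace_plus_arg Cc_Lspace q f)
      also have "\<dots> \<le> K * e'"
        using d e'(1) \<delta>(2)[of _ "x' + _" "x + _"]
        by (intro tele supp measurable_compose[OF _ Cc_borel[OF f]]) (auto intro: less_imp_le simp: dist_norm)
      finally show ?thesis using e'(2) by (simp add: dist_real_def)
    qed
    then show "\<exists>d>0. \<forall>x'\<in>UNIV. dist x' x < d \<longrightarrow> dist (cubic_conv k f x') (cubic_conv k f x) < e"
      using \<delta>(1) by (intro exI[of _ "min \<delta> 1"]) auto
  qed
qed

section \<open>The product as an average\<close>

text \<open>The families over which the product of two cubic convolution products is averaged.\<close>

definition shift_mult ::
    "nat \<Rightarrow> ((nat \<Rightarrow> nat) \<Rightarrow> real^'d::finite \<Rightarrow> real) \<Rightarrow> ((nat \<Rightarrow> nat) \<Rightarrow> real^'d \<Rightarrow> real) \<Rightarrow>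
      (nat \<Rightarrow> real^'d) \<Rightarrow> (nat \<Rightarrow> nat) \<Rightarrow> real^'d \<Rightarrow> real" where
  "shift_mult k f g u \<alpha> y = f \<alpha> y * g \<alpha> (y + cube_dot k \<alpha> u)"

lemma shift_mult_Cc:
  assumes "f \<alpha> \<in> Cc" "g \<alpha> \<in> Cc" shows "shift_mult k f g u \<alpha> \<in> Cc"
proof -
  have "continuous_on UNIV (\<lambda>y. g \<alpha> (y + cube_dot k \<alpha> u))"
    using assms(2) unfolding Cc_def
    by (auto intro!: continuous_on_compose2[of UNIV "g \<alpha>"] continuous_intros)
  then show ?thesis using assms by (auto simp: Cc_def shift_mult_def intro!: continuous_intros)
qed

lemma PiM_lborel_translate:
  fixes h :: "nat \<Rightarrow> 'a::euclidean_space"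
  shows "distr (PiM {1..k} (\<lambda>_. lborel)) (PiM {1..k} (\<lambda>_. lborel)) (\<lambda>u. \<lambda>i\<in>{1..k}. h i + u i)
    = PiM {1..k} (\<lambda>_. lborel)"
proof (rule lborel_prod.PiM_eqI)
  let ?T = "\<lambda>u. \<lambda>i\<in>{1..k}. h i + u i"
  have T: "?T \<in> PiM {1..k} (\<lambda>_. lborel) \<rightarrow>\<^sub>M PiM {1..k} (\<lambda>_. lborel)" by measurable
  fix A :: "nat \<Rightarrow> 'a set" assume "\<And>i. i \<in> {1..k} \<Longrightarrow> A i \<in> sets lborel"
  then have A: "A i \<in> sets borel" if "i \<in> {1..k}" for i using that by simp
  have shift: "(+) (h i) -` A i \<in> sets borel"
    "emeasure lborel ((+) (h i) -` A i) = emeasure lborel (A i)" if "i \<in> {1..k}" for i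
  proof -
    have "(+) (h i) -` A i \<inter> space borel \<in> sets borel"
      by (rule measurable_sets[OF _ A[OF that]]) simp
    then show "(+) (h i) -` A i \<in> sets borel" by simp
    have "emeasure lborel (A i) = emeasure (distr lborel borel ((+) (h i))) (A i)"
      by (simp add: lborel_distr_plus)
    also have "\<dots> = emeasure lborel ((+) (h i) -` A i)"
      using A[OF that] by (subst emeasure_distr) auto
    finally show "emeasure lborel ((+) (h i) -` A i) = emeasure lborel (A i)" ..
  qed
  have "emeasure (distr (PiM {1..k} (\<lambda>_. lborel)) (PiM {1..k} (\<lambda>_. lborel)) ?T) (Pi\<^sub>E {1..k} A) =
      emeasure (PiM {1..k} (\<lambda>_. lborel)) (?T -` Pi\<^sub>E {1..k} A \<inter> space (PiM {1..k} (\<lambda>_. lborel)))"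
    using A by (intro emeasure_distr T sets_PiM_I_finite) auto
  also have "?T -` Pi\<^sub>E {1..k} A \<inter> space (PiM {1..k} (\<lambda>_. lborel)) = Pi\<^sub>E {1..k} (\<lambda>i. (+) (h i) -` A i)"
    by (auto simp: space_PiM PiE_iff)
  also have "emeasure (PiM {1..k} (\<lambda>_. lborel)) \<dots> = (\<Prod>i\<in>{1..k}. emeasure lborel ((+) (h i) -` A i))"
    using shift by (intro lborel_prod.emeasure_PiM) auto
  also have "\<dots> = (\<Prod>i\<in>{1..k}. emeasure lborel (A i))" using shift by (intro prod.cong) auto
  finally show "emeasure (distr (PiM {1..k} (\<lambda>_. lborel)) (PiM {1..k} (\<lambda>_. lborel)) ?T) (Pi\<^sub>E {1..k} A)
    = (\<Prod>i\<in>{1..k}. emeasure lborel (A i))" .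
qed auto

lemma
  fixes \<phi> :: "(nat \<Rightarrow> 'a::euclidean_space) \<Rightarrow> real"
  assumes "\<phi> \<in> borel_measurable (PiM {1..k} (\<lambda>_. lborel))"
  shows integrable_PiM_translate: "integrable (PiM {1..k} (\<lambda>_. lborel)) (\<lambda>u. \<phi> (\<lambda>i\<in>{1..k}. h i + u i))
      \<longleftrightarrow> integrable (PiM {1..k} (\<lambda>_. lborel)) \<phi>"
    and integral_PiM_translate: "(LINT u|PiM {1..k} (\<lambda>_. lborel). \<phi> (\<lambda>i\<in>{1..k}. h i + u i))
      = (LINT u|PiM {1..k} (\<lambda>_. lborel). \<phi> u)"
proof -
  have T: "(\<lambda>u. \<lambda>i\<in>{1..k}. h i + u i) \<in> PiM {1..k} (\<lambda>_. lborel) \<rightarrow>\<^sub>M PiM {1..k} (\<lambda>_. lborel)" by measurable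
  show "integrable (PiM {1..k} (\<lambda>_. lborel)) (\<lambda>u. \<phi> (\<lambda>i\<in>{1..k}. h i + u i))
      \<longleftrightarrow> integrable (PiM {1..k} (\<lambda>_. lborel)) \<phi>"
    using integrable_distr_eq[OF T assms] by (simp only: PiM_lborel_translate)
  show "(LINT u|PiM {1..k} (\<lambda>_. lborel). \<phi> (\<lambda>i\<in>{1..k}. h i + u i))
      = (LINT u|PiM {1..k} (\<lambda>_. lborel). \<phi> u)"
    using integral_distr[OF T assms] by (simp only: PiM_lborel_translate)
qed

lemma cube_dot_add:
  "cube_dot k \<alpha> (\<lambda>i\<in>{1..k}. h i + u i) = cube_dot k \<alpha> h + cube_dot k \<alpha> u"
  by (simp add: cube_dot_def scaleR_add_right sum.distrib)

text \<open>Fubini after the substitution \<open>h \<mapsto> h + u\<close> in the integral that defines the second factor.\<close>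

lemma
  fixes f g :: "(nat \<Rightarrow> nat) \<Rightarrow> real^'d::finite \<Rightarrow> real"
  assumes k: "k \<ge> 1" and f: "\<And>\<alpha>. \<alpha> \<in> cube_nz k \<Longrightarrow> f \<alpha> \<in> Lspace (q_exp k)"
    and g: "\<And>\<alpha>. \<alpha> \<in> cube_nz k \<Longrightarrow> g \<alpha> \<in> Lspace (q_exp k)"
  shows integrable_cubic_conv_shift_mult:
      "integrable (PiM {1..k} (\<lambda>_. lborel)) (\<lambda>u. cubic_conv k (shift_mult k f g u) x)"
    and cubic_conv_mult_eq_integral:
      "cubic_conv k f x * cubic_conv k g x =
        (LINT u|PiM {1..k} (\<lambda>_. lborel). cubic_conv k (shift_mult k f g u) x)"
proof -
  let ?M = "PiM {1..k} (\<lambda>_. lborel) :: (nat \<Rightarrow> real^'d) measure"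
  interpret M: sigma_finite_measure ?M by (rule lborel_prod.sigma_finite) simp
  interpret pair_sigma_finite ?M ?M ..
  define P where "P h = (\<Prod>\<alpha>\<in>cube_nz k. f \<alpha> (x + cube_dot k \<alpha> h))" for h
  define Q where "Q h = (\<Prod>\<alpha>\<in>cube_nz k. g \<alpha> (x + cube_dot k \<alpha> h))" for h
  have P: "integrable ?M P" unfolding P_def by (rule integrable_cube_prod[OF k f])
  have Q: "integrable ?M Q" unfolding Q_def by (rule integrable_cube_prod[OF k g])
  have Q_shift: "integrable ?M (\<lambda>u. Q (\<lambda>i\<in>{1..k}. h i + u i))"
    "(LINT u|?M. Q (\<lambda>i\<in>{1..k}. h i + u i)) = (LINT u|?M. Q u)"
    "(LINT u|?M. \<bar>Q (\<lambda>i\<in>{1..k}. h i + u i)\<bar>) = (LINT u|?M. \<bar>Q u\<bar>)" for h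
    using Q integrable_PiM_translate[of Q k h] integral_PiM_translate[of Q k h]
      integral_PiM_translate[of "\<lambda>u. \<bar>Q u\<bar>" k h] by auto
  define H where "H h u = P h * Q (\<lambda>i\<in>{1..k}. h i + u i)" for h u
  have H_eq: "(\<Prod>\<alpha>\<in>cube_nz k. shift_mult k f g u \<alpha> (x + cube_dot k \<alpha> h)) = H h u" for h u
    by (simp add: H_def P_def Q_def shift_mult_def cube_dot_add prod.distrib add.assoc)
  have "(\<lambda>(h, u). \<lambda>i\<in>{1..k}. h i + u i) \<in> ?M \<Otimes>\<^sub>M ?M \<rightarrow>\<^sub>M ?M" by measurable
  from measurable_compose[OF this borel_measurable_integrable[OF Q]]
  have "(\<lambda>p. Q (\<lambda>i\<in>{1..k}. fst p i + snd p i)) \<in> borel_measurable (?M \<Otimes>\<^sub>M ?M)"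
    by (simp add: case_prod_beta)
  then have H_meas: "case_prod H \<in> borel_measurable (?M \<Otimes>\<^sub>M ?M)"
    using borel_measurable_integrable[OF P] unfolding H_def case_prod_beta by measurable
  have H_int: "integrable (?M \<Otimes>\<^sub>M ?M) (case_prod H)"
  proof (rule Fubini_integrable[OF H_meas])
    have "(LINT u|?M. norm (case_prod H (h, u))) = \<bar>P h\<bar> * (LINT u|?M. \<bar>Q u\<bar>)" for h
      unfolding Q_shift(3)[of h, symmetric] by (simp add: H_def abs_mult)
    then show "integrable ?M (\<lambda>h. LINT u|?M. norm (case_prod H (h, u)))"
      using P by simp
    show "AE h in ?M. integrable ?M (\<lambda>u. case_prod H (h, u))"
      using Q_shift(1) by (simp add: H_def)
  qed
  have conv: "cubic_conv k (shift_mult k f g u) x = (LINT h|?M. H h u)" for u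
    unfolding cubic_conv_def H_eq ..
  show "integrable ?M (\<lambda>u. cubic_conv k (shift_mult k f g u) x)"
    unfolding conv using integrable_snd[OF H_int] by simp
  have "(LINT u|?M. cubic_conv k (shift_mult k f g u) x) = (LINT h|?M. LINT u|?M. H h u)"
    unfolding conv by (rule Fubini_integral[OF H_int])
  also have "\<dots> = (LINT h|?M. P h * (LINT u|?M. Q u))"
    using Q_shift(2) by (simp add: H_def)
  also have "\<dots> = cubic_conv k f x * cubic_conv k g x"
    by (simp add: P_def Q_def cubic_conv_def)
  finally show "cubic_conv k f x * cubic_conv k g x = (LINT u|?M. cubic_conv k (shift_mult k f g u) x)" ..
qed

text \<open>As a function of the shift, the \<open>q\<close>-th moment of \<open>f\<close> times a shift of \<open>g\<close> is a convolution, so its integral is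
  the product of the moments of \<open>f\<close> and \<open>g\<close>.\<close>

lemma
  fixes f g :: "real^'d::finite \<Rightarrow> real"
  assumes f: "f \<in> Lspace q" and g: "g \<in> Lspace q"
  shows integrable_correlation: "integrable lborel (\<lambda>v. LINT y|lborel. \<bar>f y * g (y + v)\<bar> powr q)"
    and integral_correlation: "(LINT v|lborel. LINT y|lborel. \<bar>f y * g (y + v)\<bar> powr q) =
      (LINT y|lborel. \<bar>f y\<bar> powr q) * (LINT y|lborel. \<bar>g y\<bar> powr q)"
proof -
  let ?L = "lborel :: (real^'d) measure"
  define H where "H y v = \<bar>f y * g (y + v)\<bar> powr q" for y v
  have [measurable]: "f \<in> borel_measurable borel" "g \<in> borel_measurable borel"
    using f g by (auto simp: Lspace_def)
  have gs: "integrable lborel (\<lambda>v. \<bar>g (y + v)\<bar> powr q)"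
    "(LINT v|lborel. \<bar>g (y + v)\<bar> powr q) = (LINT v|lborel. \<bar>g v\<bar> powr q)" for y
    using g integrable_lborel_plus[of "\<lambda>v. \<bar>g v\<bar> powr q" y] integral_lborel_plus[of "\<lambda>v. \<bar>g v\<bar> powr q" y]
    by (auto simp: Lspace_def)
  have H_eq: "H y v = \<bar>f y\<bar> powr q * \<bar>g (y + v)\<bar> powr q" for y v
    by (simp add: H_def abs_mult powr_mult)
  have H_meas: "case_prod H \<in> borel_measurable (?L \<Otimes>\<^sub>M ?L)" unfolding H_def by measurable
  have H_int: "integrable (?L \<Otimes>\<^sub>M ?L) (case_prod H)"
    using f by (intro lborel_pair.Fubini_integrable[OF H_meas]) (auto simp: H_eq gs Lspace_def)
  show "integrable lborel (\<lambda>v. LINT y|lborel. \<bar>f y * g (y + v)\<bar> powr q)"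
    using lborel_pair.integrable_snd[OF H_int] by (simp add: H_def)
  have "(LINT v|lborel. LINT y|lborel. H y v) = (LINT y|lborel. LINT v|lborel. H y v)"
    by (rule lborel_pair.Fubini_integral[OF H_int])
  also have "\<dots> = (LINT y|lborel. \<bar>f y\<bar> powr q) * (LINT y|lborel. \<bar>g y\<bar> powr q)"
    by (simp add: H_eq gs)
  finally show "(LINT v|lborel. LINT y|lborel. \<bar>f y * g (y + v)\<bar> powr q) =
      (LINT y|lborel. \<bar>f y\<bar> powr q) * (LINT y|lborel. \<bar>g y\<bar> powr q)"
    unfolding H_def .
qed

definition shift_mult_Lnorm ::
    "nat \<Rightarrow> ((nat \<Rightarrow> nat) \<Rightarrow> real^'d::finite \<Rightarrow> real) \<Rightarrow> ((nat \<Rightarrow> nat) \<Rightarrow> real^'d \<Rightarrow> real) \<Rightarrow>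
      (nat \<Rightarrow> real^'d) \<Rightarrow> real" where
  "shift_mult_Lnorm k f g u = (\<Prod>\<alpha>\<in>cube_nz k. Lnorm (q_exp k) (shift_mult k f g u \<alpha>))"

lemma shift_mult_Lnorm_nonneg: "shift_mult_Lnorm k f g u \<ge> 0"
  by (auto simp: shift_mult_Lnorm_def Lnorm_def intro!: prod_nonneg)

text \<open>The Brascamp-Lieb inequality applied to the correlations \<open>F\<^sub>\<alpha>(v) = \<integral> \<bar>f\<^sub>\<alpha>(y) g\<^sub>\<alpha>(y + v)\<bar> powr q dy\<close>.\<close>

lemma
  fixes f g :: "(nat \<Rightarrow> nat) \<Rightarrow> real^'d::finite \<Rightarrow> real"
  assumes k: "k \<ge> 1" and f: "\<And>\<alpha>. \<alpha> \<in> cube_nz k \<Longrightarrow> f \<alpha> \<in> Lspace (q_exp k)"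
    and g: "\<And>\<alpha>. \<alpha> \<in> cube_nz k \<Longrightarrow> g \<alpha> \<in> Lspace (q_exp k)"
  shows integrable_shift_mult_Lnorm: "integrable (PiM {1..k} (\<lambda>_. lborel)) (shift_mult_Lnorm k f g)"
    and integral_shift_mult_Lnorm_le: "(LINT u|PiM {1..k} (\<lambda>_. lborel). shift_mult_Lnorm k f g u) \<le>
      (\<Prod>\<alpha>\<in>cube_nz k. Lnorm (q_exp k) (f \<alpha>)) * (\<Prod>\<alpha>\<in>cube_nz k. Lnorm (q_exp k) (g \<alpha>))"
proof -
  let ?M = "PiM {1..k} (\<lambda>_. lborel) :: (nat \<Rightarrow> real^'d) measure"
  define F where "F \<alpha> v = (LINT y|lborel. \<bar>f \<alpha> y * g \<alpha> (y + v)\<bar> powr q_exp k)" for \<alpha> v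
  have F: "integrable lborel (F \<alpha>)" if "\<alpha> \<in> cube_nz k" for \<alpha>
    unfolding F_def by (intro integrable_correlation f g that)
  have F_nonneg: "F \<alpha> v \<ge> 0" for \<alpha> v unfolding F_def by (intro Bochner_Integration.integral_nonneg) auto
  have w_eq: "shift_mult_Lnorm k f g u = (\<Prod>\<alpha>\<in>cube_nz k. F \<alpha> (cube_dot k \<alpha> u) powr (1 / q_exp k))" for u
    by (simp add: shift_mult_Lnorm_def Lnorm_def F_def shift_mult_def)
  define W where "W = (\<Prod>\<alpha>\<in>cube_nz k. Lnorm (q_exp k) (f \<alpha>)) * (\<Prod>\<alpha>\<in>cube_nz k. Lnorm (q_exp k) (g \<alpha>))"
  have W: "W \<ge> 0" by (auto simp: W_def Lnorm_def intro!: mult_nonneg_nonneg prod_nonneg)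
  have W_eq: "(\<Prod>\<alpha>\<in>cube_nz k. (LINT v|lborel. F \<alpha> v) powr (1 / q_exp k)) = W"
    unfolding W_def prod.distrib[symmetric] Lnorm_def F_def
    by (intro prod.cong refl, subst integral_correlation)
      (auto simp: f g powr_mult Bochner_Integration.integral_nonneg)
  have le: "(\<integral>\<^sup>+u. ennreal (shift_mult_Lnorm k f g u) \<partial>?M) \<le> ennreal W"
    unfolding w_eq W_eq[symmetric] by (intro nn_integral_cube_prod_le k F F_nonneg)
  have meas: "shift_mult_Lnorm k f g \<in> borel_measurable ?M"
    unfolding w_eq[abs_def]
    by (intro borel_measurable_prod powr_real_measurable measurable_compose[OF measurable_cube_dot]
        borel_measurable_const)
      (use borel_measurable_integrable[OF F] in auto)
  show int: "integrable ?M (shift_mult_Lnorm k f g)"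
    using le meas shift_mult_Lnorm_nonneg
    by (intro integrableI_nonneg AE_I2) (auto intro: order.strict_trans1)
  have "ennreal (LINT u|?M. shift_mult_Lnorm k f g u) \<le> ennreal W"
    using le nn_integral_eq_integral[OF int AE_I2[OF shift_mult_Lnorm_nonneg]] by simp
  then show "(LINT u|?M. shift_mult_Lnorm k f g u) \<le> (\<Prod>\<alpha>\<in>cube_nz k. Lnorm (q_exp k) (f \<alpha>)) *
      (\<Prod>\<alpha>\<in>cube_nz k. Lnorm (q_exp k) (g \<alpha>))"
    using W by (simp add: W_def)
qed

section \<open>Averages in the closed convex hull\<close>

text \<open>Cover the ball by finitely many small balls and group the points by the set of those that contain them.\<close>

lemma cball_partition:
  fixes r \<eta> :: real
  assumes "\<eta> > 0"
  shows "\<exists>C :: 'a::euclidean_space set set. finite C \<and> C \<subseteq> sets borel \<and> disjoint C \<and> \<Union>C = cball 0 r \<and>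
    (\<forall>c\<in>C. \<forall>x\<in>c. \<forall>y\<in>c. dist x y < \<eta>)"
proof -
  have "compact (cball (0::'a) r)" by simp
  then obtain D :: "'a set" where D: "finite D" "cball 0 r \<subseteq> (\<Union>p\<in>D. ball p (\<eta> / 2))"
    using assms unfolding compact_eq_totally_bounded by (meson half_gt_zero)
  define near where "near x = {p \<in> D. x \<in> ball p (\<eta> / 2)}" for x
  define cell where "cell S = {x \<in> cball 0 r. near x = S}" for S
  have "cell S \<in> sets borel" if S: "S \<subseteq> D" for S
  proof -
    have "near x = S \<longleftrightarrow> (\<forall>p\<in>S. x \<in> ball p (\<eta> / 2)) \<and> (\<forall>p\<in>D - S. x \<notin> ball p (\<eta> / 2))" for x
      unfolding near_def using S by blast
    then have "cell S = cball 0 r \<inter> ((\<Inter>p\<in>S. ball p (\<eta> / 2)) \<inter> (\<Inter>p\<in>D - S. - ball p (\<eta> / 2)))"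
      unfolding cell_def by blast
    also have "\<dots> \<in> sets borel"
      using finite_subset[OF S D(1)] D(1)
      by (intro sets.Int borel_closed borel_open closed_Inter open_INT) auto
    finally show ?thesis .
  qed
  moreover have "disjoint (cell ` Pow D)"
    by (auto simp: disjoint_def cell_def)
  moreover have "\<Union>(cell ` Pow D) = cball 0 r"
    by (auto simp: cell_def near_def)
  moreover have "dist x y < \<eta>" if "x \<in> cell S" "y \<in> cell S" for S x y
  proof -
    have xy: "x \<in> cball 0 r" "near x = near y" using that by (auto simp: cell_def)
    then obtain p where "p \<in> near x" using D(2) by (auto simp: near_def)
    then have "dist p x < \<eta> / 2" "dist p y < \<eta> / 2" using xy(2) by (auto simp: near_def)
    then show ?thesis by (metis dist_commute dist_triangle_half_r)
  qed
  ultimately show ?thesis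
    using D(1) by (intro exI[of _ "cell ` Pow D"]) auto
qed

text \<open>A set of positive measure on which \<open>w\<close> exceeded its mean throughout would contradict the definition of the
  mean. For an empty set every point has the required property, as both sides are zero.\<close>

lemma exists_point_below_average:
  fixes w :: "'a \<Rightarrow> real"
  assumes Q: "Q \<in> sets M" "emeasure M Q < \<infinity>" and w: "integrable M w"
  shows "\<exists>u. (Q \<noteq> {} \<longrightarrow> u \<in> Q) \<and> measure M Q * w u \<le> (LINT u|M. indicator Q u * w u)"
proof (cases "measure M Q = 0")
  case True
  then have "emeasure M Q = 0" using Q emeasure_eq_ennreal_measure[of M Q] by auto
  then have "Q \<in> null_sets M" using Q(1) by (rule null_setsI)
  then have "AE u in M. indicator Q u * w u = 0"
    by (rule AE_mp[OF AE_not_in]) (auto intro!: AE_I2)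
  then have "(LINT u|M. indicator Q u * w u) = 0" by (rule integral_eq_zero_AE)
  then show ?thesis using True by (cases "Q = {}") auto
next
  case False
  then have m: "measure M Q > 0" by (simp add: order_less_le)
  define I where "I = (LINT u|M. indicator Q u * w u)"
  define a where "a = I / measure M Q"
  have int: "integrable M (\<lambda>u. indicator Q u * w u)" "integrable M (indicator Q :: 'a \<Rightarrow> real)"
    using Q w integrable_mult_indicator[OF Q(1) w] by auto
  have "\<exists>u\<in>Q. w u \<le> a"
  proof (rule ccontr)
    assume "\<not> ?thesis"
    then have gt: "w u > a" if "u \<in> Q" for u using that by force
    have int': "integrable M (\<lambda>u. indicator Q u * w u - a * indicator Q u)" using int by auto
    have "(LINT u|M. indicator Q u * w u - a * indicator Q u) = 0"
      using int m Q by (simp add: a_def I_def)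
    then have "AE u in M. indicator Q u * w u - a * indicator Q u = 0"
      using gt integral_nonneg_eq_0_iff_AE[OF int'] by (force simp: indicator_def)
    then have "AE u in M. u \<notin> Q"
      by (rule AE_mp) (auto intro!: AE_I2 dest: gt)
    then have "Q \<in> null_sets M" using Q(1) AE_iff_null_sets by blast
    then show False using m by (simp add: measure_def null_setsD1)
  qed
  then obtain u where "u \<in> Q" "w u \<le> a" by blast
  then have "measure M Q * w u \<le> measure M Q * a" by (intro mult_left_mono) auto
  then show ?thesis using \<open>u \<in> Q\<close> m by (auto simp: a_def I_def)
qed

lemma convex_sum_subunit:
  fixes S :: "'v::real_vector set"
  assumes S: "convex S" "0 \<in> S" and "finite I"
    and "\<And>i. i \<in> I \<Longrightarrow> c i \<ge> 0" "\<And>i. i \<in> I \<Longrightarrow> s i \<in> S" "sum c I \<le> 1"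
  shows "(\<Sum>i\<in>I. c i *\<^sub>R s i) \<in> S"
proof (cases "sum c I = 0")
  case True
  then have "c i = 0" if "i \<in> I" for i using assms that by (simp add: sum_nonneg_eq_0_iff)
  then show ?thesis using S(2) by simp
next
  case False
  have pos: "sum c I \<ge> 0" using assms by (intro sum_nonneg)
  have "(\<Sum>i\<in>I. (c i / sum c I) *\<^sub>R s i) \<in> S"
    using assms False pos by (intro convex_sum) (auto simp: sum_divide_distrib[symmetric])
  then have "sum c I *\<^sub>R (\<Sum>i\<in>I. (c i / sum c I) *\<^sub>R s i) + (1 - sum c I) *\<^sub>R 0 \<in> S"
    using assms pos by (intro convexD) auto
  then show ?thesis using False by (simp add: scaleR_sum_right)
qed

lemma apply_bcontfun_sum:
  fixes f :: "'i \<Rightarrow> 'a::topological_space \<Rightarrow>\<^sub>C 'b::real_normed_vector"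
  shows "apply_bcontfun (sum f I) x = (\<Sum>i\<in>I. apply_bcontfun (f i) x)"
  by (induction I rule: infinite_finite_induct) auto

lemma bounded_bilinear_bcontfun_mult:
  "bounded_bilinear (bcontfun_mult :: ('a::topological_space \<Rightarrow>\<^sub>C real) \<Rightarrow> _)"
proof
  have bound: "\<bar>apply_bcontfun f x\<bar> \<le> norm f" for f :: "'a \<Rightarrow>\<^sub>C real" and x
    using norm_bounded[of f x] by simp
  show "\<exists>K. \<forall>a b :: 'a \<Rightarrow>\<^sub>C real. norm (bcontfun_mult a b) \<le> norm a * norm b * K"
    by (intro exI[of _ 1] allI norm_bound)
      (auto simp: apply_bcontfun_mult abs_mult intro!: mult_mono bound)
qed (auto intro!: bcontfun_eqI simp: apply_bcontfun_mult algebra_simps)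

lemma Lspace_cmult: "f \<in> Lspace q \<Longrightarrow> (\<lambda>x. c * f x) \<in> Lspace q"
  by (auto simp: Lspace_def abs_mult powr_mult)

lemma Lnorm_cmult:
  assumes "q > 0" shows "Lnorm q (\<lambda>x. c * f x) = \<bar>c\<bar> * Lnorm q f"
  using assms by (simp add: Lnorm_def abs_mult powr_mult powr_powr Bochner_Integration.integral_nonneg)

text \<open>A scalar is absorbed by a single factor; any \<open>\<alpha>\<close> would do, and the all-ones vector is always available.\<close>

lemma cubic_conv_rescale:
  fixes f :: "(nat \<Rightarrow> nat) \<Rightarrow> real^'d::finite \<Rightarrow> real"
  assumes k: "k \<ge> 1"
    and f: "\<forall>\<alpha>\<in>cube_nz k. f \<alpha> \<in> Lspace (q_exp k) \<inter> Lspace (p_exp k)"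
  shows "\<exists>f'. (\<forall>\<alpha>\<in>cube_nz k. f' \<alpha> \<in> Lspace (q_exp k) \<inter> Lspace (p_exp k)) \<and>
    cubic_conv k f' = (\<lambda>x. c * cubic_conv k f x) \<and>
    (\<Prod>\<alpha>\<in>cube_nz k. Lnorm (q_exp k) (f' \<alpha>)) = \<bar>c\<bar> * (\<Prod>\<alpha>\<in>cube_nz k. Lnorm (q_exp k) (f \<alpha>))"
proof -
  define \<alpha>0 :: "nat \<Rightarrow> nat" where "\<alpha>0 = (\<lambda>i\<in>{1..k}. 1)"
  have \<alpha>0: "\<alpha>0 \<in> cube_nz k" using k by (auto simp: cube_nz_iff \<alpha>0_def)
  define f' where "f' \<alpha> = (if \<alpha> = \<alpha>0 then (\<lambda>x. c * f \<alpha> x) else f \<alpha>)" for \<alpha>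
  have prod_upd: "(\<Prod>\<alpha>\<in>cube_nz k. if \<alpha> = \<alpha>0 then d * t \<alpha> else t \<alpha>) = d * (\<Prod>\<alpha>\<in>cube_nz k. t \<alpha>)"
    for d :: real and t
  proof -
    have "(\<Prod>\<alpha>\<in>cube_nz k - {\<alpha>0}. if \<alpha> = \<alpha>0 then d * t \<alpha> else t \<alpha>) = (\<Prod>\<alpha>\<in>cube_nz k - {\<alpha>0}. t \<alpha>)"
      by (intro prod.cong) auto
    then show ?thesis using \<alpha>0 finite_cube_nz by (simp add: prod.remove[of _ \<alpha>0])
  qed
  show ?thesis
  proof (intro exI[of _ f'] conjI ballI)
    show "f' \<alpha> \<in> Lspace (q_exp k) \<inter> Lspace (p_exp k)" if "\<alpha> \<in> cube_nz k" for \<alpha>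
      using f that by (auto simp: f'_def intro: Lspace_cmult)
    have "(\<Prod>\<alpha>\<in>cube_nz k. f' \<alpha> (x + cube_dot k \<alpha> h)) = c * (\<Prod>\<alpha>\<in>cube_nz k. f \<alpha> (x + cube_dot k \<alpha> h))" for x h
      unfolding prod_upd[symmetric] by (intro prod.cong) (auto simp: f'_def)
    then show "cubic_conv k f' = (\<lambda>x. c * cubic_conv k f x)"
      by (simp add: cubic_conv_def fun_eq_iff)
    show "(\<Prod>\<alpha>\<in>cube_nz k. Lnorm (q_exp k) (f' \<alpha>)) = \<bar>c\<bar> * (\<Prod>\<alpha>\<in>cube_nz k. Lnorm (q_exp k) (f \<alpha>))"
      unfolding prod_upd[symmetric] using q_exp_pos[OF k]
      by (intro prod.cong) (auto simp: f'_def Lnorm_cmult)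
  qed
qed

lemma p_exp_pos: "p_exp k > 0"
  by (simp add: p_exp_def)

lemma cubic_gen_uminus:
  assumes k: "k \<ge> 1" and g: "g \<in> cubic_gen k" shows "- g \<in> cubic_gen k"
proof -
  obtain f where f: "\<forall>\<alpha>\<in>cube_nz k. f \<alpha> \<in> Lspace (q_exp k) \<inter> Lspace (p_exp k)"
    "(\<Prod>\<alpha>\<in>cube_nz k. Lnorm (q_exp k) (f \<alpha>)) \<le> 1" "apply_bcontfun g = cubic_conv k f"
    using g by (auto simp: cubic_gen_def)
  obtain f' where f': "\<forall>\<alpha>\<in>cube_nz k. f' \<alpha> \<in> Lspace (q_exp k) \<inter> Lspace (p_exp k)"
    "cubic_conv k f' = (\<lambda>x. - 1 * cubic_conv k f x)"
    "(\<Prod>\<alpha>\<in>cube_nz k. Lnorm (q_exp k) (f' \<alpha>)) = \<bar>- 1\<bar> * (\<Prod>\<alpha>\<in>cube_nz k. Lnorm (q_exp k) (f \<alpha>))"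
    using cubic_conv_rescale[OF k f(1), of "- 1"] by blast
  have "apply_bcontfun (- g) = cubic_conv k f'" unfolding f'(2) using f(3) by (simp add: fun_eq_iff)
  moreover have "(\<Prod>\<alpha>\<in>cube_nz k. Lnorm (q_exp k) (f' \<alpha>)) \<le> 1" unfolding f'(3) using f(2) by simp
  ultimately show ?thesis
    unfolding cubic_gen_def mem_Collect_eq by (intro exI[of _ f'] conjI f'(1))
qed

lemma cubic_gen_zero:
  assumes k: "k \<ge> 1" shows "0 \<in> (cubic_gen k :: ((real^'d::finite) \<Rightarrow>\<^sub>C real) set)"
proof -
  define z :: "(nat \<Rightarrow> nat) \<Rightarrow> real^'d \<Rightarrow> real" where "z = (\<lambda>_ _. 0)"
  have z: "z \<alpha> \<in> Lspace (q_exp k) \<inter> Lspace (p_exp k)" for \<alpha> by (simp add: Lspace_def z_def)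
  obtain f' where f': "\<forall>\<alpha>\<in>cube_nz k. f' \<alpha> \<in> Lspace (q_exp k) \<inter> Lspace (p_exp k)"
    "cubic_conv k f' = (\<lambda>x. 0 * cubic_conv k z x)"
    "(\<Prod>\<alpha>\<in>cube_nz k. Lnorm (q_exp k) (f' \<alpha>)) = \<bar>0\<bar> * (\<Prod>\<alpha>\<in>cube_nz k. Lnorm (q_exp k) (z \<alpha>))"
    using cubic_conv_rescale[of k z 0] k z by blast
  have "apply_bcontfun 0 = cubic_conv k f'" unfolding f'(2) by (simp add: fun_eq_iff)
  moreover have "(\<Prod>\<alpha>\<in>cube_nz k. Lnorm (q_exp k) (f' \<alpha>)) \<le> 1" unfolding f'(3) by simp
  ultimately show ?thesis
    unfolding cubic_gen_def mem_Collect_eq by (intro exI[of _ f'] conjI f'(1))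
qed

text \<open>A family whose product of norms is zero has cubic convolution product zero by the uniform bound, and
  otherwise dividing by that product gives a generator.\<close>

lemma cubic_conv_Cc_hull_multiple:
  fixes f :: "(nat \<Rightarrow> nat) \<Rightarrow> real^'d::finite \<Rightarrow> real"
  assumes k: "k \<ge> 1" and f: "\<And>\<alpha>. \<alpha> \<in> cube_nz k \<Longrightarrow> f \<alpha> \<in> Cc"
  shows "\<exists>s\<in>cubic_gen k. \<forall>x. cubic_conv k f x = (\<Prod>\<alpha>\<in>cube_nz k. Lnorm (q_exp k) (f \<alpha>)) * apply_bcontfun s x"
proof -
  define c where "c = (\<Prod>\<alpha>\<in>cube_nz k. Lnorm (q_exp k) (f \<alpha>))"
  have q: "q_exp k > 0" by (rule q_exp_pos[OF k])
  have fL: "f \<alpha> \<in> Lspace (q_exp k) \<inter> Lspace (p_exp k)" if "\<alpha> \<in> cube_nz k" for \<alpha>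
    using Cc_Lspace f[OF that] q p_exp_pos by blast
  have c: "c \<ge> 0" by (auto simp: c_def Lnorm_def intro!: prod_nonneg)
  have "\<exists>s\<in>cubic_gen k. \<forall>x. cubic_conv k f x = c * apply_bcontfun s x"
  proof (cases "c = 0")
    case True
    have "\<bar>cubic_conv k f x\<bar> \<le> c" for x
      unfolding c_def using fL by (intro cubic_conv_bound k) auto
    then show ?thesis using cubic_gen_zero[OF k] True by (intro bexI[of _ 0]) auto
  next
    case False
    obtain f' where f': "\<forall>\<alpha>\<in>cube_nz k. f' \<alpha> \<in> Lspace (q_exp k) \<inter> Lspace (p_exp k)"
      "cubic_conv k f' = (\<lambda>x. 1 / c * cubic_conv k f x)"
      "(\<Prod>\<alpha>\<in>cube_nz k. Lnorm (q_exp k) (f' \<alpha>)) = \<bar>1 / c\<bar> * c"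
      using cubic_conv_rescale[of k f "1 / c"] k fL unfolding c_def by blast
    define s where "s = (1 / c) *\<^sub>R Bcontfun (cubic_conv k f)"
    have s: "apply_bcontfun s x = 1 / c * cubic_conv k f x" for x
      by (simp add: s_def Bcontfun_inverse[OF cubic_conv_Cc_bcontfun[OF k f]])
    have "apply_bcontfun s = cubic_conv k f'" unfolding f'(2) using s by blast
    moreover have "(\<Prod>\<alpha>\<in>cube_nz k. Lnorm (q_exp k) (f' \<alpha>)) \<le> 1" unfolding f'(3) using c by simp
    ultimately have "s \<in> cubic_gen k"
      unfolding cubic_gen_def mem_Collect_eq by (intro exI[of _ f'] conjI f'(1))
    then show ?thesis using False s by (intro bexI[of _ s]) auto
  qed
  then show ?thesis unfolding c_def .
qed

text \<open>The factor of the unit vector with index \<open>i\<close> is already zero, since a point and its shift by \<open>u i\<close> cannot both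
  have norm at most \<open>R\<close>. Hence the average over \<open>u\<close> extends over a bounded set only.\<close>

lemma cubic_conv_shift_mult_eq_0:
  fixes f g :: "(nat \<Rightarrow> nat) \<Rightarrow> real^'d::finite \<Rightarrow> real"
  assumes f: "\<And>\<alpha> x. \<alpha> \<in> cube_nz k \<Longrightarrow> norm x > R \<Longrightarrow> f \<alpha> x = 0"
    and g: "\<And>\<alpha> x. \<alpha> \<in> cube_nz k \<Longrightarrow> norm x > R \<Longrightarrow> g \<alpha> x = 0"
    and i: "i \<in> {1..k}" "norm (u i) > 2 * R"
  shows "cubic_conv k (shift_mult k f g u) x = 0"
proof -
  define e :: "nat \<Rightarrow> nat" where "e = (\<lambda>l\<in>{1..k}. if l = i then 1 else 0)"
  have e: "e \<in> cube_nz k" using i(1) by (auto simp: cube_nz_iff e_def)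
  have "cube_dot k e u = (\<Sum>l = 1..k. if l = i then u l else 0)"
    unfolding cube_dot_def by (intro sum.cong) (auto simp: e_def)
  also have "\<dots> = u i" using i(1) by simp
  finally have eu: "cube_dot k e u = u i" .
  have "shift_mult k f g u e y = 0" for y
  proof -
    have "norm (u i) \<le> norm (y + u i) + norm y" by norm
    then have "norm y > R \<or> norm (y + u i) > R" using i(2) by linarith
    then show ?thesis using f[OF e] g[OF e] by (auto simp: shift_mult_def eu)
  qed
  then have "(\<Prod>\<alpha>\<in>cube_nz k. shift_mult k f g u \<alpha> (x + cube_dot k \<alpha> h)) = 0" for h
    using e finite_cube_nz by auto
  then show ?thesis by (simp add: cubic_conv_def)
qed

lemma norm_cube_dot_diff_le:
  assumes \<alpha>: "\<alpha> \<in> cube_nz k" and uv: "\<And>i. i \<in> {1..k} \<Longrightarrow> dist (u i) (v i) \<le> \<eta>"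
  shows "norm (cube_dot k \<alpha> u - cube_dot k \<alpha> v) \<le> real k * \<eta>"
proof -
  have "norm (cube_dot k \<alpha> u - cube_dot k \<alpha> v) = norm (\<Sum>i = 1..k. real (\<alpha> i) *\<^sub>R (u i - v i))"
    by (simp add: cube_dot_def scaleR_diff_right sum_subtractf)
  also have "\<dots> \<le> (\<Sum>i = 1..k. \<eta>)"
  proof (rule sum_norm_le)
    fix i assume i: "i \<in> {1..k}"
    then have "\<alpha> i = 0 \<or> \<alpha> i = 1" using \<alpha> unfolding cube_nz_iff by blast
    then have "real (\<alpha> i) * norm (u i - v i) \<le> 1 * \<eta>"
      using uv[OF i] by (intro mult_mono) (auto simp: dist_norm)
    then show "norm (real (\<alpha> i) *\<^sub>R (u i - v i)) \<le> \<eta>" by simp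
  qed
  finally show ?thesis by simp
qed

lemma shift_mult_oscillation:
  fixes f g :: "(nat \<Rightarrow> nat) \<Rightarrow> real^'d::finite \<Rightarrow> real"
  assumes k: "k \<ge> 1" and f: "\<And>\<alpha>. \<alpha> \<in> cube_nz k \<Longrightarrow> f \<alpha> \<in> Cc"
    and g: "\<And>\<alpha>. \<alpha> \<in> cube_nz k \<Longrightarrow> g \<alpha> \<in> Cc" and e: "e > 0"
  obtains \<eta> where "\<eta> > 0" "\<And>u v x. (\<And>i. i \<in> {1..k} \<Longrightarrow> dist (u i) (v i) < \<eta>) \<Longrightarrow>
    \<bar>cubic_conv k (shift_mult k f g u) x - cubic_conv k (shift_mult k f g v) x\<bar> \<le> e"
proof -
  have q: "q_exp k > 0" by (rule q_exp_pos[OF k])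
  obtain M R where MR: "M \<ge> 0" "R \<ge> 0" "\<And>\<alpha> x. \<alpha> \<in> cube_nz k \<Longrightarrow> \<bar>f \<alpha> x\<bar> \<le> M * indicator (cball 0 R) x"
    using Cc_family_bound[of k f] f by metis
  obtain M' R' where MR': "M' \<ge> 0" "R' \<ge> 0" "\<And>\<alpha> x. \<alpha> \<in> cube_nz k \<Longrightarrow> \<bar>g \<alpha> x\<bar> \<le> M' * indicator (cball 0 R') x"
    using Cc_family_bound[of k g] g by metis
  have fM: "\<bar>f \<alpha> y\<bar> \<le> M" if "\<alpha> \<in> cube_nz k" for \<alpha> y
    using MR(3)[OF that, of y] MR(1) by (cases "norm y \<le> R") auto
  have gM: "\<bar>g \<alpha> y\<bar> \<le> M'" if "\<alpha> \<in> cube_nz k" for \<alpha> y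
    using MR'(3)[OF that, of y] MR'(1) by (cases "norm y \<le> R'") auto
  obtain K where K: "K \<ge> 0" and tele: "\<And>(f :: (nat \<Rightarrow> nat) \<Rightarrow> real^'d \<Rightarrow> real) g \<delta>. \<lbrakk>\<delta> \<ge> 0;
       \<And>\<alpha>. \<alpha> \<in> cube_nz k \<Longrightarrow> f \<alpha> \<in> borel_measurable borel;
       \<And>\<alpha>. \<alpha> \<in> cube_nz k \<Longrightarrow> g \<alpha> \<in> borel_measurable borel;
       \<And>\<alpha> y. \<alpha> \<in> cube_nz k \<Longrightarrow> \<bar>f \<alpha> y\<bar> \<le> M * M' * indicator (cball 0 R) y;
       \<And>\<alpha> y. \<alpha> \<in> cube_nz k \<Longrightarrow> \<bar>g \<alpha> y\<bar> \<le> M * M' * indicator (cball 0 R) y;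
       \<And>\<alpha> y. \<alpha> \<in> cube_nz k \<Longrightarrow> \<bar>f \<alpha> y - g \<alpha> y\<bar> \<le> \<delta>\<rbrakk>
       \<Longrightarrow> telescoping_bound k f g \<le> K * \<delta>"
    using telescoping_bound_uniform[OF k mult_nonneg_nonneg[OF MR(1) MR'(1)], of R] by metis
  define e' where "e' = e / (K * M + 1)"
  have KM: "K * M + 1 > 0" using K MR(1) by (simp add: add_nonneg_pos)
  have e': "e' > 0" "K * (M * e') \<le> e"
  proof -
    show "e' > 0" using e KM by (simp add: e'_def)
    have "K * (M * e') \<le> (K * M + 1) * e'" using \<open>e' > 0\<close> by (simp add: algebra_simps)
    also have "\<dots> = e" using KM by (simp add: e'_def)
    finally show "K * (M * e') \<le> e" .
  qed
  obtain \<delta> where \<delta>: "\<delta> > 0" "\<And>\<alpha> (x :: real^'d) y. \<alpha> \<in> cube_nz k \<Longrightarrow> dist x y < \<delta> \<Longrightarrow> \<bar>g \<alpha> x - g \<alpha> y\<bar> < e'"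
    using Cc_family_uniformly_continuous[of k g e'] g e'(1) by metis
  define \<eta> where "\<eta> = \<delta> / (real k + 1)"
  have \<eta>: "\<eta> > 0" "real k * \<eta> < \<delta>" using \<delta>(1) by (auto simp: \<eta>_def field_simps)
  show thesis
  proof (rule that[OF \<eta>(1)])
    fix u v :: "nat \<Rightarrow> real^'d" and x
    assume uv: "\<And>i. i \<in> {1..k} \<Longrightarrow> dist (u i) (v i) < \<eta>"
    have bound: "\<bar>shift_mult k f g u \<alpha> y\<bar> \<le> M * M' * indicator (cball 0 R) y" if \<alpha>: "\<alpha> \<in> cube_nz k" for u \<alpha> y
    proof -
      have "\<bar>f \<alpha> y\<bar> * \<bar>g \<alpha> (y + cube_dot k \<alpha> u)\<bar> \<le> (M * indicator (cball 0 R) y) * M'"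
        using MR(1,3) \<alpha> gM by (intro mult_mono) auto
      then show ?thesis by (simp add: shift_mult_def abs_mult mult_ac)
    qed
    have diff: "\<bar>shift_mult k f g u \<alpha> y - shift_mult k f g v \<alpha> y\<bar> \<le> M * e'" if \<alpha>: "\<alpha> \<in> cube_nz k" for \<alpha> y
    proof -
      have "norm (cube_dot k \<alpha> u - cube_dot k \<alpha> v) < \<delta>"
        using norm_cube_dot_diff_le[OF \<alpha>, of u v \<eta>] uv \<eta>(2) by (force intro: less_imp_le)
      then have "\<bar>g \<alpha> (y + cube_dot k \<alpha> u) - g \<alpha> (y + cube_dot k \<alpha> v)\<bar> < e'"
        using \<delta>(2)[OF \<alpha>, of "y + cube_dot k \<alpha> u" "y + cube_dot k \<alpha> v"] by (simp add: dist_norm)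
      then have "\<bar>f \<alpha> y\<bar> * \<bar>g \<alpha> (y + cube_dot k \<alpha> u) - g \<alpha> (y + cube_dot k \<alpha> v)\<bar> \<le> M * e'"
        using fM[OF \<alpha>] MR(1) by (intro mult_mono) auto
      then show ?thesis by (simp add: shift_mult_def abs_mult[symmetric] right_diff_distrib)
    qed
    have Cc: "shift_mult k f g u \<alpha> \<in> Cc" if "\<alpha> \<in> cube_nz k" for u \<alpha>
      by (intro shift_mult_Cc f g that)
    have "\<bar>cubic_conv k (shift_mult k f g u) x - cubic_conv k (shift_mult k f g v) x\<bar> \<le>
        telescoping_bound k (shift_mult k f g u) (shift_mult k f g v)"
      by (intro cubic_conv_diff_le k Cc_Lspace[OF q] Cc)
    also have "\<dots> \<le> K * (M * e')"
      using MR(1) e'(1) by (intro tele bound diff Cc_borel[OF Cc]) auto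
    finally show "\<bar>cubic_conv k (shift_mult k f g u) x - cubic_conv k (shift_mult k f g v) x\<bar> \<le> e"
      using e'(2) by linarith
  qed
qed

lemma L_hull_convex: "convex (L_hull k)" by (simp add: L_hull_def)

lemma cubic_gen_subset_L_hull: "cubic_gen k \<subseteq> L_hull k"
  by (simp add: L_hull_def hull_subset)

text \<open>The Riemann sum argument. The box of relevant \<open>u\<close> is divided into product cells on which the averaged
  functions vary by at most \<open>e0\<close>, and each cell is represented by a point at which the weight is at most its
  mean over the cell. The Riemann sum is then a combination of generators with total coefficient at most
  \<open>1\<close> after division by \<open>T\<close>, and it differs from the product by at most \<open>e0\<close> times the volume of the box.\<close>

lemma cubic_conv_Cc_mult_in_L_bar:
  fixes f g :: "(nat \<Rightarrow> nat) \<Rightarrow> real^'d::finite \<Rightarrow> real" and a b :: "(real^'d) \<Rightarrow>\<^sub>C real"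
  assumes k: "k \<ge> 1" and f: "\<And>\<alpha>. \<alpha> \<in> cube_nz k \<Longrightarrow> f \<alpha> \<in> Cc"
    and g: "\<And>\<alpha>. \<alpha> \<in> cube_nz k \<Longrightarrow> g \<alpha> \<in> Cc"
    and a: "apply_bcontfun a = cubic_conv k f" and b: "apply_bcontfun b = cubic_conv k g"
    and T: "T > 0" "(\<Prod>\<alpha>\<in>cube_nz k. Lnorm (q_exp k) (f \<alpha>)) * (\<Prod>\<alpha>\<in>cube_nz k. Lnorm (q_exp k) (g \<alpha>)) \<le> T"
  shows "(1 / T) *\<^sub>R bcontfun_mult a b \<in> L_bar k"
  unfolding L_bar_def closure_approachable
proof (intro allI impI)
  fix e :: real assume e: "e > 0"
  let ?M = "PiM {1..k} (\<lambda>_. lborel) :: (nat \<Rightarrow> real^'d) measure"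
  let ?w = "shift_mult_Lnorm k f g"
  let ?G = "\<lambda>u x. cubic_conv k (shift_mult k f g u) x"
  have q: "q_exp k > 0" by (rule q_exp_pos[OF k])
  note fL = Cc_Lspace[OF q f] and gL = Cc_Lspace[OF q g]
  obtain M R where MR: "M \<ge> 0" "R \<ge> 0" "\<And>\<alpha> x. \<alpha> \<in> cube_nz k \<Longrightarrow> \<bar>f \<alpha> x\<bar> \<le> M * indicator (cball 0 R) x"
    using Cc_family_bound[of k f] f by metis
  obtain M' R' where MR': "M' \<ge> 0" "R' \<ge> 0" "\<And>\<alpha> x. \<alpha> \<in> cube_nz k \<Longrightarrow> \<bar>g \<alpha> x\<bar> \<le> M' * indicator (cball 0 R') x"
    using Cc_family_bound[of k g] g by metis
  define r where "r = 2 * max R R'"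
  define vol where "vol = measure ?M (\<Pi>\<^sub>E i\<in>{1..k}. cball 0 r)"
  \<comment> \<open>The summand \<open>1\<close> in the denominator guards against a box of volume zero.\<close>
  define e0 where "e0 = e * T / (2 * (vol + 1))"
  have vol: "vol \<ge> 0" by (simp add: vol_def)
  have e0: "e0 > 0" "e0 * vol / T < e"
  proof -
    show "e0 > 0" using e T(1) vol by (simp add: e0_def)
    have "e0 * vol \<le> e0 * (vol + 1)" using \<open>e0 > 0\<close> by simp
    also have "\<dots> = e * T / 2" using vol by (simp add: e0_def field_simps)
    also have "\<dots> < e * T" using e T(1) by simp
    finally show "e0 * vol / T < e" using T(1) by (simp add: pos_divide_less_eq)
  qed
  obtain \<eta> where \<eta>: "\<eta> > 0" "\<And>u v x. (\<And>i. i \<in> {1..k} \<Longrightarrow> dist (u i) (v i) < \<eta>) \<Longrightarrow> \<bar>?G u x - ?G v x\<bar> \<le> e0"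
    using shift_mult_oscillation[OF k, of f g e0] f g e0(1) by metis
  obtain C :: "(real^'d) set set" where C_fin: "finite C" and C_borel: "C \<subseteq> sets borel"
    and C_disjoint: "disjoint C" and C_cover: "\<Union>C = cball 0 r"
    and C_dist: "\<forall>c\<in>C. \<forall>x\<in>c. \<forall>y\<in>c. dist x y < \<eta>"
    using cball_partition[OF \<eta>(1)] by metis
  define Z where "Z = {1..k} \<rightarrow>\<^sub>E C"
  define Q where "Q z = (\<Pi>\<^sub>E i\<in>{1..k}. z i)" for z :: "nat \<Rightarrow> (real^'d) set"
  have Z: "finite Z" unfolding Z_def using C_fin by (intro finite_PiE) auto
  have QM: "Q z \<in> sets ?M" if "z \<in> Z" for z
    using that C_borel unfolding Q_def Z_def by (intro sets_PiM_I_finite) auto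
  have Q_sub: "Q z \<subseteq> (\<Pi>\<^sub>E i\<in>{1..k}. cball 0 r)" if "z \<in> Z" for z
    unfolding Q_def
  proof (rule PiE_mono)
    show "z i \<subseteq> cball 0 r" if "i \<in> {1..k}" for i
      using C_cover PiE_mem[OF \<open>z \<in> Z\<close>[unfolded Z_def] that] by blast
  qed
  have boxM: "(\<Pi>\<^sub>E i\<in>{1..k}. cball 0 r) \<in> sets ?M" by (intro sets_PiM_I_finite) auto
  have box_fin: "emeasure ?M (\<Pi>\<^sub>E i\<in>{1..k}. cball 0 r) < \<infinity>"
  proof -
    have "emeasure lborel (cball (0::real^'d) r) < \<infinity>" by (intro emeasure_bounded_finite) simp
    then show ?thesis by (subst lborel_prod.emeasure_PiM) (simp_all add: power_less_top_ennreal)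
  qed
  have Q_fin: "emeasure ?M (Q z) < \<infinity>" if "z \<in> Z" for z
    using emeasure_mono[OF Q_sub[OF that] boxM] box_fin by (rule le_less_trans)
  \<comment> \<open>The product cells form a partition of the box.\<close>
  have box_split: "indicator (\<Pi>\<^sub>E i\<in>{1..k}. cball 0 r) u = (\<Sum>z\<in>Z. indicator (Q z) u :: real)" for u
  proof (cases "u \<in> (\<Pi>\<^sub>E i\<in>{1..k}. cball 0 r)")
    case True
    then have "\<forall>i\<in>{1..k}. \<exists>c\<in>C. u i \<in> c" using C_cover by blast
    then obtain z0 where z0: "\<forall>i\<in>{1..k}. z0 i \<in> C \<and> u i \<in> z0 i" by metis
    define z where "z = restrict z0 {1..k}"
    have z: "z \<in> Z" "u \<in> Q z" using z0 True by (auto simp: z_def Z_def Q_def PiE_iff)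
    have "u \<in> Q z' \<longleftrightarrow> z' = z" if "z' \<in> Z" for z'
    proof
      assume "u \<in> Q z'"
      show "z' = z"
      proof (rule extensionalityI[of _ "{1..k}"])
        show "z' \<in> extensional {1..k}" "z \<in> extensional {1..k}"
          using that z(1) by (auto simp: Z_def PiE_iff)
        show "z' i = z i" if i: "i \<in> {1..k}" for i
        proof -
          have "z' i \<in> C" "z i \<in> C" "u i \<in> z' i" "u i \<in> z i"
            using \<open>u \<in> Q z'\<close> \<open>z' \<in> Z\<close> z i by (auto simp: Z_def Q_def)
          then show ?thesis using C_disjoint unfolding disjoint_def by blast
        qed
      qed
    qed (use z in simp)
    then have "(\<Sum>z'\<in>Z. indicator (Q z') u :: real) = (\<Sum>z'\<in>Z. if z' = z then 1 else 0)"
      by (intro sum.cong) auto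
    then show ?thesis using True z Z by simp
  next
    case False
    then have "u \<notin> Q z" if "z \<in> Z" for z using Q_sub[OF that] by blast
    then show ?thesis using False by (simp add: sum.neutral)
  qed
  have vol_sum: "vol = (\<Sum>z\<in>Z. measure ?M (Q z))"
  proof -
    have "vol = (LINT u|?M. indicator (\<Pi>\<^sub>E i\<in>{1..k}. cball 0 r) u)"
      using boxM by (simp add: vol_def)
    also have "\<dots> = (\<Sum>z\<in>Z. LINT u|?M. indicator (Q z) u)"
      unfolding box_split using QM Q_fin by (intro Bochner_Integration.integral_sum) auto
    also have "\<dots> = (\<Sum>z\<in>Z. measure ?M (Q z))" using QM by (intro sum.cong) auto
    finally show ?thesis .
  qed
  have w_int: "integrable ?M ?w" by (rule integrable_shift_mult_Lnorm[of k f g, OF k fL gL])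
  \<comment> \<open>The sample point of a cell has at most average weight.\<close>
  have "\<forall>z\<in>Z. \<exists>u. (Q z \<noteq> {} \<longrightarrow> u \<in> Q z) \<and> measure ?M (Q z) * ?w u \<le> (LINT u|?M. indicator (Q z) u * ?w u)"
    using QM Q_fin w_int by (intro ballI exists_point_below_average) auto
  from bchoice[OF this] obtain p where "\<forall>z\<in>Z. (Q z \<noteq> {} \<longrightarrow> p z \<in> Q z) \<and>
      measure ?M (Q z) * ?w (p z) \<le> (LINT u|?M. indicator (Q z) u * ?w u)" by blast
  then have p: "\<And>z. z \<in> Z \<Longrightarrow> Q z \<noteq> {} \<Longrightarrow> p z \<in> Q z"
    "\<And>z. z \<in> Z \<Longrightarrow> measure ?M (Q z) * ?w (p z) \<le> (LINT u|?M. indicator (Q z) u * ?w u)"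
    by blast+
  have weights: "(\<Sum>z\<in>Z. measure ?M (Q z) * ?w (p z)) \<le> T"
  proof -
    have "(\<Sum>z\<in>Z. measure ?M (Q z) * ?w (p z)) \<le> (\<Sum>z\<in>Z. LINT u|?M. indicator (Q z) u * ?w u)"
      by (intro sum_mono p(2))
    also have "\<dots> = (LINT u|?M. (\<Sum>z\<in>Z. indicator (Q z) u * ?w u))"
      using QM integrable_mult_indicator[OF _ w_int] by (intro Bochner_Integration.integral_sum[symmetric]) auto
    also have "\<dots> = (LINT u|?M. indicator (\<Pi>\<^sub>E i\<in>{1..k}. cball 0 r) u * ?w u)"
      unfolding box_split sum_distrib_right ..
    also have "\<dots> \<le> (LINT u|?M. ?w u)"
      using boxM integrable_mult_indicator[OF _ w_int] w_int shift_mult_Lnorm_nonneg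
      by (intro integral_mono mult_left_le_one_le) auto
    also have "\<dots> \<le> T" using integral_shift_mult_Lnorm_le[of k f g, OF k fL gL] T(2) by linarith
    finally show ?thesis .
  qed
  have "\<forall>z. \<exists>s\<in>cubic_gen k. \<forall>x. ?G (p z) x = ?w (p z) * apply_bcontfun s x"
    unfolding shift_mult_Lnorm_def by (intro allI cubic_conv_Cc_hull_multiple k shift_mult_Cc f g)
  then obtain s where s: "\<And>z. s z \<in> cubic_gen k" "\<And>z x. ?G (p z) x = ?w (p z) * apply_bcontfun (s z) x"
    by metis
  define S where "S = (\<Sum>z\<in>Z. (measure ?M (Q z) * ?w (p z) / T) *\<^sub>R s z)"
  have "S \<in> L_hull k"
    unfolding S_def
  proof (rule convex_sum_subunit[OF L_hull_convex])
    show "0 \<in> L_hull k" "\<And>z. s z \<in> L_hull k" using cubic_gen_zero[OF k] s(1) cubic_gen_subset_L_hull by blast+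
    show "(\<Sum>z\<in>Z. measure ?M (Q z) * ?w (p z) / T) \<le> 1"
      using weights T(1) by (simp add: sum_divide_distrib[symmetric])
  qed (use Z T(1) shift_mult_Lnorm_nonneg in \<open>auto intro!: divide_nonneg_pos mult_nonneg_nonneg\<close>)
  moreover have "dist S ((1 / T) *\<^sub>R bcontfun_mult a b) < e"
  proof -
    have "norm (apply_bcontfun (S - (1 / T) *\<^sub>R bcontfun_mult a b) x) \<le> e0 * vol / T" for x
    proof -
      have G_int: "integrable ?M (\<lambda>u. ?G u x)" by (rule integrable_cubic_conv_shift_mult[of k f g, OF k fL gL])
      have cell_int: "integrable ?M (\<lambda>u. indicator (Q z) u * ?G u x)" if "z \<in> Z" for z
        using integrable_mult_indicator[OF QM[OF that] G_int] by simp
      have "cubic_conv k f x * cubic_conv k g x = (LINT u|?M. ?G u x)"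
        by (rule cubic_conv_mult_eq_integral[of k f g, OF k fL gL])
      also have "\<dots> = (LINT u|?M. (\<Sum>z\<in>Z. indicator (Q z) u * ?G u x))"
      proof (rule Bochner_Integration.integral_cong)
        fix u assume u: "u \<in> space ?M"
        have "?G u x = indicator (\<Pi>\<^sub>E i\<in>{1..k}. cball 0 r) u * ?G u x"
        proof (cases "u \<in> (\<Pi>\<^sub>E i\<in>{1..k}. cball 0 r)")
          case False
          then obtain i where i: "i \<in> {1..k}" "norm (u i) > 2 * max R R'"
            using u by (auto simp: space_PiM PiE_iff r_def not_le)
          have "?G u x = 0"
          proof (rule cubic_conv_shift_mult_eq_0[where R = "max R R'" and i = i])
            show "f \<alpha> y = 0" if "\<alpha> \<in> cube_nz k" "norm y > max R R'" for \<alpha> y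
              using MR(3)[OF that(1), of y] that(2) by simp
            show "g \<alpha> y = 0" if "\<alpha> \<in> cube_nz k" "norm y > max R R'" for \<alpha> y
              using MR'(3)[OF that(1), of y] that(2) by simp
            show "i \<in> {1..k}" "norm (u i) > 2 * max R R'" by (fact i)+
          qed
          then show ?thesis by simp
        qed simp
        then show "?G u x = (\<Sum>z\<in>Z. indicator (Q z) u * ?G u x)"
          by (simp add: box_split sum_distrib_right)
      qed simp
      also have "\<dots> = (\<Sum>z\<in>Z. LINT u|?M. indicator (Q z) u * ?G u x)"
        using cell_int by (intro Bochner_Integration.integral_sum)
      finally have prod_eq: "cubic_conv k f x * cubic_conv k g x = (\<Sum>z\<in>Z. LINT u|?M. indicator (Q z) u * ?G u x)" .
      have cell: "\<bar>measure ?M (Q z) * ?G (p z) x - (LINT u|?M. indicator (Q z) u * ?G u x)\<bar> \<le> e0 * measure ?M (Q z)"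
        if z: "z \<in> Z" for z
      proof -
        have ind: "integrable ?M (\<lambda>u. indicator (Q z) u :: real)" using QM[OF z] Q_fin[OF z] by simp
        have cell_const: "(LINT u|?M. indicator (Q z) u * c) = measure ?M (Q z) * c" for c :: real
          using QM[OF z] by simp
        have close: "\<bar>indicator (Q z) u * ?G (p z) x - indicator (Q z) u * ?G u x\<bar> \<le> e0 * indicator (Q z) u" for u
        proof (cases "u \<in> Q z")
          case True
          then have pz: "p z \<in> Q z" using p(1)[OF z] by (metis empty_iff)
          have "dist (p z i) (u i) < \<eta>" if i: "i \<in> {1..k}" for i
          proof -
            have "z i \<in> C" using z i unfolding Z_def by (rule PiE_mem)
            moreover have "p z i \<in> z i" "u i \<in> z i"
              using PiE_mem[OF pz[unfolded Q_def] i] PiE_mem[OF True[unfolded Q_def] i] .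
            ultimately show ?thesis using C_dist by blast
          qed
          then have "\<bar>?G (p z) x - ?G u x\<bar> \<le> e0" by (rule \<eta>(2))
          then show ?thesis using True by simp
        qed simp
        have osc_int: "integrable ?M (\<lambda>u. indicator (Q z) u * ?G (p z) x - indicator (Q z) u * ?G u x)"
          by (rule Bochner_Integration.integrable_diff[OF integrable_mult_left[OF ind] cell_int[OF z]])
        have eq: "measure ?M (Q z) * ?G (p z) x - (LINT u|?M. indicator (Q z) u * ?G u x)
          = (LINT u|?M. indicator (Q z) u * ?G (p z) x - indicator (Q z) u * ?G u x)"
          unfolding cell_const[symmetric]
          by (rule Bochner_Integration.integral_diff[OF integrable_mult_left[OF ind] cell_int[OF z], symmetric])
        have "\<bar>measure ?M (Q z) * ?G (p z) x - (LINT u|?M. indicator (Q z) u * ?G u x)\<bar>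
            \<le> (LINT u|?M. \<bar>indicator (Q z) u * ?G (p z) x - indicator (Q z) u * ?G u x\<bar>)"
          unfolding eq by (rule integral_abs_bound)
        also have "\<dots> \<le> (LINT u|?M. e0 * indicator (Q z) u)"
          by (rule integral_mono[OF integrable_abs[OF osc_int] integrable_mult_right[OF ind] close])
        also have "\<dots> = e0 * measure ?M (Q z)" using QM[OF z] by simp
        finally show ?thesis .
      qed
      have "apply_bcontfun S x = (\<Sum>z\<in>Z. measure ?M (Q z) * ?G (p z) x) / T"
        by (simp add: S_def apply_bcontfun_sum s(2) sum_divide_distrib mult.assoc)
      then have eq: "apply_bcontfun (S - (1 / T) *\<^sub>R bcontfun_mult a b) x =
          (\<Sum>z\<in>Z. measure ?M (Q z) * ?G (p z) x - (LINT u|?M. indicator (Q z) u * ?G u x)) / T"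
        by (simp add: apply_bcontfun_mult a b prod_eq sum_subtractf diff_divide_distrib)
      have "\<bar>\<Sum>z\<in>Z. measure ?M (Q z) * ?G (p z) x - (LINT u|?M. indicator (Q z) u * ?G u x)\<bar>
          \<le> (\<Sum>z\<in>Z. e0 * measure ?M (Q z))"
        by (intro order_trans[OF sum_abs] sum_mono cell)
      then have "norm (apply_bcontfun (S - (1 / T) *\<^sub>R bcontfun_mult a b) x)
          \<le> (\<Sum>z\<in>Z. e0 * measure ?M (Q z)) / T"
        unfolding eq using T(1) by (simp add: abs_divide divide_right_mono)
      also have "\<dots> = e0 * vol / T" by (simp add: vol_sum sum_distrib_left)
      finally show ?thesis .
    qed
    then have "norm (S - (1 / T) *\<^sub>R bcontfun_mult a b) \<le> e0 * vol / T" by (rule norm_bound)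
    then show ?thesis using e0(2) by (simp add: dist_norm)
  qed
  ultimately show "\<exists>y\<in>L_hull k. dist y ((1 / T) *\<^sub>R bcontfun_mult a b) < e" by blast
qed

text \<open>Approximants may have a product of norms slightly above \<open>1\<close>; dividing by \<open>T n = max 1 \<dots>\<close> corrects this, and
  \<open>T n\<close> tends to \<open>1\<close>.\<close>

lemma cubic_gen_mult_in_L_bar:
  fixes a b :: "(real^'d::finite) \<Rightarrow>\<^sub>C real"
  assumes k: "k \<ge> 1" and a: "a \<in> cubic_gen k" and b: "b \<in> cubic_gen k"
  shows "bcontfun_mult a b \<in> L_bar k"
proof -
  let ?W = "\<lambda>f. \<Prod>\<alpha>\<in>cube_nz k. Lnorm (q_exp k) (f \<alpha>)"
  have q: "q_exp k > 0" by (rule q_exp_pos[OF k])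
  have W_nonneg: "?W f \<ge> 0" for f :: "_ \<Rightarrow> real^'d \<Rightarrow> real" by (auto simp: Lnorm_def intro!: prod_nonneg)
  have approx: "\<exists>\<phi> A. (\<forall>n. \<forall>\<alpha>\<in>cube_nz k. \<phi> n \<alpha> \<in> Cc) \<and> (\<forall>n. apply_bcontfun (A n) = cubic_conv k (\<phi> n)) \<and>
      A \<longlonglongrightarrow> g \<and> (\<exists>w\<in>{0..1}. (\<lambda>n. ?W (\<phi> n)) \<longlonglongrightarrow> w)"
    if g: "g \<in> cubic_gen k" for g :: "(real^'d) \<Rightarrow>\<^sub>C real"
  proof -
    obtain f where f: "\<And>\<alpha>. \<alpha> \<in> cube_nz k \<Longrightarrow> f \<alpha> \<in> Lspace (q_exp k) \<inter> Lspace (p_exp k)"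
      "?W f \<le> 1" "apply_bcontfun g = cubic_conv k f"
      using g by (auto simp: cubic_gen_def)
    have fq: "\<And>\<alpha>. \<alpha> \<in> cube_nz k \<Longrightarrow> f \<alpha> \<in> Lspace (q_exp k)" using f(1) by blast
    obtain \<phi> where \<phi>: "\<And>n \<alpha>. \<alpha> \<in> cube_nz k \<Longrightarrow> \<phi> n \<alpha> \<in> Cc"
      "(\<lambda>n. telescoping_bound k f (\<phi> n)) \<longlonglongrightarrow> 0" "(\<lambda>n. ?W (\<phi> n)) \<longlonglongrightarrow> ?W f"
      using cubic_approximation[of k f, OF k fq] by blast
    define A where "A n = Bcontfun (cubic_conv k (\<phi> n))" for n
    have A: "apply_bcontfun (A n) = cubic_conv k (\<phi> n)" for n
      unfolding A_def by (rule Bcontfun_inverse[OF cubic_conv_Cc_bcontfun[OF k \<phi>(1)]])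
    have "A \<longlonglongrightarrow> g"
    proof (rule metric_tendsto_imp_tendsto[OF \<phi>(2)], intro always_eventually allI)
      fix n
      have "norm (apply_bcontfun (g - A n) x) \<le> telescoping_bound k f (\<phi> n)" for x
        using cubic_conv_diff_le[of k f "\<phi> n" x, OF k fq Cc_Lspace[OF q \<phi>(1)]] by (simp add: A f(3))
      then have "norm (g - A n) \<le> telescoping_bound k f (\<phi> n)" by (rule norm_bound)
      then show "dist (A n) g \<le> dist (telescoping_bound k f (\<phi> n)) 0"
        by (simp add: dist_norm norm_minus_commute)
    qed
    then show ?thesis using \<phi> A f(2) W_nonneg by (intro exI[of _ \<phi>] exI[of _ A]) auto
  qed
  from approx[OF a] obtain \<phi> A v where "\<forall>n. \<forall>\<alpha>\<in>cube_nz k. \<phi> n \<alpha> \<in> Cc"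
    "\<forall>n. apply_bcontfun (A n) = cubic_conv k (\<phi> n)" "A \<longlonglongrightarrow> a" "v \<in> {0..1}" "(\<lambda>n. ?W (\<phi> n)) \<longlonglongrightarrow> v"
    by blast
  then have \<phi>: "\<And>n \<alpha>. \<alpha> \<in> cube_nz k \<Longrightarrow> \<phi> n \<alpha> \<in> Cc" "\<And>n. apply_bcontfun (A n) = cubic_conv k (\<phi> n)"
    "A \<longlonglongrightarrow> a" "0 \<le> v" "v \<le> 1" "(\<lambda>n. ?W (\<phi> n)) \<longlonglongrightarrow> v" by simp_all
  from approx[OF b] obtain \<psi> B w where "\<forall>n. \<forall>\<alpha>\<in>cube_nz k. \<psi> n \<alpha> \<in> Cc"
    "\<forall>n. apply_bcontfun (B n) = cubic_conv k (\<psi> n)" "B \<longlonglongrightarrow> b" "w \<in> {0..1}" "(\<lambda>n. ?W (\<psi> n)) \<longlonglongrightarrow> w"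
    by blast
  then have \<psi>: "\<And>n \<alpha>. \<alpha> \<in> cube_nz k \<Longrightarrow> \<psi> n \<alpha> \<in> Cc" "\<And>n. apply_bcontfun (B n) = cubic_conv k (\<psi> n)"
    "B \<longlonglongrightarrow> b" "0 \<le> w" "w \<le> 1" "(\<lambda>n. ?W (\<psi> n)) \<longlonglongrightarrow> w" by simp_all
  define T where "T n = max 1 (?W (\<phi> n) * ?W (\<psi> n))" for n
  have "v * w \<le> 1" using \<phi>(4,5) \<psi>(4,5) by (simp add: mult_le_one)
  then have "max 1 (v * w) = 1" by simp
  moreover have "T \<longlonglongrightarrow> max 1 (v * w)"
    unfolding T_def by (intro tendsto_max tendsto_mult tendsto_const \<phi>(6) \<psi>(6))
  ultimately have T: "T \<longlonglongrightarrow> 1" by simp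
  have "(\<lambda>n. (1 / T n) *\<^sub>R bcontfun_mult (A n) (B n)) \<longlonglongrightarrow> (1 / 1) *\<^sub>R bcontfun_mult a b"
    by (intro tendsto_intros bounded_bilinear.tendsto[OF bounded_bilinear_bcontfun_mult] \<phi>(3) \<psi>(3) T) simp
  moreover have "(1 / T n) *\<^sub>R bcontfun_mult (A n) (B n) \<in> L_bar k" for n
    by (rule cubic_conv_Cc_mult_in_L_bar[OF k \<phi>(1) \<psi>(1) \<phi>(2) \<psi>(2)]) (auto simp: T_def)
  moreover have "closed (L_bar k :: ((real^'d) \<Rightarrow>\<^sub>C real) set)" by (simp add: L_bar_def)
  ultimately have "(1 / 1) *\<^sub>R bcontfun_mult a b \<in> L_bar k" by (meson closed_sequentially)
  then show ?thesis by simp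
qed

section \<open>The algebra\<close>

lemma L_bar_subset:
  assumes "closed S" "convex S" "cubic_gen k \<subseteq> S" shows "L_bar k \<subseteq> S"
  unfolding L_bar_def L_hull_def using assms by (intro closure_minimal hull_minimal)

lemma cubic_gen_subset_L_bar: "cubic_gen k \<subseteq> L_bar k"
  unfolding L_bar_def using cubic_gen_subset_L_hull closure_subset by blast

lemma closed_convex_L_bar: "closed (L_bar k)" "convex (L_bar k)"
  by (auto simp: L_bar_def L_hull_convex)

lemma L_bar_subset_vimage:
  assumes "bounded_linear F" "\<And>g. g \<in> cubic_gen k \<Longrightarrow> F g \<in> L_bar k" "g \<in> L_bar k"
  shows "F g \<in> L_bar k"
proof -
  have "L_bar k \<subseteq> F -` L_bar k"
    using assms(1,2) closed_convex_L_bar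
    by (intro L_bar_subset closed_vimage convex_linear_vimage bounded_linear.linear linear_continuous_on) auto
  then show ?thesis using assms(3) by blast
qed

lemma banach_disc_L_bar:
  assumes k: "k \<ge> 1" shows "banach_disc (L_bar k :: ((real^'d::finite) \<Rightarrow>\<^sub>C real) set)"
proof
  show "0 \<in> (L_bar k :: ((real^'d) \<Rightarrow>\<^sub>C real) set)" using cubic_gen_zero[OF k] cubic_gen_subset_L_bar by blast
  have minus: "bounded_linear (uminus :: ((real^'d) \<Rightarrow>\<^sub>C real) \<Rightarrow> _)"
    using bounded_linear_minus[OF bounded_linear_ident] .
  show "- g \<in> L_bar k" if "g \<in> L_bar k" for g :: "(real^'d) \<Rightarrow>\<^sub>C real"
    using cubic_gen_uminus[OF k] cubic_gen_subset_L_bar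
    by (intro L_bar_subset_vimage[OF minus _ that]) blast
  have "(L_bar k :: ((real^'d) \<Rightarrow>\<^sub>C real) set) \<subseteq> cball 0 1"
  proof (rule L_bar_subset)
    show "(cubic_gen k :: ((real^'d) \<Rightarrow>\<^sub>C real) set) \<subseteq> cball 0 1"
    proof
      fix g :: "(real^'d) \<Rightarrow>\<^sub>C real" assume "g \<in> cubic_gen k"
      then obtain f where f: "\<And>\<alpha>. \<alpha> \<in> cube_nz k \<Longrightarrow> f \<alpha> \<in> Lspace (q_exp k)"
        "(\<Prod>\<alpha>\<in>cube_nz k. Lnorm (q_exp k) (f \<alpha>)) \<le> 1" "apply_bcontfun g = cubic_conv k f"
        by (auto simp: cubic_gen_def)
      have "norm g \<le> 1"
        using cubic_conv_bound[of k f, OF k f(1)] f(2) by (intro norm_bound) (auto simp: f(3) intro: order_trans)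
      then show "g \<in> cball 0 1" by simp
    qed
  qed auto
  then show "norm g \<le> 1" if "g \<in> L_bar k" for g :: "(real^'d) \<Rightarrow>\<^sub>C real" using that by auto
qed (auto simp: closed_convex_L_bar)

text \<open>By bilinearity and continuity, it suffices to multiply generators: extend first the right factor,
  then the left one.\<close>

lemma L_bar_mult:
  assumes k: "k \<ge> 1" and "a \<in> L_bar k" "b \<in> L_bar k" shows "bcontfun_mult a b \<in> L_bar k"
proof -
  note lin = bounded_bilinear.bounded_linear_left[OF bounded_bilinear_bcontfun_mult]
    bounded_bilinear.bounded_linear_right[OF bounded_bilinear_bcontfun_mult]
  have "bcontfun_mult a g \<in> L_bar k" if "g \<in> cubic_gen k" for g
    by (rule L_bar_subset_vimage[OF lin(1) _ assms(2)]) (rule cubic_gen_mult_in_L_bar[OF k _ that])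
  then show ?thesis by (rule L_bar_subset_vimage[OF lin(2) _ assms(3)])
qed

theorem theorem11:
  fixes k :: nat
  assumes "k \<ge> 2"
  shows "banach_algebra_on (F_space k :: ((real^'d::finite) \<Rightarrow>\<^sub>C real) set) (F_norm k) bcontfun_mult \<and>
    (\<forall>g1\<in>F_space k. \<forall>g2\<in>(F_space k :: ((real^'d) \<Rightarrow>\<^sub>C real) set).
       bcontfun_mult g1 g2 \<in> F_space k \<and>
       F_norm k (bcontfun_mult g1 g2) \<le> F_norm k g1 * F_norm k g2)"
proof -
  have k: "k \<ge> 1" using assms by simp
  interpret banach_disc "L_bar k :: ((real^'d) \<Rightarrow>\<^sub>C real) set" by (rule banach_disc_L_bar[OF k])
  have norm: "F_norm k = (minkowski_functional (L_bar k) :: ((real^'d) \<Rightarrow>\<^sub>C real) \<Rightarrow> real)"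
    by (simp add: fun_eq_iff F_norm_def minkowski_functional_def)
  have "banach_algebra_on (F_space k :: ((real^'d) \<Rightarrow>\<^sub>C real) set) (F_norm k) bcontfun_mult"
    unfolding F_space_def norm
  proof (rule banach_algebra_on_span)
    show "bcontfun_mult (bcontfun_mult u v) w = bcontfun_mult u (bcontfun_mult v w)"
      for u v w :: "(real^'d) \<Rightarrow>\<^sub>C real"
      by (auto intro!: bcontfun_eqI simp: apply_bcontfun_mult)
  qed (auto intro: bounded_bilinear_bcontfun_mult L_bar_mult[OF k])
  then show ?thesis unfolding banach_algebra_on_def by blast
qed

end
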